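(* Let $\mathbf{X}=(X_i)_{i\in\mathbb{N}}$ be a random sequence in $[-\infty,\infty]^{\mathbb{N}}$. The following are equivalent: 1. $\mathbf{X}$ is an exchangeable min-id sequence such that $X_i\in(-\infty,\infty]$ almost surely for all $i$ and $\mathbb{P}(X_{i_1}>x_1,\ldots,X_{i_d}>x_d)>0$ for all $d\in\mathbb{N}$, all $(i_1,\ldots,i_d)\in\mathbb{N}^d$ and all $(x_1,\ldots,x_d)\in\mathbb{R}^d$. 2. There exists an extended chronometer $H=(H_t)_{t\in\mathbb{R}}\in D^\infty(\mathbb{R})$ with $\mathbb{P}(\lim_{t\to-\infty}H_t=0)=1$ and $\mathbb{P}(H_t=\infty)<1$ for all $t\in\mathbb{R}$ such that $$\mathbf{X}\sim\big(\inf\{t\in\mathbb{R}\mid H_t\geq E_i\}\big)_{i\in\mathbb{N}},$$ where $(E_i)_{i\in\mathbb{N}}$ are i.i.d. unit exponential random variables independent of $H$. Moreover, the law of $H$ is uniquely determined by the law of $\mathbf{X}$.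
   Context: $\sim$ denotes equality in distribution (the random objects may live on different probability spaces); $\inf\emptyset:=\infty$. $D^\infty(\mathbb{R})$ is the space of càdlàg (right-continuous with left limits) functions $\mathbb{R}\to[-\infty,\infty]$, with the $\sigma$-algebra generated by finite-dimensional projections. A random sequence is exchangeable if for every $d$ all its $d$-dimensional marginal distributions (at distinct indices) are invariant under permutations of the coordinates. A random vector $\mathbf{X}_d\in[-\infty,\infty]^d$ is min-infinitely divisible (min-id) if for every $n\in\mathbb{N}$ there exist i.i.d. random vectors $\mathbf{X}_d^{(1,1/n)},\ldots,\mathbf{X}_d^{(n,1/n)}$ with $\mathbf{X}_d\sim\min_{1\leq i\leq n}\mathbf{X}_d^{(i,1/n)}$ (componentwise minimum). A sequence $\mathbf{X}$ is min-id if $(X_{i_1},\ldots,X_{i_d})$ is min-id for all $d\in\mathbb{N}$ and $(i_1,\ldots,i_d)\in\mathbb{N}^d$. A process $H=(H_t)_{t\in\mathbb{R}}$ with values in $[-\infty,\infty]$, such that for each $t$ either $\mathbb{P}(H_t=\infty)=0$ or $\mathbb{P}(H_t=-\infty)=0$, is infinitely divisible (id) if for every $n\in\mathbb{N}$ there are i.i.d. processes $H^{(1,1/n)},\ldots,H^{(n,1/n)}$ indexed by $\mathbb{R}$ with $H\sim\sum_{i=1}^nH^{(i,1/n)}$ (equality of finite-dimensional distributions). An extended chronometer is a non-negative, non-decreasing id-process with paths in $D^\infty(\mathbb{R})$. *)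

theory Defs
  imports "HOL-Probability.Probability"
begin

text \<open>
  Random vectors, sequences and processes are random elements of function spaces: the value of a
  process \<open>H\<close> at time \<open>t\<close> and outcome \<open>\<omega>\<close> is \<open>H \<omega> t\<close>. Values lie in \<open>[-\<infinity>, \<infinity>]\<close>, the type
  \<open>ereal\<close>. A sequence indexed by \<open>{1, 2, ...}\<close> is indexed here by the type \<open>nat\<close>, starting at 0, and
  a vector of dimension \<open>d\<close> is an element of the product over \<open>{..<d}\<close>.
\<close>

abbreviation borel_fun :: "'i set \<Rightarrow> ('i \<Rightarrow> ereal) measure" where
  "borel_fun I \<equiv> (\<Pi>\<^sub>M i\<in>I. borel)"

definition eq_in_distribution ::
  "'c measure \<Rightarrow> 'a measure \<Rightarrow> ('a \<Rightarrow> 'c) \<Rightarrow> 'b measure \<Rightarrow> ('b \<Rightarrow> 'c) \<Rightarrow> bool" where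
  "eq_in_distribution S M X N Y \<longleftrightarrow>
     X \<in> M \<rightarrow>\<^sub>M S \<and> Y \<in> N \<rightarrow>\<^sub>M S \<and> distr M S X = distr N S Y"

definition eq_fin_dim_distributions ::
  "'a measure \<Rightarrow> ('a \<Rightarrow> 'i \<Rightarrow> ereal) \<Rightarrow> 'b measure \<Rightarrow> ('b \<Rightarrow> 'i \<Rightarrow> ereal) \<Rightarrow> bool" where
  "eq_fin_dim_distributions M X N Y \<longleftrightarrow>
     (\<forall>J. finite J \<longrightarrow>
        eq_in_distribution (borel_fun J) M (\<lambda>\<omega>. restrict (X \<omega>) J) N (\<lambda>\<omega>. restrict (Y \<omega>) J))"

definition iid :: "'a measure \<Rightarrow> 'c measure \<Rightarrow> ('i \<Rightarrow> 'a \<Rightarrow> 'c) \<Rightarrow> 'i set \<Rightarrow> bool" where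
  "iid M S Y I \<longleftrightarrow>
     prob_space M \<and> prob_space.indep_vars M (\<lambda>_. S) Y I \<and>
     (\<forall>i\<in>I. \<forall>j\<in>I. distr M S (Y i) = distr M S (Y j))"

definition marginal :: "nat \<Rightarrow> (nat \<Rightarrow> nat) \<Rightarrow> (nat \<Rightarrow> ereal) \<Rightarrow> nat \<Rightarrow> ereal" where
  "marginal d i x = (\<lambda>k\<in>{..<d}. x (i k))"

definition exchangeable :: "'a measure \<Rightarrow> ('a \<Rightarrow> nat \<Rightarrow> ereal) \<Rightarrow> bool" where
  "exchangeable M X \<longleftrightarrow>
     (\<forall>d i \<pi>. inj_on i {..<d} \<longrightarrow> \<pi> permutes {..<d} \<longrightarrow>
        eq_in_distribution (borel_fun {..<d})
          M (\<lambda>\<omega>. marginal d (i \<circ> \<pi>) (X \<omega>)) M (\<lambda>\<omega>. marginal d i (X \<omega>)))"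

text \<open>
  HOL cannot quantify existentially over the type of outcomes. The existential quantifier over
  probability spaces here and in the definition of infinitely divisible processes ranges over
  measures on a type that carries the product of the \<open>n\<close> marginal laws. Every i.i.d. family on an
  arbitrary space has a copy there with the same joint law, so this loses no generality.
\<close>

definition min_id_vector :: "nat \<Rightarrow> 'a measure \<Rightarrow> ('a \<Rightarrow> nat \<Rightarrow> ereal) \<Rightarrow> bool" where
  "min_id_vector d M V \<longleftrightarrow>
     (\<forall>n\<ge>1. \<exists>(N :: (nat \<Rightarrow> nat \<Rightarrow> ereal) measure)
         (Y :: nat \<Rightarrow> (nat \<Rightarrow> nat \<Rightarrow> ereal) \<Rightarrow> nat \<Rightarrow> ereal).
        iid N (borel_fun {..<d}) Y {..<n} \<and>
        eq_in_distribution (borel_fun {..<d})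
          M V N (\<lambda>\<omega>. \<lambda>k\<in>{..<d}. MIN i\<in>{..<n}. Y i \<omega> k))"

definition min_id_sequence :: "'a measure \<Rightarrow> ('a \<Rightarrow> nat \<Rightarrow> ereal) \<Rightarrow> bool" where
  "min_id_sequence M X \<longleftrightarrow> (\<forall>d i. min_id_vector d M (\<lambda>\<omega>. marginal d i (X \<omega>)))"

text \<open>
  In HOL, \<open>\<infinity> + (-\<infinity>) = \<infinity>\<close> on \<open>ereal\<close>. This convention plays no role below: if \<open>H \<omega> t\<close> almost surely
  avoids one of the two infinite values then so do the i.i.d. summands at \<open>t\<close>, because the sum takes
  that value whenever all summands do.
\<close>

definition id_process :: "'a measure \<Rightarrow> ('a \<Rightarrow> real \<Rightarrow> ereal) \<Rightarrow> bool" where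
  "id_process M H \<longleftrightarrow>
     H \<in> M \<rightarrow>\<^sub>M borel_fun UNIV \<and>
     (\<forall>t. \<P>(\<omega> in M. H \<omega> t = \<infinity>) = 0 \<or> \<P>(\<omega> in M. H \<omega> t = -\<infinity>) = 0) \<and>
     (\<forall>n\<ge>1. \<exists>(N :: (nat \<Rightarrow> real \<Rightarrow> ereal) measure)
         (Y :: nat \<Rightarrow> (nat \<Rightarrow> real \<Rightarrow> ereal) \<Rightarrow> real \<Rightarrow> ereal).
        iid N (borel_fun UNIV) Y {..<n} \<and>
        eq_fin_dim_distributions M H N (\<lambda>\<omega> t. \<Sum>i<n. Y i \<omega> t))"

definition D_inf :: "(real \<Rightarrow> ereal) set" where
  "D_inf = {f. \<forall>t. (f \<longlongrightarrow> f t) (at_right t) \<and> (\<exists>l. (f \<longlongrightarrow> l) (at_left t))}"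

definition D_inf_space :: "(real \<Rightarrow> ereal) measure" where
  "D_inf_space = restrict_space (borel_fun UNIV) D_inf"

definition extended_chronometer :: "'a measure \<Rightarrow> ('a \<Rightarrow> real \<Rightarrow> ereal) \<Rightarrow> bool" where
  "extended_chronometer M H \<longleftrightarrow>
     H \<in> M \<rightarrow>\<^sub>M D_inf_space \<and> id_process M H \<and>
     (\<forall>\<omega>\<in>space M. (\<forall>t. 0 \<le> H \<omega> t) \<and> mono (H \<omega>))"

text \<open>On \<open>ereal\<close>, \<open>Inf {} = \<infinity>\<close>; a set of times unbounded below has infimum \<open>-\<infinity>\<close>.\<close>

definition first_passage :: "(real \<Rightarrow> ereal) \<Rightarrow> (nat \<Rightarrow> real) \<Rightarrow> nat \<Rightarrow> ereal" where
  "first_passage h e i = Inf (ereal ` {t. h t \<ge> ereal (e i)})"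

definition unit_exponentials :: "'a measure \<Rightarrow> ('a \<Rightarrow> nat \<Rightarrow> real) \<Rightarrow> bool" where
  "unit_exponentials M E \<longleftrightarrow>
     prob_space.indep_vars M (\<lambda>_. borel) (\<lambda>i \<omega>. E \<omega> i) UNIV \<and>
     (\<forall>i. distributed M lborel (\<lambda>\<omega>. E \<omega> i) (exponential_density 1))"

text \<open>
  The library's \<open>indep_var\<close> requires both random elements to take values in the same type. As there,
  independence is that of the generated \<open>\<sigma>\<close>-algebras.
\<close>

definition independent ::
  "'a measure \<Rightarrow> 'b measure \<Rightarrow> ('a \<Rightarrow> 'b) \<Rightarrow> 'c measure \<Rightarrow> ('a \<Rightarrow> 'c) \<Rightarrow> bool" where
  "independent M S X T Y \<longleftrightarrow>
     X \<in> M \<rightarrow>\<^sub>M S \<and> Y \<in> M \<rightarrow>\<^sub>M T \<and>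
     prob_space.indep_set M
       {X -` A \<inter> space M | A. A \<in> sets S} {Y -` B \<inter> space M | B. B \<in> sets T}"

definition chronometer_representation ::
  "'a measure \<Rightarrow> ('a \<Rightarrow> nat \<Rightarrow> ereal) \<Rightarrow>
   'b measure \<Rightarrow> ('b \<Rightarrow> real \<Rightarrow> ereal) \<Rightarrow> ('b \<Rightarrow> nat \<Rightarrow> real) \<Rightarrow> bool" where
  "chronometer_representation M X N H E \<longleftrightarrow>
     prob_space N \<and>
     extended_chronometer N H \<and>
     (AE \<omega> in N. (H \<omega> \<longlongrightarrow> 0) at_bot) \<and>
     (\<forall>t. \<P>(\<omega> in N. H \<omega> t = \<infinity>) < 1) \<and>
     unit_exponentials N E \<and>
     independent N D_inf_space H (\<Pi>\<^sub>M i\<in>UNIV. borel) E \<and>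
     eq_in_distribution (borel_fun UNIV) M X N (\<lambda>\<omega>. first_passage (H \<omega>) (E \<omega>))"

end

theory Submission
  imports Defs
begin

text \<open>
  Write \<open>F J x\<close> for the probability that \<open>X\<^sub>j > x\<^sub>j\<close> for all \<open>j \<in> J\<close>. A right-continuous path has not
  reached level \<open>E\<^sub>j\<close> by time \<open>x\<close> iff its first passage time exceeds \<open>x\<close>; hence the first passage
  times of \<open>H\<close> have survival function \<open>F J x = E (\<Prod>j\<in>J. exp (- H (x j)))\<close>. Allowing equal times,
  the right-hand sides are all mixed moments of the \<open>[0, 1]\<close>-valued variables \<open>exp (- H t)\<close> and so
  determine the law of \<open>H\<close>.

  Conversely an exchangeable law has this form, with \<open>exp (- H t)\<close> the limiting frequency of
  \<open>{i. X\<^sub>i > t}\<close> (de Finetti). Since minima of i.i.d. vectors multiply survival functions, and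
  sums of i.i.d. processes multiply the transforms, \<open>n\<close>-th roots of \<open>X\<close> with respect to the minimum
  correspond to \<open>n\<close>-th roots of \<open>H\<close> with respect to addition: both have survival function \<open>F\<close> to the
  power \<open>1/n\<close>.
\<close>

section \<open>Survival functions\<close>

text \<open>The transfer of n-th roots is the main obstacle, since neither side hands over an object
  of the right kind. Min-infinite divisibility supplies a root vector for each dimension separately,
  and nothing in its definition relates the dimensions. Non-negative n-th roots of numbers are
  unique, so consistency and exchangeability are inherited from \<open>X\<close>; an extension
  theorem then gives one root sequence, to which de Finetti applies. In the other direction the
  summands of \<open>H\<close> are arbitrary processes: their sign and monotonicity must be
  recovered from the sum, and hold only almost surely at each pair of times. Paths are therefore
  rebuilt from rational times, and right-continuity of the survival function, whose inequalities are
  strict, shows that this leaves the transforms unchanged. The same repair serves the limiting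
  frequencies. De Finetti is needed only at the level of survival functions, so second moments and
  transpositions suffice and no conditional expectation occurs.\<close>

definition survival :: "('i \<Rightarrow> ereal) measure \<Rightarrow> 'i set \<Rightarrow> ('i \<Rightarrow> real) \<Rightarrow> real" where
  "survival P J x = measure P {\<omega> \<in> space P. \<forall>j\<in>J. ereal (x j) < \<omega> j}"

text \<open>Extends exp(-h) continuously to \<infinity>. At -\<infinity> the convention that
  \<open>real_of_ereal\<close> is 0 there yields the value 1; hence the algebraic rules below assume
  non-negative arguments, while the value is non-negative everywhere.\<close>

definition expm :: "ereal \<Rightarrow> real" where
  "expm h = (if h = \<infinity> then 0 else exp (- real_of_ereal h))"

text \<open>The ray above \<infinity> is empty and the ray above -\<infinity> is a countable union
  of rays above -n. Boxes and first passage events come with real thresholds only.\<close>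

lemma borel_measurable_ereal_real_rays:
  fixes f :: "'a \<Rightarrow> ereal"
  assumes rays: "\<And>r. {\<omega> \<in> space M. ereal r < f \<omega>} \<in> sets M"
  shows "f \<in> borel_measurable M"
proof (rule borel_measurableI_greater)
  fix y :: ereal
  show "{\<omega> \<in> space M. y < f \<omega>} \<in> sets M"
  proof (cases y)
    case MInf
    have "{\<omega> \<in> space M. y < f \<omega>} = (\<Union>n::nat. {\<omega> \<in> space M. ereal (- real n) < f \<omega>})"
    proof (intro set_eqI iffI)
      fix \<omega> assume "\<omega> \<in> {\<omega> \<in> space M. y < f \<omega>}"
      then have \<omega>: "\<omega> \<in> space M" "- f \<omega> \<noteq> \<infinity>" using MInf by (auto simp: ereal_uminus_eq_reorder)
      obtain n where "- f \<omega> < ereal (real n)" using less_PInf_Ex_of_nat \<omega>(2) by metis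
      with \<omega> show "\<omega> \<in> (\<Union>n::nat. {\<omega> \<in> space M. ereal (- real n) < f \<omega>})"
        by (cases "f \<omega>") (auto intro!: exI[of _ n])
    qed (use MInf in auto)
    then show ?thesis using rays by auto
  qed (auto simp: rays)
qed

lemma upper_box_sets:
  assumes "finite J" "J \<subseteq> I" "sets P = sets (borel_fun I)"
  shows "{\<omega> \<in> space P. \<forall>j\<in>J. ereal (x j) < \<omega> j} \<in> sets P"
proof -
  have "{\<omega> \<in> space (borel_fun I). \<forall>j\<in>J. ereal (x j) < \<omega> j} \<in> sets (borel_fun I)"
  proof (intro sets.sets_Collect_finite_All)
    fix j assume "j \<in> J"
    then have [measurable]: "(\<lambda>\<omega>. \<omega> j) \<in> borel_measurable (borel_fun I)"
      using assms(2) by (intro measurable_component_singleton) auto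
    show "{\<omega> \<in> space (borel_fun I). ereal (x j) < \<omega> j} \<in> sets (borel_fun I)" by measurable
  qed fact
  then show ?thesis using assms(3) sets_eq_imp_space_eq[OF assms(3)] by simp
qed

lemma survival_distr:
  assumes "X \<in> M \<rightarrow>\<^sub>M borel_fun I" "finite J" "J \<subseteq> I"
  shows "survival (distr M (borel_fun I) X) J x
           = measure M {\<omega> \<in> space M. \<forall>j\<in>J. ereal (x j) < X \<omega> j}"
proof -
  have "X -` {\<omega> \<in> space (borel_fun I). \<forall>j\<in>J. ereal (x j) < \<omega> j} \<inter> space M
      = {\<omega> \<in> space M. \<forall>j\<in>J. ereal (x j) < X \<omega> j}"
    using measurable_space[OF assms(1)] by auto
  then show ?thesis
    unfolding survival_def space_distr
    using upper_box_sets[OF assms(2,3) refl, of x] assms(1)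
    by (simp add: measure_distr)
qed

text \<open>
  Coordinates left unconstrained are dropped from \<open>J\<close> rather than bounded below by \<open>-\<infinity>\<close>, so mass at
  \<open>-\<infinity>\<close> needs no separate treatment.
\<close>

lemma measure_eqI_survival:
  fixes P Q :: "('i \<Rightarrow> ereal) measure"
  assumes P: "prob_space P" "sets P = sets (borel_fun I)"
    and Q: "prob_space Q" "sets Q = sets (borel_fun I)"
    and eq: "\<And>J x. finite J \<Longrightarrow> J \<subseteq> I \<Longrightarrow> survival P J x = survival Q J x"
  shows "P = Q"
proof -
  interpret P: prob_space P by fact
  interpret Q: prob_space Q by fact
  define \<Omega> :: "('i \<Rightarrow> ereal) set" where "\<Omega> = (\<Pi>\<^sub>E i\<in>I. UNIV)"
  have sp: "space P = \<Omega>" "space Q = \<Omega>"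
    using sets_eq_imp_space_eq[OF P(2)] sets_eq_imp_space_eq[OF Q(2)]
    by (simp_all add: space_PiM \<Omega>_def)
  define box :: "'i set \<Rightarrow> ('i \<Rightarrow> real) \<Rightarrow> ('i \<Rightarrow> ereal) set"
    where "box J x = {\<omega>\<in>\<Omega>. \<forall>j\<in>J. ereal (x j) < \<omega> j}" for J x
  define E where "E = {box J x | J x. finite J \<and> J \<subseteq> I}"
  have box_sets: "box J x \<in> sets (borel_fun I)" if "finite J" "J \<subseteq> I" for J x
    using upper_box_sets[OF that P(2)] unfolding box_def sp P(2) .
  have "Int_stable E"
  proof (rule Int_stableI)
    fix a b assume "a \<in> E" "b \<in> E"
    then obtain J x J' x' where J: "finite J" "J \<subseteq> I" "a = box J x"
      and J': "finite J'" "J' \<subseteq> I" "b = box J' x'" unfolding E_def by auto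
    \<comment> \<open>On shared coordinates the larger threshold decides, so boxes over different
      index sets still intersect in a box.\<close>
    define z where "z j = (if j \<in> J then if j \<in> J' then max (x j) (x' j) else x j else x' j)" for j
    have "a \<inter> b = box (J \<union> J') z"
      unfolding J(3) J'(3) box_def
    proof (intro set_eqI iffI)
      fix \<omega> assume "\<omega> \<in> {\<omega>\<in>\<Omega>. \<forall>j\<in>J. ereal (x j) < \<omega> j} \<inter> {\<omega>\<in>\<Omega>. \<forall>j\<in>J'. ereal (x' j) < \<omega> j}"
      then show "\<omega> \<in> {\<omega>\<in>\<Omega>. \<forall>j\<in>J \<union> J'. ereal (z j) < \<omega> j}"
        by (auto simp: z_def max_def)
    next
      fix \<omega> assume *: "\<omega> \<in> {\<omega>\<in>\<Omega>. \<forall>j\<in>J \<union> J'. ereal (z j) < \<omega> j}"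
      have "ereal (x j) < \<omega> j" if "j \<in> J" for j
      proof -
        have "ereal (x j) \<le> ereal (z j)" using that by (auto simp: z_def)
        also have "\<dots> < \<omega> j" using * that by auto
        finally show ?thesis .
      qed
      moreover have "ereal (x' j) < \<omega> j" if "j \<in> J'" for j
      proof -
        have "ereal (x' j) \<le> ereal (z j)" using that by (auto simp: z_def)
        also have "\<dots> < \<omega> j" using * that by auto
        finally show ?thesis .
      qed
      ultimately show "\<omega> \<in> {\<omega>\<in>\<Omega>. \<forall>j\<in>J. ereal (x j) < \<omega> j} \<inter> {\<omega>\<in>\<Omega>. \<forall>j\<in>J'. ereal (x' j) < \<omega> j}"
        using * by auto
    qed
    then show "a \<inter> b \<in> E" unfolding E_def using J J' by auto
  qed
  have E_Pow: "E \<subseteq> Pow \<Omega>" by (auto simp: E_def box_def)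
  have gen: "sets (borel_fun I) = sigma_sets \<Omega> E"
  proof (rule antisym)
    have "(\<lambda>\<omega>. \<omega>) \<in> sigma \<Omega> E \<rightarrow>\<^sub>M borel_fun I"
    proof (rule measurable_PiM_single')
      fix i assume i: "i \<in> I"
      show "(\<lambda>\<omega>. \<omega> i) \<in> borel_measurable (sigma \<Omega> E)"
      proof (rule borel_measurable_ereal_real_rays)
        fix r
        have "{\<omega> \<in> \<Omega>. ereal r < \<omega> i} = box {i} (\<lambda>_. r)" by (auto simp: box_def)
        also have "\<dots> \<in> E" using i by (auto simp: E_def)
        finally show "{\<omega> \<in> space (sigma \<Omega> E). ereal r < \<omega> i} \<in> sets (sigma \<Omega> E)"
          using E_Pow by (auto simp: space_measure_of)
      qed
    qed (use E_Pow in \<open>auto simp: space_measure_of \<Omega>_def\<close>)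
    from measurable_sets[OF this] have "A \<inter> \<Omega> \<in> sigma_sets \<Omega> E" if "A \<in> sets (borel_fun I)" for A
      using that E_Pow by (simp add: space_measure_of sets_measure_of)
    moreover have "A \<inter> \<Omega> = A" if "A \<in> sets (borel_fun I)" for A
      using sets.sets_into_space[OF that] by (auto simp: space_PiM \<Omega>_def)
    ultimately show "sets (borel_fun I) \<subseteq> sigma_sets \<Omega> E" by auto
    have "sigma_sets (space (borel_fun I)) E \<subseteq> sets (borel_fun I)"
      by (rule sets.sigma_sets_subset) (auto simp: E_def box_sets)
    then show "sigma_sets \<Omega> E \<subseteq> sets (borel_fun I)" by (simp add: space_PiM \<Omega>_def)
  qed
  show ?thesis
  proof (rule measure_eqI_generator_eq[where A = "\<lambda>_. \<Omega>"])
    show "Int_stable E" "E \<subseteq> Pow \<Omega>" "sets P = sigma_sets \<Omega> E" "sets Q = sigma_sets \<Omega> E"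
      by (fact | simp add: P Q gen)+
    show "emeasure P X = emeasure Q X" if "X \<in> E" for X
      using that eq unfolding E_def survival_def sp box_def
      by (auto simp: P.emeasure_eq_measure Q.emeasure_eq_measure)
    have "\<Omega> = box {} (\<lambda>_. 0)" by (simp add: box_def)
    then show "range (\<lambda>_. \<Omega>) \<subseteq> E" by (auto simp: E_def)
  qed auto
qed

lemma survival_nonneg: "0 \<le> survival P J x"
  by (simp add: survival_def)

section \<open>The transform exp(-h) on [0, \<infinity>]\<close>

lemma expm_PInf [simp]: "expm \<infinity> = 0"
  by (simp add: expm_def)

lemma expm_ereal [simp]: "expm (ereal r) = exp (- r)"
  by (simp add: expm_def)

lemma expm_0 [simp]: "expm 0 = 1"
  by (simp add: zero_ereal_def del: ereal_eq_0)

lemma expm_nonneg [simp]: "0 \<le> expm h"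
  by (simp add: expm_def)

lemma expm_le_1: "0 \<le> h \<Longrightarrow> expm h \<le> 1"
  by (cases h) auto

lemma expm_measurable [measurable]: "expm \<in> borel_measurable borel"
  unfolding expm_def by measurable

lemma expm_add: "0 \<le> a \<Longrightarrow> 0 \<le> b \<Longrightarrow> expm (a + b) = expm a * expm b"
  by (cases a; cases b) (auto simp: mult_exp_exp)

lemma expm_sum:
  assumes "finite A" "\<And>i. i \<in> A \<Longrightarrow> 0 \<le> f i"
  shows "expm (\<Sum>i\<in>A. f i) = (\<Prod>i\<in>A. expm (f i))"
  using assms by (induction) (auto simp: expm_add sum_nonneg)

text \<open>The case that matters is l = \<infinity>, where continuity means that exp(-h) drops
  below a as soon as h exceeds -ln a.\<close>

lemma tendsto_expm:
  assumes lim: "(f \<longlongrightarrow> l) F" and l: "0 \<le> l" and nn: "eventually (\<lambda>x. 0 \<le> f x) F"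
  shows "((\<lambda>x. expm (f x)) \<longlongrightarrow> expm l) F"
proof (cases l)
  case (real r)
  have "((\<lambda>x. real_of_ereal (f x)) \<longlongrightarrow> r) F"
    by (rule lim_real_of_ereal[OF lim[unfolded real]])
  then have "((\<lambda>x. exp (- real_of_ereal (f x))) \<longlongrightarrow> exp (- r)) F" by (intro tendsto_exp tendsto_minus)
  moreover have "eventually (\<lambda>x. f x < \<infinity>) F" using order_tendstoD(2)[OF lim, of \<infinity>] real by simp
  then have "eventually (\<lambda>x. exp (- real_of_ereal (f x)) = expm (f x)) F"
    by eventually_elim (auto simp: expm_def)
  ultimately have "((\<lambda>x. expm (f x)) \<longlongrightarrow> exp (- r)) F" by (rule Lim_transform_eventually)
  then show ?thesis using real by simp
next
  case PInf
  show ?thesis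
  proof (rule order_tendstoI)
    fix a :: real assume "a < expm l"
    then show "eventually (\<lambda>x. a < expm (f x)) F"
      using PInf by (auto intro!: always_eventually less_le_trans[OF _ expm_nonneg])
  next
    fix a assume "expm l < a"
    then have a: "0 < a" using PInf by simp
    have "eventually (\<lambda>x. ereal (max 0 (- ln a)) < f x) F"
      by (rule order_tendstoD(1)[OF lim]) (simp add: PInf max_def)
    then show "eventually (\<lambda>x. expm (f x) < a) F"
    proof eventually_elim
      case (elim x)
      show ?case
      proof (cases "f x")
        case (real s)
        then have "- s < ln a" using elim by auto
        then have "exp (- s) < exp (ln a)" by (simp only: exp_less_cancel_iff)
        then show ?thesis using real a by simp
      qed (use elim a in auto)
    qed
  qed
qed (use l in auto)

lemma prod_expm_bounds:
  assumes "\<And>j. j \<in> J \<Longrightarrow> 0 \<le> f j"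
  shows "0 \<le> (\<Prod>j\<in>J. expm (f j))" "(\<Prod>j\<in>J. expm (f j)) \<le> 1"
  using assms by (auto intro!: prod_nonneg prod_le_1 expm_le_1)

section \<open>Moment uniqueness on the unit interval\<close>

text \<open>Weierstrass: on [0, 1] a continuous f is uniformly close to a polynomial, whose weighted
  integral is a combination of moments. The weight W serves an induction over coordinates, in which
  it carries every coordinate except the current one.\<close>

lemma integral_moments_eq_continuous:
  fixes U W :: "'a \<Rightarrow> real" and U' W' :: "'b \<Rightarrow> real"
  assumes M: "prob_space M" "U \<in> borel_measurable M" "W \<in> borel_measurable M"
      "\<And>\<omega>. \<omega> \<in> space M \<Longrightarrow> U \<omega> \<in> {0..1}" "\<And>\<omega>. \<omega> \<in> space M \<Longrightarrow> W \<omega> \<in> {0..1}"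
    and N: "prob_space N" "U' \<in> borel_measurable N" "W' \<in> borel_measurable N"
      "\<And>\<omega>. \<omega> \<in> space N \<Longrightarrow> U' \<omega> \<in> {0..1}" "\<And>\<omega>. \<omega> \<in> space N \<Longrightarrow> W' \<omega> \<in> {0..1}"
    and eq: "\<And>m. (\<integral>\<omega>. U \<omega> ^ m * W \<omega> \<partial>M) = (\<integral>\<omega>. U' \<omega> ^ m * W' \<omega> \<partial>N)"
    and f: "continuous_on UNIV f"
  shows "(\<integral>\<omega>. f (U \<omega>) * W \<omega> \<partial>M) = (\<integral>\<omega>. f (U' \<omega>) * W' \<omega> \<partial>N)"
proof -
  have [measurable]: "f \<in> borel_measurable borel" by (rule borel_measurable_continuous_onI[OF f])
  have cf: "continuous_on {0..1} f" using f by (rule continuous_on_subset) auto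
  \<comment> \<open>Stated for an arbitrary space because it is applied to \<open>M\<close> and to
    \<open>N\<close>. As Z is at most 1, the uniform error e is not enlarged by integration.\<close>
  have bnd: "\<bar>(\<integral>\<omega>. f (V \<omega>) * Z \<omega> \<partial>K) - (\<Sum>i\<le>d. a i * (\<integral>\<omega>. V \<omega> ^ i * Z \<omega> \<partial>K))\<bar> \<le> e"
    if K: "prob_space K" and [measurable]: "V \<in> borel_measurable K" "Z \<in> borel_measurable K"
      and V: "\<And>\<omega>. \<omega> \<in> space K \<Longrightarrow> V \<omega> \<in> {0..1}" and Z: "\<And>\<omega>. \<omega> \<in> space K \<Longrightarrow> Z \<omega> \<in> {0..1}"
      and a: "\<And>x. x \<in> {0..1} \<Longrightarrow> \<bar>f x - (\<Sum>i\<le>d. a i * x ^ i)\<bar> \<le> e"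
    for K :: "'c measure" and V Z and a :: "nat \<Rightarrow> real" and d e
  proof -
    interpret K: prob_space K by fact
    obtain C where C: "\<And>x. x \<in> {0..1} \<Longrightarrow> \<bar>f x\<bar> \<le> C"
      using compact_continuous_image[OF cf] compact_imp_bounded
      by (fastforce simp: bounded_iff)
    have C0: "0 \<le> C" using C[of 0] by auto
    have "\<bar>f (V \<omega>) * Z \<omega>\<bar> \<le> C * 1" if "\<omega> \<in> space K" for \<omega>
      unfolding abs_mult using V[OF that] Z[OF that] C[of "V \<omega>"] C0 by (intro mult_mono) auto
    then have i1: "integrable K (\<lambda>\<omega>. f (V \<omega>) * Z \<omega>)"
      by (intro K.integrable_const_bound[where B = C]) auto
    have "\<bar>V \<omega> ^ i * Z \<omega>\<bar> \<le> 1" if "\<omega> \<in> space K" for \<omega> i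
      using V[OF that] Z[OF that] by (auto simp: abs_mult intro!: mult_le_one power_le_one)
    then have i2: "integrable K (\<lambda>\<omega>. V \<omega> ^ i * Z \<omega>)" for i
      by (intro K.integrable_const_bound[where B = 1]) auto
    have "(\<integral>\<omega>. f (V \<omega>) * Z \<omega> \<partial>K) - (\<Sum>i\<le>d. a i * (\<integral>\<omega>. V \<omega> ^ i * Z \<omega> \<partial>K))
        = (\<integral>\<omega>. f (V \<omega>) * Z \<omega> - (\<Sum>i\<le>d. a i * (V \<omega> ^ i * Z \<omega>)) \<partial>K)"
      using i1 i2 by (subst Bochner_Integration.integral_diff) auto
    also have "\<dots> = (\<integral>\<omega>. (f (V \<omega>) - (\<Sum>i\<le>d. a i * V \<omega> ^ i)) * Z \<omega> \<partial>K)"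
      by (intro Bochner_Integration.integral_cong) (auto simp: left_diff_distrib sum_distrib_right mult.assoc)
    also have "\<bar>\<dots>\<bar> \<le> (\<integral>\<omega>. \<bar>(f (V \<omega>) - (\<Sum>i\<le>d. a i * V \<omega> ^ i)) * Z \<omega>\<bar> \<partial>K)"
      by (rule integral_abs_bound)
    also have "\<dots> \<le> (\<integral>\<omega>. e \<partial>K)"
    proof (rule integral_mono)
      have e0: "0 \<le> e" using a[of 0] by auto
      show "\<bar>(f (V \<omega>) - (\<Sum>i\<le>d. a i * V \<omega> ^ i)) * Z \<omega>\<bar> \<le> e" if "\<omega> \<in> space K" for \<omega>
      proof -
        have "\<bar>f (V \<omega>) - (\<Sum>i\<le>d. a i * V \<omega> ^ i)\<bar> * \<bar>Z \<omega>\<bar> \<le> e * 1"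
          using V[OF that] Z[OF that] e0 by (intro mult_mono a) auto
        then show ?thesis by (simp add: abs_mult)
      qed
      have "integrable K (\<lambda>\<omega>. f (V \<omega>) * Z \<omega> - (\<Sum>i\<le>d. a i * (V \<omega> ^ i * Z \<omega>)))" using i1 i2 by auto
      then show "integrable K (\<lambda>\<omega>. \<bar>(f (V \<omega>) - (\<Sum>i\<le>d. a i * V \<omega> ^ i)) * Z \<omega>\<bar>)"
        by (auto simp: left_diff_distrib sum_distrib_right mult.assoc)
    qed auto
    also have "\<dots> = e" by (simp add: K.prob_space)
    finally show ?thesis .
  qed
  show ?thesis
  proof (rule ccontr)
    assume ne: "\<not> ?thesis"
    define \<delta> where "\<delta> = \<bar>(\<integral>\<omega>. f (U \<omega>) * W \<omega> \<partial>M) - (\<integral>\<omega>. f (U' \<omega>) * W' \<omega> \<partial>N)\<bar>"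
    have \<delta>: "0 < \<delta>" using ne by (simp add: \<delta>_def)
    \<comment> \<open>Two approximation errors of \<delta>/3 cannot account for a gap of
      \<delta>.\<close>
    obtain p where p: "polynomial_function p" "\<And>x. x \<in> {0..1} \<Longrightarrow> \<bar>f x - p x\<bar> < \<delta> / 3"
      using Stone_Weierstrass_polynomial_function[of "{0..1}" f "\<delta> / 3"] cf \<delta> by auto
    then obtain a d where pa: "p = (\<lambda>x. \<Sum>i\<le>d. a i * x ^ i)"
      unfolding real_polynomial_function_eq[symmetric] real_polynomial_function_iff_sum by auto
    have a: "\<bar>f x - (\<Sum>i\<le>d. a i * x ^ i)\<bar> \<le> \<delta> / 3" if "x \<in> {0..1}" for x
      using p(2)[OF that] pa by simp
    have "\<bar>(\<integral>\<omega>. f (U \<omega>) * W \<omega> \<partial>M) - (\<Sum>i\<le>d. a i * (\<integral>\<omega>. U \<omega> ^ i * W \<omega> \<partial>M))\<bar> \<le> \<delta> / 3"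
      by (rule bnd[OF M a])
    moreover have "\<bar>(\<integral>\<omega>. f (U' \<omega>) * W' \<omega> \<partial>N) - (\<Sum>i\<le>d. a i * (\<integral>\<omega>. U' \<omega> ^ i * W' \<omega> \<partial>N))\<bar> \<le> \<delta> / 3"
      by (rule bnd[OF N a])
    ultimately have "\<delta> \<le> \<delta> / 3 + \<delta> / 3"
      unfolding eq \<delta>_def by (smt (verit))
    then show False using \<delta> by simp
  qed
qed

text \<open>Both sides are masses of B under the measures with densities W and W' pushed forward by
  U and U'. Integrals of continuous ramps give equal masses of open rays, and rays determine a
  finite measure on the reals.\<close>

lemma integral_moments_eq_indicator:
  fixes U W :: "'a \<Rightarrow> real" and U' W' :: "'b \<Rightarrow> real"
  assumes M: "prob_space M" "U \<in> borel_measurable M" "W \<in> borel_measurable M"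
      "\<And>\<omega>. \<omega> \<in> space M \<Longrightarrow> U \<omega> \<in> {0..1}" "\<And>\<omega>. \<omega> \<in> space M \<Longrightarrow> W \<omega> \<in> {0..1}"
    and N: "prob_space N" "U' \<in> borel_measurable N" "W' \<in> borel_measurable N"
      "\<And>\<omega>. \<omega> \<in> space N \<Longrightarrow> U' \<omega> \<in> {0..1}" "\<And>\<omega>. \<omega> \<in> space N \<Longrightarrow> W' \<omega> \<in> {0..1}"
    and eq: "\<And>m. (\<integral>\<omega>. U \<omega> ^ m * W \<omega> \<partial>M) = (\<integral>\<omega>. U' \<omega> ^ m * W' \<omega> \<partial>N)"
    and B: "B \<in> sets borel"
  shows "(\<integral>\<omega>. indicator B (U \<omega>) * W \<omega> \<partial>M) = (\<integral>\<omega>. indicator B (U' \<omega>) * W' \<omega> \<partial>N)"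
proof -
  have key: "emeasure (distr (density K Z) borel V) A = ennreal (\<integral>\<omega>. indicator A (V \<omega>) * Z \<omega> \<partial>K)"
    if K: "prob_space K" and [measurable]: "V \<in> borel_measurable K" "Z \<in> borel_measurable K"
      and Z: "\<And>\<omega>. \<omega> \<in> space K \<Longrightarrow> Z \<omega> \<in> {0..1}" and A[measurable]: "A \<in> sets borel"
    for K :: "'c measure" and V Z :: "'c \<Rightarrow> real" and A
  proof -
    interpret K: prob_space K by fact
    have "emeasure (distr (density K Z) borel V) A
        = (\<integral>\<^sup>+\<omega>. ennreal (Z \<omega>) * indicator (V -` A \<inter> space K) \<omega> \<partial>K)"
      by (simp add: emeasure_distr emeasure_density)
    also have "\<dots> = (\<integral>\<^sup>+\<omega>. ennreal (indicator A (V \<omega>) * Z \<omega>) \<partial>K)"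
      by (intro nn_integral_cong) (auto simp: indicator_def)
    also have "\<dots> = ennreal (\<integral>\<omega>. indicator A (V \<omega>) * Z \<omega> \<partial>K)"
    proof (rule nn_integral_eq_integral)
      have "\<bar>indicator A (V \<omega>) * Z \<omega>\<bar> \<le> 1" if "\<omega> \<in> space K" for \<omega>
        using Z[OF that] by (auto simp: indicator_def)
      then show "integrable K (\<lambda>\<omega>. indicator A (V \<omega>) * Z \<omega>)"
        by (intro K.integrable_const_bound[where B = 1]) auto
      show "AE \<omega> in K. 0 \<le> indicator A (V \<omega>) * Z \<omega>" using Z by (auto intro!: AE_I2)
    qed
    finally show ?thesis .
  qed
  note kM = key[OF M(1-3,5)] and kN = key[OF N(1-3,5)]
  have ray: "(\<integral>\<omega>. indicator {a<..} (U \<omega>) * W \<omega> \<partial>M) = (\<integral>\<omega>. indicator {a<..} (U' \<omega>) * W' \<omega> \<partial>N)"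
    for a :: real
  proof -
    \<comment> \<open>For n > 0 a continuous ramp from 0 at a to 1 at a + 1/n; the pointwise limit
      is the indicator of the open ray.\<close>
    define f :: "nat \<Rightarrow> real \<Rightarrow> real" where "f n x = max 0 (min 1 (real n * (x - a)))" for n x
    have cont: "continuous_on UNIV (f n)" for n unfolding f_def by (intro continuous_intros)
    have [measurable]: "f n \<in> borel_measurable borel" for n
      by (rule borel_measurable_continuous_onI[OF cont])
    have f01: "0 \<le> f n x" "f n x \<le> 1" for n x by (auto simp: f_def)
    have flim: "(\<lambda>n. f n x) \<longlonglongrightarrow> indicator {a<..} x" for x
    proof (cases "a < x")
      case True
      obtain n0 :: nat where n0: "1 / (x - a) < real n0" using reals_Archimedean2 by blast
      have "f n x = 1" if "n \<ge> n0" for n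
      proof -
        have "1 / (x - a) \<le> real n" using n0 that by linarith
        then have "1 \<le> real n * (x - a)" using True by (simp add: field_simps)
        then show ?thesis by (simp add: f_def)
      qed
      then have "eventually (\<lambda>n. f n x = 1) sequentially" by (auto simp: eventually_sequentially)
      then show ?thesis using True by (simp add: tendsto_eventually)
    next
      case False
      have "f n x = 0" for n
      proof -
        have "real n * (x - a) \<le> 0" using False by (intro mult_nonneg_nonpos) auto
        then show ?thesis by (simp add: f_def)
      qed
      then show ?thesis using False by simp
    qed
    have lim: "(\<lambda>n. \<integral>\<omega>. f n (V \<omega>) * Z \<omega> \<partial>K) \<longlonglongrightarrow> (\<integral>\<omega>. indicator {a<..} (V \<omega>) * Z \<omega> \<partial>K)"
      if K: "prob_space K" and [measurable]: "V \<in> borel_measurable K" "Z \<in> borel_measurable K"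
        and Z: "\<And>\<omega>. \<omega> \<in> space K \<Longrightarrow> Z \<omega> \<in> {0..1}"
      for K :: "'c measure" and V Z :: "'c \<Rightarrow> real"
    proof (rule integral_dominated_convergence[where w = "\<lambda>_. 1"])
      interpret K: prob_space K by fact
      show "integrable K (\<lambda>_. 1 :: real)" by simp
      show "AE x in K. (\<lambda>n. f n (V x) * Z x) \<longlonglongrightarrow> indicator {a<..} (V x) * Z x"
        by (intro AE_I2 tendsto_intros flim)
      show "AE x in K. norm (f n (V x) * Z x) \<le> 1" for n
        using Z f01 by (intro AE_I2) (auto simp: abs_mult intro!: mult_le_one)
    qed auto
    have "(\<integral>\<omega>. f n (U \<omega>) * W \<omega> \<partial>M) = (\<integral>\<omega>. f n (U' \<omega>) * W' \<omega> \<partial>N)" for n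
      by (rule integral_moments_eq_continuous[OF M N eq cont])
    with lim[OF M(1-3,5)] lim[OF N(1-3,5)] show ?thesis by (simp add: LIMSEQ_unique)
  qed
  have "distr (density M W) borel U = distr (density N W') borel U'"
    by (rule measure_eqI_lessThan) (auto simp: kM kN ray)
  then have "ennreal (\<integral>\<omega>. indicator B (U \<omega>) * W \<omega> \<partial>M) = ennreal (\<integral>\<omega>. indicator B (U' \<omega>) * W' \<omega> \<partial>N)"
    using B by (simp flip: kM kN)
  moreover have "0 \<le> (\<integral>\<omega>. indicator B (U \<omega>) * W \<omega> \<partial>M)" "0 \<le> (\<integral>\<omega>. indicator B (U' \<omega>) * W' \<omega> \<partial>N)"
    using M(5) N(5) by (auto intro!: integral_nonneg_AE AE_I2)
  ultimately show ?thesis by simp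
qed

text \<open>Inverse of \<open>expm\<close> on [0, \<infinity>]. Sending negative arguments to
  \<infinity> as well keeps it antitone on all reals.\<close>

definition lnm :: "real \<Rightarrow> ereal" where
  "lnm u = (if u \<le> 0 then \<infinity> else ereal (- ln u))"

lemma lnm_expm: "0 \<le> h \<Longrightarrow> lnm (expm h) = h"
  by (cases h) (auto simp: lnm_def)

lemma expm_lnm: "0 \<le> u \<Longrightarrow> expm (lnm u) = u"
  by (auto simp: lnm_def)

lemma lnm_measurable [measurable]: "lnm \<in> borel_measurable borel"
  unfolding lnm_def by measurable

lemma lnm_nonneg: "u \<le> 1 \<Longrightarrow> 0 \<le> lnm u"
  by (auto simp: lnm_def)

lemma lnm_antimono: "u \<le> v \<Longrightarrow> lnm v \<le> lnm u"
  by (auto simp: lnm_def)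

lemma borel_fun_component:
  assumes "H \<in> M \<rightarrow>\<^sub>M borel_fun UNIV"
  shows "(\<lambda>\<omega>. H \<omega> t) \<in> borel_measurable M"
  using measurable_compose[OF assms measurable_component_singleton[of t UNIV]] by simp

text \<open>Repeating the time s m times produces an m-th power, so moments in one coordinate are
  themselves mixed transforms.\<close>

lemma prod_append_const:
  fixes f :: "'t \<Rightarrow> real"
  shows "(\<Prod>k<d + m. f (if k < d then t k else s)) = (\<Prod>k<d. f (t k)) * f s ^ m"
  by (induction m) (auto intro!: prod.cong)

text \<open>Coordinates are converted one at a time from exponential factors to indicators. At each
  stage the indicators already obtained and the remaining exponential factors form the weight in the
  one-dimensional moment argument.\<close>

lemma process_law_eqI:
  fixes H :: "'a \<Rightarrow> 't \<Rightarrow> ereal" and H' :: "'b \<Rightarrow> 't \<Rightarrow> ereal"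
  assumes M: "prob_space M" "H \<in> M \<rightarrow>\<^sub>M borel_fun UNIV" "\<And>\<omega> t. \<omega> \<in> space M \<Longrightarrow> 0 \<le> H \<omega> t"
    and N: "prob_space N" "H' \<in> N \<rightarrow>\<^sub>M borel_fun UNIV" "\<And>\<omega> t. \<omega> \<in> space N \<Longrightarrow> 0 \<le> H' \<omega> t"
    and eq: "\<And>(d :: nat) t. (\<integral>\<omega>. (\<Prod>k<d. expm (H \<omega> (t k))) \<partial>M) = (\<integral>\<omega>. (\<Prod>k<d. expm (H' \<omega> (t k))) \<partial>N)"
  shows "distr M (borel_fun UNIV) H = distr N (borel_fun UNIV) H'"
proof -
  interpret M: prob_space M by fact
  interpret N: prob_space N by fact
  note [measurable] = borel_fun_component[OF M(2)] borel_fun_component[OF N(2)] M(2) N(2)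
  \<comment> \<open>The numbers d and the times t stay arbitrary in the induction: the m-th moment
    at the new time s calls the hypothesis for d + m times.\<close>
  have eqJ: "(\<integral>\<omega>. (\<Prod>j\<in>J. indicator (A j) (H \<omega> j)) * (\<Prod>k<d. expm (H \<omega> (t k))) \<partial>M)
      = (\<integral>\<omega>. (\<Prod>j\<in>J. indicator (A j) (H' \<omega> j)) * (\<Prod>k<d. expm (H' \<omega> (t k))) \<partial>N)"
    if "finite J" and "\<And>j. j \<in> J \<Longrightarrow> A j \<in> sets borel"
    for J :: "'t set" and A and d :: nat and t
    using that
  proof (induction J arbitrary: d t rule: finite_induct)
    case empty
    then show ?case using eq by simp
  next
    case (insert s J)
    have A[measurable]: "\<And>j. j \<in> J \<Longrightarrow> A j \<in> sets borel" "A s \<in> sets borel"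
      using insert.prems by auto
    \<comment> \<open>\<open>expm\<close> is injective on [0, \<infinity>], so an event for H s
      becomes an event for the variable exp(-H s), which lies in [0, 1].\<close>
    define B where "B = lnm -` A s"
    have B: "B \<in> sets borel"
      using measurable_sets[OF lnm_measurable A(2)] by (simp add: B_def)
    have ind: "indicator (A s) h = (indicator B (expm h) :: real)" if "0 \<le> h" for h
      using lnm_expm[OF that] by (simp add: B_def indicator_def)
    define W where "W \<omega> = (\<Prod>j\<in>J. indicator (A j) (H \<omega> j)) * (\<Prod>k<d. expm (H \<omega> (t k)))" for \<omega>
    define W' where "W' \<omega> = (\<Prod>j\<in>J. indicator (A j) (H' \<omega> j)) * (\<Prod>k<d. expm (H' \<omega> (t k)))" for \<omega>
    have [measurable]: "W \<in> borel_measurable M" "W' \<in> borel_measurable N"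
      unfolding W_def W'_def by measurable
    have W01: "W \<omega> \<in> {0..1}" if "\<omega> \<in> space M" for \<omega>
      using prod_expm_bounds[of "{..<d}" "\<lambda>k. H \<omega> (t k)"] M(3)[OF that]
      by (auto simp: W_def intro!: mult_le_one prod_nonneg prod_le_1 mult_nonneg_nonneg)
    have W'01: "W' \<omega> \<in> {0..1}" if "\<omega> \<in> space N" for \<omega>
      using prod_expm_bounds[of "{..<d}" "\<lambda>k. H' \<omega> (t k)"] N(3)[OF that]
      by (auto simp: W'_def intro!: mult_le_one prod_nonneg prod_le_1 mult_nonneg_nonneg)
    have "(\<integral>\<omega>. indicator B (expm (H \<omega> s)) * W \<omega> \<partial>M) = (\<integral>\<omega>. indicator B (expm (H' \<omega> s)) * W' \<omega> \<partial>N)"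
    proof (rule integral_moments_eq_indicator[OF M(1) _ _ _ W01 N(1) _ _ _ W'01 _ B])
      fix m
      have "(\<integral>\<omega>. expm (H \<omega> s) ^ m * W \<omega> \<partial>M)
          = (\<integral>\<omega>. (\<Prod>j\<in>J. indicator (A j) (H \<omega> j)) * (\<Prod>k<d + m. expm (H \<omega> (if k < d then t k else s))) \<partial>M)"
        unfolding prod_append_const[of "\<lambda>t. expm (H _ t)"] W_def by (simp add: mult_ac)
      also have "\<dots> = (\<integral>\<omega>. (\<Prod>j\<in>J. indicator (A j) (H' \<omega> j)) * (\<Prod>k<d + m. expm (H' \<omega> (if k < d then t k else s))) \<partial>N)"
        using insert.prems by (intro insert.IH) auto
      also have "\<dots> = (\<integral>\<omega>. expm (H' \<omega> s) ^ m * W' \<omega> \<partial>N)"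
        unfolding prod_append_const[of "\<lambda>t. expm (H' _ t)"] W'_def by (simp add: mult_ac)
      finally show "(\<integral>\<omega>. expm (H \<omega> s) ^ m * W \<omega> \<partial>M) = (\<integral>\<omega>. expm (H' \<omega> s) ^ m * W' \<omega> \<partial>N)" .
    qed (use M(3) N(3) in \<open>auto simp: expm_le_1\<close>)
    moreover have "(\<integral>\<omega>. (\<Prod>j\<in>insert s J. indicator (A j) (H \<omega> j)) * (\<Prod>k<d. expm (H \<omega> (t k))) \<partial>M)
        = (\<integral>\<omega>. indicator B (expm (H \<omega> s)) * W \<omega> \<partial>M)"
      using insert.hyps M(3) by (intro Bochner_Integration.integral_cong) (auto simp: W_def ind mult_ac)
    moreover have "(\<integral>\<omega>. (\<Prod>j\<in>insert s J. indicator (A j) (H' \<omega> j)) * (\<Prod>k<d. expm (H' \<omega> (t k))) \<partial>N)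
        = (\<integral>\<omega>. indicator B (expm (H' \<omega> s)) * W' \<omega> \<partial>N)"
      using insert.hyps N(3) by (intro Bochner_Integration.integral_cong) (auto simp: W'_def ind mult_ac)
    ultimately show ?case by simp
  qed
  have emb: "emeasure (distr K (borel_fun UNIV) G) (prod_emb UNIV (\<lambda>_. borel) J (Pi\<^sub>E J A))
      = ennreal (\<integral>\<omega>. (\<Prod>j\<in>J. indicator (A j) (G \<omega> j)) \<partial>K)"
    if K: "prob_space K" and G[measurable]: "G \<in> K \<rightarrow>\<^sub>M borel_fun UNIV"
      and J: "finite J" and A[measurable]: "\<And>j. j \<in> J \<Longrightarrow> A j \<in> sets borel"
    for K :: "'c measure" and G and J :: "'t set" and A
  proof -
    interpret K: prob_space K by fact
    note [measurable] = borel_fun_component[OF G]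
    have "prod_emb UNIV (\<lambda>_. borel) J (Pi\<^sub>E J A) \<in> sets (borel_fun UNIV)"
      using J by (intro sets_PiM_I) auto
    then have "emeasure (distr K (borel_fun UNIV) G) (prod_emb UNIV (\<lambda>_. borel) J (Pi\<^sub>E J A))
      = emeasure K (G -` prod_emb UNIV (\<lambda>_. borel) J (Pi\<^sub>E J A) \<inter> space K)"
      by (simp add: emeasure_distr)
    also have "G -` prod_emb UNIV (\<lambda>_. borel) J (Pi\<^sub>E J A) \<inter> space K = {\<omega> \<in> space K. \<forall>j\<in>J. G \<omega> j \<in> A j}"
      by (auto simp: prod_emb_def)
    also have "emeasure K {\<omega> \<in> space K. \<forall>j\<in>J. G \<omega> j \<in> A j}
        = ennreal (\<integral>\<omega>. indicator {\<omega> \<in> space K. \<forall>j\<in>J. G \<omega> j \<in> A j} \<omega> \<partial>K)"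
      using J by (simp add: K.emeasure_eq_measure)
    also have "(\<integral>\<omega>. indicat_real {\<omega> \<in> space K. \<forall>j\<in>J. G \<omega> j \<in> A j} \<omega> \<partial>K)
        = (\<integral>\<omega>. (\<Prod>j\<in>J. indicator (A j) (G \<omega> j)) \<partial>K)"
      using J by (intro Bochner_Integration.integral_cong) (auto simp: indicator_def prod_zero_iff)
    finally show ?thesis .
  qed
  show ?thesis
  proof (rule measure_eqI_PiM_infinite[where M = "\<lambda>_. borel"])
    fix A :: "'t \<Rightarrow> ereal set" and J assume J: "finite J" "\<And>i. i \<in> J \<Longrightarrow> A i \<in> sets borel"
    have "(\<integral>\<omega>. (\<Prod>j\<in>J. indicat_real (A j) (H \<omega> j)) * (\<Prod>k<(0::nat). expm (H \<omega> (t k))) \<partial>M)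
      = (\<integral>\<omega>. (\<Prod>j\<in>J. indicat_real (A j) (H' \<omega> j)) * (\<Prod>k<(0::nat). expm (H' \<omega> (t k))) \<partial>N)" for t
      by (rule eqJ) (use J in auto)
    with J show "emeasure (distr M (borel_fun UNIV) H) (prod_emb UNIV (\<lambda>_. borel) J (Pi\<^sub>E J A))
       = emeasure (distr N (borel_fun UNIV) H') (prod_emb UNIV (\<lambda>_. borel) J (Pi\<^sub>E J A))"
      by (simp add: emb M(1,2) N(1,2))
  next
    show "finite_measure (distr M (borel_fun UNIV) H)"
      by (intro prob_space.finite_measure M.prob_space_distr M(2))
  qed auto
qed

section \<open>First passage times\<close>

definition chron_paths :: "(real \<Rightarrow> ereal) set" where
  "chron_paths = {h. (\<forall>t. 0 \<le> h t) \<and> mono h \<and> (\<forall>t. (h \<longlongrightarrow> h t) (at_right t))}"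

lemma chron_paths_nonneg: "h \<in> chron_paths \<Longrightarrow> 0 \<le> h t"
  by (simp add: chron_paths_def)

lemma chron_paths_mono: "h \<in> chron_paths \<Longrightarrow> s \<le> t \<Longrightarrow> h s \<le> h t"
  by (auto simp: chron_paths_def mono_def)

text \<open>Left limits come free with monotonicity: in the complete lattice of extended reals the
  supremum over s < t is the limit.\<close>

lemma chron_paths_subset_D_inf: "chron_paths \<subseteq> D_inf"
proof
  fix h assume h: "h \<in> chron_paths"
  have "\<exists>l. (h \<longlongrightarrow> l) (at_left t)" for t
  proof
    show "(h \<longlongrightarrow> (SUP s\<in>{..<t}. h s)) (at_left t)"
    proof (rule order_tendstoI)
      fix a assume "a < (SUP s\<in>{..<t}. h s)"
      then obtain s where s: "s < t" "a < h s" by (auto simp: less_SUP_iff)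
      have "eventually (\<lambda>u. u \<in> {s<..<t}) (at_left t)" by (rule eventually_at_left_real[OF s(1)])
      then show "eventually (\<lambda>u. a < h u) (at_left t)"
        by eventually_elim (use s chron_paths_mono[OF h] in \<open>auto intro: less_le_trans\<close>)
    next
      fix a assume a: "(SUP s\<in>{..<t}. h s) < a"
      have "eventually (\<lambda>u. u < t) (at_left t)" by (simp add: eventually_at_filter)
      then show "eventually (\<lambda>u. h u < a) (at_left t)"
        by eventually_elim (use a in \<open>auto intro: le_less_trans[OF SUP_upper]\<close>)
    qed
  qed
  then show "h \<in> D_inf" using h by (auto simp: chron_paths_def D_inf_def)
qed

text \<open>By right-continuity a level unreached at x stays unreached on an interval after x, which
  separates the infimum strictly from x. The equivalence holds for every path, so events for first
  passages become events for H and E without null sets.\<close>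

lemma less_first_passage_iff:
  assumes h: "h \<in> chron_paths"
  shows "ereal x < first_passage h e i \<longleftrightarrow> h x < ereal (e i)"
proof
  assume less: "ereal x < first_passage h e i"
  show "h x < ereal (e i)"
  proof (rule ccontr)
    assume "\<not> h x < ereal (e i)"
    then have "first_passage h e i \<le> ereal x"
      unfolding first_passage_def by (intro INF_lower) auto
    with less show False by simp
  qed
next
  assume "h x < ereal (e i)"
  moreover have "(h \<longlongrightarrow> h x) (at_right x)" using h by (simp add: chron_paths_def)
  ultimately have "eventually (\<lambda>u. h u < ereal (e i)) (at_right x)" by (rule order_tendstoD(2)[rotated])
  then obtain b where b: "x < b" "\<And>u. x < u \<Longrightarrow> u < b \<Longrightarrow> h u < ereal (e i)"
    unfolding eventually_at_right_field by auto
  \<comment> \<open>A point strictly between x and b: the level is still unreached there, and the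
    point lies strictly above x.\<close>
  have "ereal ((x + b) / 2) \<le> first_passage h e i"
    unfolding first_passage_def
  proof (rule INF_greatest)
    fix t assume t: "t \<in> {t. ereal (e i) \<le> h t}"
    show "ereal ((x + b) / 2) \<le> ereal t"
    proof (rule ccontr)
      assume "\<not> ereal ((x + b) / 2) \<le> ereal t"
      then have "h t \<le> h ((x + b) / 2)" by (intro chron_paths_mono[OF h]) auto
      moreover have "h ((x + b) / 2) < ereal (e i)" using b(1) by (intro b(2)) (auto simp: field_simps)
      ultimately show False using t by auto
    qed
  qed
  moreover have "ereal x < ereal ((x + b) / 2)" using b(1) by simp
  ultimately show "ereal x < first_passage h e i" by (rule less_le_trans[rotated])
qed

lemma D_inf_space_imp_borel_fun:
  "H \<in> M \<rightarrow>\<^sub>M D_inf_space \<Longrightarrow> H \<in> M \<rightarrow>\<^sub>M borel_fun UNIV"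
  unfolding D_inf_space_def by (rule measurable_restrict_space2_iff[THEN iffD1, THEN conjunct1])

text \<open>For a single j this is the exponential tail, with c j = \<infinity> contributing the
  factor 0; independence multiplies the tails.\<close>

lemma prob_exponential_exceeds:
  assumes "prob_space N" "unit_exponentials N E" "finite J" and c: "\<And>j. j \<in> J \<Longrightarrow> 0 \<le> c j"
  shows "measure N {\<omega> \<in> space N. \<forall>j\<in>J. c j < ereal (E \<omega> j)} = (\<Prod>j\<in>J. expm (c j))"
proof (cases "J = {}")
  case True
  then show ?thesis using assms(1) by (simp add: prob_space.prob_space)
next
  case False
  interpret prob_space N by fact
  have iv: "indep_vars (\<lambda>_. borel) (\<lambda>i \<omega>. E \<omega> i) UNIV"
    and dist: "\<And>i. distributed N lborel (\<lambda>\<omega>. E \<omega> i) (exponential_density 1)"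
    using assms(2) by (auto simp: unit_exponentials_def)
  define A where "A j = {r. c j < ereal r}" for j
  have one: "prob {\<omega> \<in> space N. c j < ereal (E \<omega> j)} = expm (c j)" if "j \<in> J" for j
  proof (cases "c j")
    case (real r)
    then have "0 \<le> r" using c[OF that] by simp
    from exponential_distributedD_gt[OF dist[of j] this] show ?thesis by (simp add: real)
  qed (use c[OF that] in auto)
  have "prob (\<Inter>j\<in>J. (\<lambda>\<omega>. E \<omega> j) -` A j \<inter> space N) = (\<Prod>j\<in>J. prob ((\<lambda>\<omega>. E \<omega> j) -` A j \<inter> space N))"
    by (rule indep_varsD[OF iv]) (use False assms(3) in \<open>auto simp: A_def\<close>)
  also have "(\<Inter>j\<in>J. (\<lambda>\<omega>. E \<omega> j) -` A j \<inter> space N) = {\<omega> \<in> space N. \<forall>j\<in>J. c j < ereal (E \<omega> j)}"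
    using False by (auto simp: A_def)
  also have "(\<Prod>j\<in>J. prob ((\<lambda>\<omega>. E \<omega> j) -` A j \<inter> space N)) = (\<Prod>j\<in>J. expm (c j))"
    by (intro prod.cong refl) (auto simp: A_def one[symmetric] intro!: arg_cong[where f = prob])
  finally show ?thesis .
qed

text \<open>Independence of the generated \<sigma>-algebras is the product formula on rectangles,
  and rectangles determine a product of probability measures. This allows E to be integrated out
  with H held fixed.\<close>

lemma independent_joint_law:
  assumes "prob_space N" "independent N S X T Y"
  shows "distr N (S \<Otimes>\<^sub>M T) (\<lambda>\<omega>. (X \<omega>, Y \<omega>)) = distr N S X \<Otimes>\<^sub>M distr N T Y"
proof -
  interpret prob_space N by fact
  have X[measurable]: "X \<in> N \<rightarrow>\<^sub>M S" and Y[measurable]: "Y \<in> N \<rightarrow>\<^sub>M T"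
    and ind: "indep_set {X -` A \<inter> space N | A. A \<in> sets S} {Y -` B \<inter> space N | B. B \<in> sets T}"
    using assms(2) by (auto simp: independent_def)
  interpret X: prob_space "distr N S X" by (rule prob_space_distr) simp
  interpret Y: prob_space "distr N T Y" by (rule prob_space_distr) simp
  show ?thesis
  proof (rule pair_measure_eqI[symmetric])
    fix A B assume "A \<in> sets (distr N S X)" "B \<in> sets (distr N T Y)"
    then have A[measurable]: "A \<in> sets S" and B[measurable]: "B \<in> sets T" by auto
    have "(\<lambda>\<omega>. (X \<omega>, Y \<omega>)) -` (A \<times> B) \<inter> space N = (X -` A \<inter> space N) \<inter> (Y -` B \<inter> space N)" by auto
    moreover have "prob ((X -` A \<inter> space N) \<inter> (Y -` B \<inter> space N))
       = prob (X -` A \<inter> space N) * prob (Y -` B \<inter> space N)"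
      by (rule indep_setD[OF ind]) (use A B in auto)
    ultimately show "emeasure (distr N S X) A * emeasure (distr N T Y) B
        = emeasure (distr N (S \<Otimes>\<^sub>M T) (\<lambda>\<omega>. (X \<omega>, Y \<omega>))) (A \<times> B)"
      by (simp add: emeasure_distr emeasure_eq_measure ennreal_mult)
  qed (simp_all add: X.sigma_finite_measure_axioms Y.sigma_finite_measure_axioms cong: sets_pair_measure_cong)
qed

text \<open>With the path of H frozen, the events are independent exponential tails at the levels H
  (x j); Fubini then averages over the path.\<close>

lemma first_passage_survival:
  assumes N: "prob_space N" and paths: "\<And>\<omega>. \<omega> \<in> space N \<Longrightarrow> H \<omega> \<in> chron_paths"
    and E: "unit_exponentials N E" and ind: "independent N D_inf_space H (\<Pi>\<^sub>M i\<in>UNIV. borel) E"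
    and J: "finite J"
  shows "measure N {\<omega> \<in> space N. \<forall>j\<in>J. ereal (x j) < first_passage (H \<omega>) (E \<omega>) j}
       = (\<integral>\<omega>. (\<Prod>j\<in>J. expm (H \<omega> (x j))) \<partial>N)"
proof -
  interpret prob_space N by fact
  let ?T = "(\<Pi>\<^sub>M i\<in>UNIV. borel) :: (nat \<Rightarrow> real) measure"
  have H[measurable]: "H \<in> N \<rightarrow>\<^sub>M D_inf_space" and Em[measurable]: "E \<in> N \<rightarrow>\<^sub>M ?T"
    using ind by (auto simp: independent_def)
  interpret DE: prob_space "distr N ?T E" by (rule prob_space_distr) simp
  have [measurable]: "(\<lambda>h. h t) \<in> borel_measurable D_inf_space" for t
    unfolding D_inf_space_def by (intro measurable_restrict_space1) measurable
  have [measurable]: "(\<lambda>\<omega>. H \<omega> t) \<in> borel_measurable N" for t by measurable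
  define G where "G = {p \<in> space (D_inf_space \<Otimes>\<^sub>M ?T). \<forall>j\<in>J. fst p (x j) < ereal (snd p j)}"
  have G[measurable]: "G \<in> sets (D_inf_space \<Otimes>\<^sub>M ?T)"
    unfolding G_def
  proof (intro sets.sets_Collect_finite_All J)
    fix j
    have [measurable]: "(\<lambda>p. fst p (x j)) \<in> borel_measurable (D_inf_space \<Otimes>\<^sub>M ?T)" by measurable
    have [measurable]: "(\<lambda>p. snd p j) \<in> borel_measurable (D_inf_space \<Otimes>\<^sub>M ?T)" by measurable
    show "{p \<in> space (D_inf_space \<Otimes>\<^sub>M ?T). fst p (x j) < ereal (snd p j)} \<in> sets (D_inf_space \<Otimes>\<^sub>M ?T)"
      by measurable
  qed
  have "emeasure N {\<omega> \<in> space N. \<forall>j\<in>J. ereal (x j) < first_passage (H \<omega>) (E \<omega>) j}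
      = emeasure N ((\<lambda>\<omega>. (H \<omega>, E \<omega>)) -` G \<inter> space N)"
    using measurable_space[OF H] measurable_space[OF Em] less_first_passage_iff[OF paths]
    by (intro arg_cong[where f = "emeasure N"]) (auto simp: G_def space_pair_measure)
  also have "\<dots> = emeasure (distr N (D_inf_space \<Otimes>\<^sub>M ?T) (\<lambda>\<omega>. (H \<omega>, E \<omega>))) G"
    by (simp add: emeasure_distr)
  also have "\<dots> = emeasure (distr N D_inf_space H \<Otimes>\<^sub>M distr N ?T E) G"
    by (simp add: independent_joint_law[OF N ind])
  also have "\<dots> = (\<integral>\<^sup>+h. emeasure (distr N ?T E) (Pair h -` G) \<partial>distr N D_inf_space H)"
    by (rule DE.emeasure_pair_measure_alt) (simp cong: sets_pair_measure_cong)
  also have "\<dots> = (\<integral>\<^sup>+\<omega>. emeasure (distr N ?T E) (Pair (H \<omega>) -` G) \<partial>N)"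
  proof (rule nn_integral_distr[OF H])
    show "(\<lambda>h. emeasure (distr N ?T E) (Pair h -` G)) \<in> borel_measurable (distr N D_inf_space H)"
      unfolding measurable_distr_eq1
      using DE.measurable_emeasure_Pair[of G D_inf_space] G by (simp cong: sets_pair_measure_cong)
  qed
  also have "\<dots> = (\<integral>\<^sup>+\<omega>. ennreal (\<Prod>j\<in>J. expm (H \<omega> (x j))) \<partial>N)"
  proof (rule nn_integral_cong)
    fix \<omega> assume \<omega>: "\<omega> \<in> space N"
    have "emeasure (distr N ?T E) (Pair (H \<omega>) -` G)
        = emeasure N (E -` (Pair (H \<omega>) -` G) \<inter> space N)"
      by (simp add: emeasure_distr sets_Pair1[OF G])
    also have "E -` (Pair (H \<omega>) -` G) \<inter> space N = {\<omega>' \<in> space N. \<forall>j\<in>J. H \<omega> (x j) < ereal (E \<omega>' j)}"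
      using measurable_space[OF H \<omega>] measurable_space[OF Em] by (auto simp: G_def space_pair_measure)
    also have "emeasure N \<dots> = ennreal (\<Prod>j\<in>J. expm (H \<omega> (x j)))"
      unfolding emeasure_eq_measure
      by (subst prob_exponential_exceeds[OF N E J]) (use chron_paths_nonneg[OF paths[OF \<omega>]] in auto)
    finally show "emeasure (distr N ?T E) (Pair (H \<omega>) -` G) = ennreal (\<Prod>j\<in>J. expm (H \<omega> (x j)))" .
  qed
  also have "\<dots> = ennreal (\<integral>\<omega>. (\<Prod>j\<in>J. expm (H \<omega> (x j))) \<partial>N)"
  proof (rule nn_integral_eq_integral)
    show "integrable N (\<lambda>\<omega>. \<Prod>j\<in>J. expm (H \<omega> (x j)))"
      using prod_expm_bounds[of J "\<lambda>j. H _ (x j)"] chron_paths_nonneg[OF paths]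
      by (intro integrable_const_bound[where B = 1] AE_I2) auto
  qed (auto intro!: AE_I2 prod_nonneg)
  finally show ?thesis
    by (simp add: emeasure_eq_measure prod_nonneg integral_nonneg_AE)
qed

section \<open>Right-continuous regularisation\<close>

text \<open>The least multiple of 1/(m+1) strictly above t. Strictly, because the regularisation
  below takes an infimum over rational times greater than t.\<close>

definition rat_above :: "nat \<Rightarrow> real \<Rightarrow> real" where
  "rat_above m t = (of_int \<lfloor>t * real (Suc m)\<rfloor> + 1) / real (Suc m)"

lemma rat_above_Rats: "rat_above m t \<in> \<rat>"
  by (simp add: rat_above_def)

lemma rat_above_gt: "t < rat_above m t"
  unfolding rat_above_def by (subst pos_less_divide_eq) (auto simp del: of_nat_Suc)

lemma rat_above_le: "rat_above m t \<le> t + 1 / real (Suc m)"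
proof -
  have "of_int \<lfloor>t * real (Suc m)\<rfloor> + 1 \<le> t * real (Suc m) + 1" by simp
  then have "rat_above m t \<le> (t * real (Suc m) + 1) / real (Suc m)"
    unfolding rat_above_def by (intro divide_right_mono) auto
  also have "\<dots> = t + 1 / real (Suc m)" by (simp add: field_simps)
  finally show ?thesis .
qed

lemma rat_above_LIMSEQ: "(\<lambda>m. rat_above m t) \<longlonglongrightarrow> t"
proof (rule tendsto_sandwich)
  show "\<forall>\<^sub>F m in sequentially. t \<le> rat_above m t"
    using rat_above_gt by (auto intro!: always_eventually less_imp_le)
  show "\<forall>\<^sub>F m in sequentially. rat_above m t \<le> t + 1 / real (Suc m)"
    using rat_above_le by (auto intro!: always_eventually)
  show "(\<lambda>m. t + 1 / real (Suc m)) \<longlonglongrightarrow> t"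
    using tendsto_add[OF tendsto_const[of t] LIMSEQ_inverse_real_of_nat] by (simp add: inverse_eq_divide)
qed simp

text \<open>Right-continuity comes from the strict inequalities: if \<omega> exceeds x on the finite
  set J, it also exceeds every approximation close enough to x.\<close>

lemma survival_rat_above_LIMSEQ:
  assumes P: "prob_space P" "sets P = sets (borel_fun I)" and J: "finite J" "J \<subseteq> I"
  shows "(\<lambda>m. survival P J (\<lambda>j. rat_above m (x j))) \<longlonglongrightarrow> survival P J x"
proof -
  interpret prob_space P by fact
  define B where "B y = {\<omega> \<in> space P. \<forall>j\<in>J. ereal (y j) < \<omega> j}" for y
  have B[measurable]: "B y \<in> sets P" for y
    unfolding B_def by (rule upper_box_sets[OF J P(2)])
  have "(\<lambda>m. \<integral>\<omega>. indicator (B (\<lambda>j. rat_above m (x j))) \<omega> \<partial>P) \<longlonglongrightarrow> (\<integral>\<omega>. indicator (B x) \<omega> \<partial>P :: real)"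
  proof (rule integral_dominated_convergence[where w = "\<lambda>_. 1"])
    show "AE \<omega> in P. (\<lambda>m. indicator (B (\<lambda>j. rat_above m (x j))) \<omega> :: real) \<longlonglongrightarrow> indicator (B x) \<omega>"
    proof (rule AE_I2)
      fix \<omega> assume \<omega>: "\<omega> \<in> space P"
      show "(\<lambda>m. indicator (B (\<lambda>j. rat_above m (x j))) \<omega> :: real) \<longlonglongrightarrow> indicator (B x) \<omega>"
      proof (cases "\<omega> \<in> B x")
        case True
        have "\<forall>j\<in>J. eventually (\<lambda>m. ereal (rat_above m (x j)) < \<omega> j) sequentially"
        proof
          fix j assume "j \<in> J"
          then have "ereal (x j) < \<omega> j" using True by (simp add: B_def)
          then show "eventually (\<lambda>m. ereal (rat_above m (x j)) < \<omega> j) sequentially"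
            by (intro order_tendstoD(2)[where y = "ereal (x j)"] tendsto_ereal rat_above_LIMSEQ)
        qed
        then have "eventually (\<lambda>m. \<forall>j\<in>J. ereal (rat_above m (x j)) < \<omega> j) sequentially"
          using J(1) by (simp add: eventually_ball_finite)
        then have "eventually (\<lambda>m. indicator (B (\<lambda>j. rat_above m (x j))) \<omega> = (1::real)) sequentially"
          by eventually_elim (use \<omega> in \<open>simp add: B_def\<close>)
        then show ?thesis using True by (simp add: tendsto_eventually)
      next
        case False
        have "\<omega> \<notin> B (\<lambda>j. rat_above m (x j))" for m
        proof
          assume "\<omega> \<in> B (\<lambda>j. rat_above m (x j))"
          moreover have "ereal (x j) < \<omega> j" if "ereal (rat_above m (x j)) < \<omega> j" for j
            using rat_above_gt[of "x j" m] that by (intro less_trans[of "ereal (x j)", OF _ that]) simp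
          ultimately have "\<omega> \<in> B x" unfolding B_def by auto
          with False show False by simp
        qed
        then show ?thesis using False by simp
      qed
    qed
  qed auto
  then show ?thesis unfolding survival_def B_def[symmetric] by simp
qed

text \<open>Only countably many times enter, so measurability survives. The cut-off at 0 and the
  infimum over times after t put every path, not just almost every one, into
  \<open>chron_paths\<close>, whatever y is.\<close>

definition right_regularisation :: "('a \<Rightarrow> real \<Rightarrow> ereal) \<Rightarrow> 'a \<Rightarrow> real \<Rightarrow> ereal" where
  "right_regularisation y \<omega> t = (INF q\<in>{q\<in>\<rat>. t < q}. max 0 (y \<omega> q))"

lemma right_regularisation_paths: "right_regularisation y \<omega> \<in> chron_paths"
proof -
  let ?h = "right_regularisation y \<omega>"
  have nn: "0 \<le> ?h t" for t unfolding right_regularisation_def by (intro INF_greatest) auto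
  have mono: "mono ?h"
    unfolding right_regularisation_def by (intro monoI INF_superset_mono) auto
  have "(?h \<longlongrightarrow> ?h t) (at_right t)" for t
  proof (rule order_tendstoI)
    fix a assume a: "a < ?h t"
    have "eventually (\<lambda>u. t < u) (at_right t)" by (simp add: eventually_at_filter)
    then show "eventually (\<lambda>u. a < ?h u) (at_right t)"
      by eventually_elim (use a monoD[OF mono, of t] in \<open>auto intro: less_le_trans\<close>)
  next
    fix a assume "?h t < a"
    then obtain q where q: "q \<in> \<rat>" "t < q" "max 0 (y \<omega> q) < a"
      unfolding right_regularisation_def by (auto simp: INF_less_iff)
    have "eventually (\<lambda>u. u \<in> {t<..<q}) (at_right t)" by (rule eventually_at_right_real[OF q(2)])
    then show "eventually (\<lambda>u. ?h u < a) (at_right t)"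
    proof eventually_elim
      case (elim u)
      then have "?h u \<le> max 0 (y \<omega> q)"
        unfolding right_regularisation_def using q(1) by (intro INF_lower) auto
      then show ?case using q(3) by (rule le_less_trans)
    qed
  qed
  then show ?thesis using nn mono by (simp add: chron_paths_def)
qed

lemma right_regularisation_measurable:
  assumes "\<And>t. (\<lambda>\<omega>. y \<omega> t) \<in> borel_measurable K"
  shows "right_regularisation y \<in> K \<rightarrow>\<^sub>M borel_fun UNIV"
proof (rule measurable_PiM_single')
  fix t
  show "(\<lambda>\<omega>. right_regularisation y \<omega> t) \<in> borel_measurable K"
    unfolding right_regularisation_def
    by (intro borel_measurable_INF borel_measurable_max assms)
      (auto intro: countable_subset[OF _ countable_rat])
qed (auto simp: space_PiM)

text \<open>Monotonicity on the rationals lets a single rational q > t with a small value control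
  all \<open>rat_above m t\<close> that have fallen below q.\<close>

lemma right_regularisation_LIMSEQ:
  assumes nn: "\<And>q. q \<in> \<rat> \<Longrightarrow> 0 \<le> y \<omega> q" and mono: "\<And>p q. p \<in> \<rat> \<Longrightarrow> q \<in> \<rat> \<Longrightarrow> p \<le> q \<Longrightarrow> y \<omega> p \<le> y \<omega> q"
  shows "(\<lambda>m. y \<omega> (rat_above m t)) \<longlonglongrightarrow> right_regularisation y \<omega> t"
proof (rule order_tendstoI)
  fix a assume a: "a < right_regularisation y \<omega> t"
  have "right_regularisation y \<omega> t \<le> max 0 (y \<omega> (rat_above m t))" for m
    unfolding right_regularisation_def using rat_above_Rats rat_above_gt by (intro INF_lower) auto
  then have "right_regularisation y \<omega> t \<le> y \<omega> (rat_above m t)" for m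
    using nn[OF rat_above_Rats[of m t]] by (metis max.absorb2)
  then show "eventually (\<lambda>m. a < y \<omega> (rat_above m t)) sequentially"
    using a by (auto intro: always_eventually less_le_trans)
next
  fix a assume "right_regularisation y \<omega> t < a"
  then obtain q where q: "q \<in> \<rat>" "t < q" "y \<omega> q < a"
    unfolding right_regularisation_def by (auto simp: INF_less_iff)
  have "eventually (\<lambda>m. rat_above m t < q) sequentially"
    by (rule order_tendstoD(2)[OF rat_above_LIMSEQ q(2)])
  then show "eventually (\<lambda>m. y \<omega> (rat_above m t) < a) sequentially"
    by eventually_elim (use q mono[OF rat_above_Rats q(1)] in \<open>auto intro: le_less_trans less_imp_le\<close>)
qed

text \<open>Sign and monotonicity are known up to null sets that depend on the times; on the
  rationals there are only countably many of them. Off these, y converges along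
  \<open>rat_above\<close> to the regularised path, and right-continuity of L identifies the limit
  of the transforms.\<close>

lemma regularised_laplace:
  assumes K: "prob_space K" and meas: "\<And>t. (\<lambda>\<omega>. y \<omega> t) \<in> borel_measurable K"
    and nn: "\<And>t. AE \<omega> in K. 0 \<le> y \<omega> t" and mono: "\<And>s t. s \<le> t \<Longrightarrow> AE \<omega> in K. y \<omega> s \<le> y \<omega> t"
    and lap: "\<And>x. (\<integral>\<omega>. (\<Prod>j\<in>J. expm (y \<omega> (x j))) \<partial>K) = L x"
    and right: "\<And>x. (\<lambda>m. L (\<lambda>j. rat_above m (x j))) \<longlonglongrightarrow> L x"
  shows "(\<integral>\<omega>. (\<Prod>j\<in>J. expm (right_regularisation y \<omega> (x j))) \<partial>K) = L x"
proof -
  interpret prob_space K by fact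
  have R: "countable \<rat>" by (rule countable_rat)
  have "AE \<omega> in K. \<forall>q\<in>\<rat>. 0 \<le> y \<omega> q" using nn by (simp add: AE_ball_countable[OF R])
  moreover have "AE \<omega> in K. \<forall>p\<in>\<rat>. \<forall>q\<in>\<rat>. p \<le> q \<longrightarrow> y \<omega> p \<le> y \<omega> q"
    using mono by (simp add: AE_ball_countable[OF R] AE_impI)
  ultimately have good: "AE \<omega> in K. (\<forall>q\<in>\<rat>. 0 \<le> y \<omega> q) \<and> (\<forall>p\<in>\<rat>. \<forall>q\<in>\<rat>. p \<le> q \<longrightarrow> y \<omega> p \<le> y \<omega> q)"
    by eventually_elim auto
  note [measurable] = meas borel_fun_component[OF right_regularisation_measurable[OF meas]]
  have "(\<lambda>m. \<integral>\<omega>. (\<Prod>j\<in>J. expm (y \<omega> (rat_above m (x j)))) \<partial>K)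
      \<longlonglongrightarrow> (\<integral>\<omega>. (\<Prod>j\<in>J. expm (right_regularisation y \<omega> (x j))) \<partial>K)"
  proof (rule integral_dominated_convergence[where w = "\<lambda>_. 1"])
    show "AE \<omega> in K. (\<lambda>m. \<Prod>j\<in>J. expm (y \<omega> (rat_above m (x j))))
        \<longlonglongrightarrow> (\<Prod>j\<in>J. expm (right_regularisation y \<omega> (x j)))"
      using good
    proof eventually_elim
      case (elim \<omega>)
      show ?case
      proof (intro tendsto_prod tendsto_expm right_regularisation_LIMSEQ)
        show "0 \<le> right_regularisation y \<omega> (x i)" for i
          by (rule chron_paths_nonneg[OF right_regularisation_paths])
        show "eventually (\<lambda>m. 0 \<le> y \<omega> (rat_above m (x i))) sequentially" for i
          using elim rat_above_Rats by (auto intro: always_eventually)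
      qed (use elim in auto)
    qed
    show "AE \<omega> in K. norm (\<Prod>j\<in>J. expm (y \<omega> (rat_above m (x j)))) \<le> 1" for m
      using good
    proof eventually_elim
      case (elim \<omega>)
      then show ?case using prod_expm_bounds[of J "\<lambda>j. y \<omega> (rat_above m (x j))"] rat_above_Rats by auto
    qed
  qed auto
  then show ?thesis unfolding lap using right LIMSEQ_unique by blast
qed

section \<open>Exchangeable laws and limiting frequencies\<close>

text \<open>Exchangeability tested on boxes, with injective relabellings of a finite index set in
  place of permutations of an initial segment. In this form it passes to n-th roots.\<close>

definition symmetric_law :: "(nat \<Rightarrow> ereal) measure \<Rightarrow> bool" where
  "symmetric_law P \<longleftrightarrow> (\<forall>J f x. finite J \<longrightarrow> inj_on f J \<longrightarrow>
     measure P {\<omega> \<in> space P. \<forall>j\<in>J. ereal (x j) < \<omega> (f j)} = survival P J x)"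

lemma permute_measurable:
  assumes "sets P = sets (borel_fun (UNIV :: nat set))"
  shows "(\<lambda>\<omega>. \<omega> \<circ> \<pi>) \<in> P \<rightarrow>\<^sub>M borel_fun UNIV"
  unfolding measurable_cong_sets[OF assms refl]
  by (rule measurable_PiM_single') (auto simp: space_PiM intro!: measurable_component_singleton)

lemma symmetric_law_permute:
  assumes P: "prob_space P" "sets P = sets (borel_fun UNIV)" and sym: "symmetric_law P"
    and \<pi>: "inj \<pi>"
  shows "distr P (borel_fun UNIV) (\<lambda>\<omega>. \<omega> \<circ> \<pi>) = P"
proof (rule measure_eqI_survival)
  note m = permute_measurable[OF P(2)]
  show "prob_space (distr P (borel_fun UNIV) (\<lambda>\<omega>. \<omega> \<circ> \<pi>))"
    by (rule prob_space.prob_space_distr[OF P(1) m])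
  fix J x assume J: "finite J" "J \<subseteq> (UNIV :: nat set)"
  have "survival (distr P (borel_fun UNIV) (\<lambda>\<omega>. \<omega> \<circ> \<pi>)) J x
      = measure P {\<omega> \<in> space P. \<forall>j\<in>J. ereal (x j) < \<omega> (\<pi> j)}"
    by (subst survival_distr[OF m J]) simp
  also have "\<dots> = survival P J x"
    using sym J(1) inj_on_subset[OF \<pi>] unfolding symmetric_law_def by blast
  finally show "survival (distr P (borel_fun UNIV) (\<lambda>\<omega>. \<omega> \<circ> \<pi>)) J x = survival P J x" .
qed (use P in auto)

definition tail_freq :: "real \<Rightarrow> nat \<Rightarrow> (nat \<Rightarrow> ereal) \<Rightarrow> real" where
  "tail_freq t n \<omega> = (\<Sum>i<n. indicator {ereal t<..} (\<omega> i)) / real n"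

text \<open>Along the powers 4^k consecutive frequencies differ in L2 by at most 2^-k, which is
  summable. Where the sequence diverges, \<open>lim\<close> still has some value; under a symmetric
  law this concerns a null set.\<close>

definition limit_freq :: "real \<Rightarrow> (nat \<Rightarrow> ereal) \<Rightarrow> real" where
  "limit_freq t \<omega> = lim (\<lambda>k. tail_freq t (4 ^ k) \<omega>)"

lemma tail_freq_bounds: "0 \<le> tail_freq t n \<omega>" "tail_freq t n \<omega> \<le> 1"
proof -
  show "0 \<le> tail_freq t n \<omega>" by (auto simp: tail_freq_def intro!: divide_nonneg_nonneg sum_nonneg)
  have "(\<Sum>i<n. indicator {ereal t<..} (\<omega> i)) \<le> (\<Sum>i<n. 1 :: real)"
    by (intro sum_mono) (auto simp: indicator_def)
  then show "tail_freq t n \<omega> \<le> 1" by (auto simp: tail_freq_def divide_le_eq)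
qed

lemma tail_freq_antimono: "s \<le> t \<Longrightarrow> tail_freq t n \<omega> \<le> tail_freq s n \<omega>"
  unfolding tail_freq_def
  by (intro divide_right_mono sum_mono) (auto simp: indicator_def intro: le_less_trans[of "ereal s" "ereal t"])

text \<open>The two sequences have the same limits, so \<open>lim\<close> picks the same value even
  when both diverge. This makes the invariance of \<open>limit_freq\<close> hold at every \<omega>
  rather than almost everywhere.\<close>

lemma lim_cong_eventually:
  assumes "eventually (\<lambda>n. f n = g n) sequentially"
  shows "lim f = lim g"
proof -
  have "(f \<longlonglongrightarrow> l) = (g \<longlonglongrightarrow> l)" for l by (rule tendsto_cong[OF assms])
  then show ?thesis by (simp add: lim_def)
qed

text \<open>Once 4^k exceeds both indices, the swap merely permutes the summands.\<close>

lemma limit_freq_transpose: "limit_freq t (\<omega> \<circ> Transposition.transpose a b) = limit_freq t \<omega>"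
  unfolding limit_freq_def
proof (rule lim_cong_eventually)
  have "eventually (\<lambda>k. max a b < 4 ^ k) sequentially"
  proof (rule eventually_sequentiallyI)
    fix k assume k: "max a b \<le> k"
    have "k < 2 ^ k" by (rule less_exp)
    also have "(2::nat) ^ k \<le> 4 ^ k" by (rule power_mono) auto
    finally show "max a b < 4 ^ k" using k by linarith
  qed
  then show "eventually (\<lambda>k. tail_freq t (4 ^ k) (\<omega> \<circ> Transposition.transpose a b) = tail_freq t (4 ^ k) \<omega>) sequentially"
  proof eventually_elim
    case (elim k)
    have "(\<Sum>i<4 ^ k. indicator {ereal t<..} ((\<omega> \<circ> Transposition.transpose a b) i) :: real)
        = (\<Sum>i<4 ^ k. indicator {ereal t<..} (\<omega> i))"
      using sum.permute[OF permutes_swap_id[of a "{..<4 ^ k}" b], of "\<lambda>i. indicat_real {ereal t<..} (\<omega> i)"] elim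
      by (simp add: o_def)
    then show ?case by (simp add: tail_freq_def)
  qed
qed

text \<open>If all products had mean a, the second moment would be a times the square of the sum of
  w, which is 0. Correcting the diagonal adds (b - a) times the sum of squares, and 0 \<le> a with b
  \<le> 1 bounds that factor by 1.\<close>

lemma centred_square_bound:
  fixes Y :: "nat \<Rightarrow> 'a \<Rightarrow> real"
  assumes P: "prob_space P" and Y: "\<And>i. Y i \<in> borel_measurable P" "\<And>i \<omega>. Y i \<omega> \<in> {0..1}"
    and ex: "\<And>i j. i \<noteq> j \<Longrightarrow> (\<integral>\<omega>. Y i \<omega> * Y j \<omega> \<partial>P) = a" and sq: "\<And>i. (\<integral>\<omega>. Y i \<omega> * Y i \<omega> \<partial>P) = b"
    and w: "(\<Sum>i<m. w i) = 0"
  shows "(\<integral>\<omega>. (\<Sum>i<m. w i * Y i \<omega>)\<^sup>2 \<partial>P) \<le> (\<Sum>i<m. (w i)\<^sup>2)"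
proof -
  interpret prob_space P by fact
  note [measurable] = Y(1)
  have int: "integrable P (\<lambda>\<omega>. Y i \<omega> * Y j \<omega>)" for i j
    using Y(2) by (intro integrable_const_bound[where B = 1] AE_I2) (auto simp: abs_mult intro!: mult_le_one)
  have "0 \<le> a" unfolding ex[of 0 1, simplified, symmetric] using Y(2) by (intro integral_nonneg_AE AE_I2) auto
  have "b \<le> 1"
  proof -
    have "(\<integral>\<omega>. Y 0 \<omega> * Y 0 \<omega> \<partial>P) \<le> (\<integral>\<omega>. 1 \<partial>P)"
      using Y(2) int by (intro integral_mono) (auto intro!: mult_le_one)
    then show ?thesis by (simp add: sq prob_space)
  qed
  have "(\<integral>\<omega>. (\<Sum>i<m. w i * Y i \<omega>)\<^sup>2 \<partial>P) = (\<integral>\<omega>. (\<Sum>i<m. \<Sum>j<m. w i * w j * (Y i \<omega> * Y j \<omega>)) \<partial>P)"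
    by (intro Bochner_Integration.integral_cong) (auto simp: power2_eq_square sum_product mult_ac)
  also have "\<dots> = (\<Sum>i<m. \<Sum>j<m. w i * w j * (\<integral>\<omega>. Y i \<omega> * Y j \<omega> \<partial>P))"
    using int by (simp add: Bochner_Integration.integral_sum)
  also have "\<dots> = (\<Sum>i<m. \<Sum>j<m. w i * w j * a + (if i = j then (w i)\<^sup>2 * (b - a) else 0))"
    by (intro sum.cong refl) (auto simp: ex sq algebra_simps power2_eq_square)
  also have "\<dots> = (\<Sum>i<m. w i) * (\<Sum>j<m. w j) * a + (b - a) * (\<Sum>i<m. (w i)\<^sup>2)"
    by (simp add: sum.distrib sum_distrib_left sum_distrib_right sum_product mult_ac)
  also have "\<dots> \<le> 1 * (\<Sum>i<m. (w i)\<^sup>2)"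
  proof -
    have "(b - a) * (\<Sum>i<m. (w i)\<^sup>2) \<le> 1 * (\<Sum>i<m. (w i)\<^sup>2)"
      using \<open>0 \<le> a\<close> \<open>b \<le> 1\<close> by (intro mult_right_mono sum_nonneg) auto
    then show ?thesis using w by simp
  qed
  finally show ?thesis by simp
qed

text \<open>The expected sum of all absolute increments is finite, so almost everywhere the
  increments are absolutely summable and telescope to a limit.\<close>

lemma AE_convergent_of_summable_increments:
  fixes f :: "nat \<Rightarrow> 'a \<Rightarrow> real"
  assumes P: "prob_space P" and [measurable]: "\<And>k. f k \<in> borel_measurable P"
    and int: "\<And>k. integrable P (f k)"
    and inc: "\<And>k. (\<integral>\<omega>. \<bar>f (Suc k) \<omega> - f k \<omega>\<bar> \<partial>P) \<le> c k" and c: "summable c"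
  shows "AE \<omega> in P. convergent (\<lambda>k. f k \<omega>)"
proof -
  define g where "g k \<omega> = \<bar>f (Suc k) \<omega> - f k \<omega>\<bar>" for k \<omega>
  have [measurable]: "g k \<in> borel_measurable P" for k unfolding g_def by measurable
  have gi: "integrable P (g k)" for k unfolding g_def using int by auto
  have "(\<integral>\<^sup>+\<omega>. (\<Sum>k. ennreal (g k \<omega>)) \<partial>P) = (\<Sum>k. \<integral>\<^sup>+\<omega>. ennreal (g k \<omega>) \<partial>P)"
    by (rule nn_integral_suminf) measurable
  also have "\<dots> = (\<Sum>k. ennreal (\<integral>\<omega>. g k \<omega> \<partial>P))"
    by (intro suminf_cong nn_integral_eq_integral gi AE_I2) (simp add: g_def)
  also have "\<dots> \<le> (\<Sum>k. ennreal (c k))"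
    using inc by (intro suminf_le ennreal_leI) (auto simp: g_def)
  also have "\<dots> < \<infinity>"
  proof -
    have c0: "0 \<le> c k" for k
    proof -
      have "0 \<le> (\<integral>\<omega>. \<bar>f (Suc k) \<omega> - f k \<omega>\<bar> \<partial>P)" by (intro integral_nonneg_AE AE_I2) auto
      with inc[of k] show ?thesis by linarith
    qed
    show ?thesis using suminf_ennreal2[OF c0 c] by simp
  qed
  finally have "(\<integral>\<^sup>+\<omega>. (\<Sum>k. ennreal (g k \<omega>)) \<partial>P) \<noteq> \<infinity>" by auto
  then have "AE \<omega> in P. (\<Sum>k. ennreal (g k \<omega>)) \<noteq> \<infinity>" by (intro nn_integral_PInf_AE) measurable
  then show ?thesis
  proof eventually_elim
    case (elim \<omega>)
    have "summable (\<lambda>k. g k \<omega>)"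
      by (rule summable_suminf_not_top) (use elim in \<open>auto simp: g_def\<close>)
    then have "summable (\<lambda>k. f (Suc k) \<omega> - f k \<omega>)"
      unfolding g_def by (simp add: summable_rabs_cancel)
    then have "convergent (\<lambda>n. \<Sum>k<n. f (Suc k) \<omega> - f k \<omega>)" by (simp add: summable_iff_convergent)
    then have "convergent (\<lambda>n. f n \<omega> - f 0 \<omega>)" using sum_lessThan_telescope[of "\<lambda>k. f k \<omega>"] by simp
    then have "convergent (\<lambda>n. (f n \<omega> - f 0 \<omega>) + f 0 \<omega>)" by (intro convergent_add convergent_const)
    then show ?case by simp
  qed
qed

lemma tail_freq_measurable:
  assumes "sets P = sets (borel_fun UNIV)"
  shows "tail_freq t n \<in> borel_measurable P" "limit_freq t \<in> borel_measurable P"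
proof -
  have c: "(\<lambda>\<omega>. \<omega> i) \<in> borel_measurable P" for i
    unfolding measurable_cong_sets[OF assms refl] by (rule measurable_component_singleton) simp
  show m: "tail_freq t n \<in> borel_measurable P" for n
    unfolding tail_freq_def
    by (intro borel_measurable_divide borel_measurable_sum borel_measurable_const
        measurable_compose[OF c borel_measurable_indicator]) auto
  show "limit_freq t \<in> borel_measurable P"
    unfolding limit_freq_def by (rule borel_measurable_lim_metric) (rule m)
qed

text \<open>A law of large numbers needing only second moments: the averages over the first n and
  the first m \<ge> n terms differ by a combination whose weights sum to 0, so the second moment of
  the difference is at most 1/n.\<close>

lemma tail_freq_LIMSEQ:
  assumes P: "prob_space P" "sets P = sets (borel_fun UNIV)" and sym: "symmetric_law P"
  shows "AE \<omega> in P. (\<lambda>k. tail_freq t (4 ^ k) \<omega>) \<longlonglongrightarrow> limit_freq t \<omega>"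
proof -
  interpret prob_space P by fact
  note meas[measurable] = tail_freq_measurable[OF P(2)]
  define Y :: "nat \<Rightarrow> (nat \<Rightarrow> ereal) \<Rightarrow> real" where "Y i \<omega> = indicator {ereal t<..} (\<omega> i)" for i \<omega>
  have c: "(\<lambda>\<omega>. \<omega> i) \<in> borel_measurable P" for i
    unfolding measurable_cong_sets[OF P(2) refl] by (rule measurable_component_singleton) simp
  have Y: "Y i \<in> borel_measurable P" "Y i \<omega> \<in> {0..1}" for i \<omega>
    unfolding Y_def by (auto simp: indicator_def intro!: measurable_compose[OF c] borel_measurable_indicator)
  \<comment> \<open>f lists canonical indices and g relabels them to i and j. Indexing by
    \<open>bool\<close> covers a pair and, with f constant, a single index.\<close>
  have Ybox: "(\<integral>\<omega>. Y i \<omega> * Y j \<omega> \<partial>P) = survival P (f ` UNIV) (\<lambda>_. t)"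
    if "inj_on g (f ` UNIV)" "g ` f ` UNIV = {i, j}" for i j and f :: "bool \<Rightarrow> nat" and g
  proof -
    let ?S = "{\<omega> \<in> space P. \<forall>k\<in>{i, j}. ereal t < \<omega> k}"
    have "survival P (f ` UNIV) (\<lambda>_. t) = measure P {\<omega> \<in> space P. \<forall>k\<in>f ` UNIV. ereal t < \<omega> (g k)}"
      using sym[unfolded symmetric_law_def, rule_format, OF _ that(1), of "\<lambda>_. t"] by simp
    also have "{\<omega> \<in> space P. \<forall>k\<in>f ` UNIV. ereal t < \<omega> (g k)} = ?S"
      unfolding that(2)[symmetric] by blast
    also have "measure P ?S = (\<integral>\<omega>. indicator ?S \<omega> \<partial>P)"
      unfolding Bochner_Integration.integral_indicator by (rule arg_cong[where f = "measure P"]) blast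
    also have "\<dots> = (\<integral>\<omega>. Y i \<omega> * Y j \<omega> \<partial>P)"
      by (intro Bochner_Integration.integral_cong) (auto simp: Y_def indicator_def)
    finally show ?thesis by simp
  qed
  have a: "(\<integral>\<omega>. Y i \<omega> * Y j \<omega> \<partial>P) = survival P {0, 1} (\<lambda>_. t)" if "i \<noteq> j" for i j
    using Ybox[of "\<lambda>k. if k = 0 then i else j" "\<lambda>b. if b then 0 else 1" i j] that
    by (simp add: UNIV_bool insert_commute)
  have b: "(\<integral>\<omega>. Y i \<omega> * Y i \<omega> \<partial>P) = survival P {0} (\<lambda>_. t)" for i
    using Ybox[of "\<lambda>_. i" "\<lambda>_. 0" i i] by simp
  have freq: "tail_freq t n \<omega> = (\<Sum>i<n. Y i \<omega>) / real n" for n \<omega>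
    by (simp add: tail_freq_def Y_def)
  have int: "integrable P (tail_freq t n)" for n
    using tail_freq_bounds by (intro integrable_const_bound[where B = 1] AE_I2) auto
  have sq: "(\<integral>\<omega>. (tail_freq t n \<omega> - tail_freq t m \<omega>)\<^sup>2 \<partial>P) \<le> 1 / real n" if "0 < n" "n \<le> m" for n m
  proof -
    \<comment> \<open>The weight of term i in the average over n minus the average over m; the
      squares sum to 1/n - 1/m.\<close>
    define w where "w i = (if i < n then 1 / real n else 0) - 1 / real m" for i
    have split: "(\<Sum>i<m. if i < n then h i else 0) = (\<Sum>i<n. h i :: real)" for h
    proof -
      have "(\<Sum>i<m. if i < n then h i else 0) = (\<Sum>i\<in>{..<m} \<inter> {i. i < n}. h i)" by (simp add: sum.inter_restrict)
      also have "{..<m} \<inter> {i. i < n} = {..<n}" using that by auto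
      finally show ?thesis .
    qed
    have "(\<Sum>i<m. w i) = 0"
      using that by (simp add: w_def sum_subtractf split)
    then have bound: "(\<integral>\<omega>. (\<Sum>i<m. w i * Y i \<omega>)\<^sup>2 \<partial>P) \<le> (\<Sum>i<m. (w i)\<^sup>2)"
      by (intro centred_square_bound[OF P(1) Y a b])
    have "(\<Sum>i<m. w i * Y i \<omega>) = tail_freq t n \<omega> - tail_freq t m \<omega>" for \<omega>
    proof -
      have "(\<Sum>i<m. w i * Y i \<omega>) = (\<Sum>i<m. (if i < n then Y i \<omega> / real n else 0) - Y i \<omega> / real m)"
        by (intro sum.cong) (auto simp: w_def left_diff_distrib)
      then show ?thesis by (simp add: sum_subtractf split freq sum_divide_distrib)
    qed
    moreover have "(\<Sum>i<m. (w i)\<^sup>2) \<le> 1 / real n"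
    proof -
      have "(\<Sum>i<m. (w i)\<^sup>2) = (\<Sum>i<m. (if i < n then 1 / (real n)\<^sup>2 - 2 / (real n * real m) else 0) + 1 / (real m)\<^sup>2)"
        by (intro sum.cong) (auto simp: w_def power2_diff power_divide)
      also have "\<dots> = real n * (1 / (real n)\<^sup>2 - 2 / (real n * real m)) + real m * (1 / (real m)\<^sup>2)"
        by (simp add: sum.distrib split)
      also have "\<dots> = 1 / real n - 1 / real m"
        using that by (simp add: field_simps power2_eq_square)
      finally show ?thesis by simp
    qed
    ultimately show ?thesis using bound by simp
  qed
  have "AE \<omega> in P. convergent (\<lambda>k. tail_freq t (4 ^ k) \<omega>)"
  proof (rule AE_convergent_of_summable_increments[OF P(1) meas(1) int])
    fix k
    let ?D = "\<lambda>\<omega>. tail_freq t (4 ^ k) \<omega> - tail_freq t (4 ^ Suc k) \<omega>"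
    have Dint: "integrable P (\<lambda>\<omega>. (?D \<omega>)\<^sup>2)"
    proof (rule integrable_const_bound[where B = 1])
      show "AE \<omega> in P. norm ((?D \<omega>)\<^sup>2) \<le> 1"
      proof (rule AE_I2)
        fix \<omega>
        have "\<bar>?D \<omega>\<bar> \<le> 1"
          using tail_freq_bounds[of t "4 ^ k" \<omega>] tail_freq_bounds[of t "4 ^ Suc k" \<omega>] by linarith
        then show "norm ((?D \<omega>)\<^sup>2) \<le> 1" by (simp add: abs_square_le_1)
      qed
    qed measurable
    \<comment> \<open>AM-GM turns the \<open>L\<^sup>2\<close> bound \<open>4\<^sup>-\<^sup>k\<close> into the summable \<open>L\<^sup>1\<close> bound \<open>2\<^sup>-\<^sup>k\<close>.\<close>
    have "(\<integral>\<omega>. \<bar>tail_freq t (4 ^ Suc k) \<omega> - tail_freq t (4 ^ k) \<omega>\<bar> \<partial>P)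
        \<le> (\<integral>\<omega>. ((1 / 2) ^ k + 2 ^ k * (?D \<omega>)\<^sup>2) / 2 \<partial>P)"
    proof (rule integral_mono)
      fix \<omega>
      define x where "x = \<bar>?D \<omega>\<bar>"
      have "0 \<le> (2 ^ k * x - 1)\<^sup>2 * (1 / 2) ^ k" by simp
      also have "\<dots> = 2 ^ k * x\<^sup>2 - 2 * x + (1 / 2) ^ k"
        by (simp add: power2_diff field_simps power2_eq_square)
      finally have "x \<le> ((1 / 2) ^ k + 2 ^ k * x\<^sup>2) / 2" by simp
      moreover have "x\<^sup>2 = (?D \<omega>)\<^sup>2" by (simp add: x_def)
      ultimately show "\<bar>tail_freq t (4 ^ Suc k) \<omega> - tail_freq t (4 ^ k) \<omega>\<bar> \<le> ((1 / 2) ^ k + 2 ^ k * (?D \<omega>)\<^sup>2) / 2"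
        unfolding x_def by (simp only: abs_minus_commute)
    qed (use int Dint in auto)
    also have "\<dots> = ((1 / 2) ^ k + 2 ^ k * (\<integral>\<omega>. (?D \<omega>)\<^sup>2 \<partial>P)) / 2"
      using Dint by (simp add: prob_space)
    also have "\<dots> \<le> ((1 / 2) ^ k + 2 ^ k * (1 / real (4 ^ k))) / 2"
      using sq[of "4 ^ k" "4 ^ Suc k"] by (intro divide_right_mono add_left_mono mult_left_mono) auto
    also have "\<dots> = (1 / 2) ^ k"
      by (simp add: power_divide field_simps flip: power_mult_distrib)
    finally show "(\<integral>\<omega>. \<bar>tail_freq t (4 ^ Suc k) \<omega> - tail_freq t (4 ^ k) \<omega>\<bar> \<partial>P) \<le> (1 / 2) ^ k" .
  qed (simp add: summable_geometric)
  then show ?thesis by eventually_elim (simp add: limit_freq_def convergent_LIMSEQ_iff)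
qed

lemma limit_freq_bounds:
  assumes "prob_space P" "sets P = sets (borel_fun UNIV)" "symmetric_law P"
  shows "AE \<omega> in P. limit_freq t \<omega> \<in> {0..1}"
  using tail_freq_LIMSEQ[OF assms, of t]
proof eventually_elim
  case (elim \<omega>)
  have "0 \<le> limit_freq t \<omega>" by (rule LIMSEQ_le_const[OF elim]) (use tail_freq_bounds in auto)
  moreover have "limit_freq t \<omega> \<le> 1" by (rule LIMSEQ_le_const2[OF elim]) (use tail_freq_bounds in auto)
  ultimately show ?case by simp
qed

text \<open>
  By symmetry the mean of \<open>W\<close> times the indicator of \<open>X\<^sub>i > t\<close> is the same for all \<open>i \<notin> A\<close> when \<open>W\<close>
  depends on the coordinates in \<open>A\<close> and on limiting frequencies only. Averaging over \<open>i\<close> therefore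
  trades one frequency factor for one more indicator.
\<close>

lemma integral_limit_freq_product:
  assumes P: "prob_space P" "sets P = sets (borel_fun UNIV)" and sym: "symmetric_law P"
    and "finite B" "finite A" "A \<inter> B = {}"
  shows "(\<integral>\<omega>. (\<Prod>i\<in>A. indicator {ereal (t i)<..} (\<omega> i)) * (\<Prod>i\<in>B. limit_freq (t i) \<omega>) \<partial>P) = survival P (A \<union> B) t"
  using assms(4-)
proof (induction B arbitrary: A rule: finite_induct)
  case empty
  have "survival P A t = (\<integral>\<omega>. indicator {\<omega> \<in> space P. \<forall>j\<in>A. ereal (t j) < \<omega> j} \<omega> \<partial>P)"
    using upper_box_sets[OF empty(1) _ P(2), of t] by (simp add: survival_def)
  also have "\<dots> = (\<integral>\<omega>. (\<Prod>i\<in>A. indicator {ereal (t i)<..} (\<omega> i)) \<partial>P)"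
    using empty(1) by (intro Bochner_Integration.integral_cong) (auto simp: indicator_def)
  finally show ?case by simp
next
  case (insert b B)
  interpret prob_space P by fact
  note meas[measurable] = tail_freq_measurable[OF P(2)]
  have c[measurable]: "(\<lambda>\<omega>. \<omega> i) \<in> borel_measurable P" for i
    unfolding measurable_cong_sets[OF P(2) refl] by (rule measurable_component_singleton) simp
  define W where "W \<omega> = (\<Prod>i\<in>A. indicator {ereal (t i)<..} (\<omega> i)) * (\<Prod>i\<in>B. limit_freq (t i) \<omega>)" for \<omega>
  define Y where "Y i \<omega> = indicat_real {ereal (t b)<..} (\<omega> i)" for i :: nat and \<omega>
  have Wm[measurable]: "W \<in> borel_measurable P" unfolding W_def by measurable
  have Ym[measurable]: "Y i \<in> borel_measurable P" for i unfolding Y_def by measurable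
  have "AE \<omega> in P. \<forall>i\<in>B. limit_freq (t i) \<omega> \<in> {0..1}"
    using limit_freq_bounds[OF P sym] insert.hyps(1) by (simp add: AE_finite_all)
  then have W1: "AE \<omega> in P. \<bar>W \<omega>\<bar> \<le> 1"
  proof eventually_elim
    case (elim \<omega>)
    have "0 \<le> W \<omega>" "W \<omega> \<le> 1"
      unfolding W_def using elim by (auto intro!: mult_le_one prod_nonneg prod_le_1 mult_nonneg_nonneg)
    then show ?case by simp
  qed
  have int: "integrable P (\<lambda>\<omega>. W \<omega> * Y i \<omega>)" for i
    by (rule integrable_const_bound[where B = 1])
      (use W1 in \<open>eventually_elim, auto simp: Y_def abs_mult indicator_def\<close>, measurable)
  define e where "e i = (\<integral>\<omega>. W \<omega> * Y i \<omega> \<partial>P)" for i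
  have e1: "\<bar>e i\<bar> \<le> 1" for i
  proof -
    have "\<bar>e i\<bar> \<le> (\<integral>\<omega>. \<bar>W \<omega> * Y i \<omega>\<bar> \<partial>P)" unfolding e_def by (rule integral_abs_bound)
    also have "\<dots> \<le> (\<integral>\<omega>. 1 \<partial>P)"
    proof (rule integral_mono_AE)
      show "AE \<omega> in P. \<bar>W \<omega> * Y i \<omega>\<bar> \<le> 1"
        using W1 by eventually_elim (auto simp: Y_def abs_mult indicator_def)
    qed (use integrable_abs[OF int] in auto)
    finally show ?thesis by (simp add: prob_space)
  qed
  \<comment> \<open>The transposition of i and b fixes A, which contains neither, and leaves
    limiting frequencies unchanged. Hence W is invariant while the last indicator moves from b to
    i.\<close>
  have e_eq: "e i = e b" if i: "i \<notin> A" for i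
  proof -
    let ?\<pi> = "Transposition.transpose i b"
    have "e b = (\<integral>\<omega>. W \<omega> * Y b \<omega> \<partial>distr P (borel_fun UNIV) (\<lambda>\<omega>. \<omega> \<circ> ?\<pi>))"
      unfolding e_def by (subst symmetric_law_permute[OF P sym]) auto
    also have "\<dots> = (\<integral>\<omega>. W (\<omega> \<circ> ?\<pi>) * Y b (\<omega> \<circ> ?\<pi>) \<partial>P)"
      by (rule integral_distr[OF permute_measurable[OF P(2)]])
        (auto simp: measurable_cong_sets[OF P(2)[symmetric] refl])
    also have "\<dots> = e i"
      unfolding e_def
    proof (intro Bochner_Integration.integral_cong refl)
      fix \<omega>
      have "?\<pi> a = a" if "a \<in> A" for a
        using that i insert.prems by (intro transpose_apply_other) auto
      then have "W (\<omega> \<circ> ?\<pi>) = W \<omega>" by (simp add: W_def limit_freq_transpose)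
      then show "W (\<omega> \<circ> ?\<pi>) * Y b (\<omega> \<circ> ?\<pi>) = W \<omega> * Y i \<omega>" by (simp add: Y_def)
    qed
    finally show ?thesis by simp
  qed
  have mean: "(\<integral>\<omega>. W \<omega> * tail_freq (t b) n \<omega> \<partial>P) = (\<Sum>i<n. e i) / real n" for n
  proof -
    have "(\<integral>\<omega>. W \<omega> * tail_freq (t b) n \<omega> \<partial>P) = (\<integral>\<omega>. (\<Sum>i<n. W \<omega> * Y i \<omega>) / real n \<partial>P)"
      by (simp add: tail_freq_def Y_def sum_distrib_left)
    then show ?thesis using int by (simp add: e_def Bochner_Integration.integral_sum)
  qed
  \<comment> \<open>Only indices in A can have e i different from e b. There are at most card A of
    them, each off by at most 2.\<close>
  have close: "\<bar>(\<Sum>i<n. e i) / real n - e b\<bar> \<le> 2 * real (card A) / real n" if "0 < n" for n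
  proof -
    have "(\<Sum>i<n. e i) / real n - e b = (\<Sum>i<n. e i - e b) / real n"
      using that by (simp add: sum_subtractf field_simps)
    moreover have "\<bar>\<Sum>i<n. e i - e b\<bar> \<le> 2 * real (card A)"
    proof -
      have "(\<Sum>i<n. e i - e b) = (\<Sum>i\<in>{..<n} \<inter> A. e i - e b)"
        by (rule sum.mono_neutral_right) (use e_eq in auto)
      also have "\<bar>\<dots>\<bar> \<le> (\<Sum>i\<in>{..<n} \<inter> A. \<bar>e i - e b\<bar>)" by (rule sum_abs)
      also have "\<dots> \<le> (\<Sum>i\<in>{..<n} \<inter> A. 2)"
      proof (rule sum_mono)
        show "\<bar>e i - e b\<bar> \<le> 2" for i using e1[of i] e1[of b] by linarith
      qed
      also have "\<dots> = 2 * real (card ({..<n} \<inter> A))" by simp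
      also have "\<dots> \<le> 2 * real (card A)"
        using card_mono[of A "{..<n} \<inter> A"] insert.prems by simp
      finally show ?thesis .
    qed
    ultimately show ?thesis using that by (simp add: abs_divide divide_right_mono)
  qed
  have "(\<lambda>k. \<integral>\<omega>. W \<omega> * tail_freq (t b) (4 ^ k) \<omega> \<partial>P) \<longlonglongrightarrow> (\<integral>\<omega>. W \<omega> * limit_freq (t b) \<omega> \<partial>P)"
  proof (rule integral_dominated_convergence[where w = "\<lambda>_. 1"])
    show "AE \<omega> in P. (\<lambda>k. W \<omega> * tail_freq (t b) (4 ^ k) \<omega>) \<longlonglongrightarrow> W \<omega> * limit_freq (t b) \<omega>"
      using tail_freq_LIMSEQ[OF P sym] by eventually_elim (intro tendsto_mult tendsto_const)
    show "AE \<omega> in P. norm (W \<omega> * tail_freq (t b) (4 ^ k) \<omega>) \<le> 1" for k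
      using W1 by eventually_elim (use tail_freq_bounds in \<open>auto simp: abs_mult intro!: mult_le_one\<close>)
  qed auto
  moreover have "(\<lambda>k. \<integral>\<omega>. W \<omega> * tail_freq (t b) (4 ^ k) \<omega> \<partial>P) \<longlonglongrightarrow> e b"
  proof (rule LIM_zero_cancel, rule Lim_null_comparison)
    show "eventually (\<lambda>k. norm ((\<integral>\<omega>. W \<omega> * tail_freq (t b) (4 ^ k) \<omega> \<partial>P) - e b) \<le> 2 * real (card A) * (1 / 4) ^ k) sequentially"
      using close[of "4 ^ _"] unfolding mean by (intro always_eventually) (auto simp: power_divide)
    show "(\<lambda>k. 2 * real (card A) * (1 / 4) ^ k) \<longlonglongrightarrow> 0"
      by (intro tendsto_mult_right_zero LIMSEQ_power_zero) auto
  qed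
  ultimately have "(\<integral>\<omega>. W \<omega> * limit_freq (t b) \<omega> \<partial>P) = e b" by (rule LIMSEQ_unique)
  \<comment> \<open>The index b has moved from the frequency factors to the indicators, which is why
    A is arbitrary in the induction.\<close>
  moreover have "e b = survival P (insert b A \<union> B) t"
  proof -
    have "e b = (\<integral>\<omega>. (\<Prod>i\<in>insert b A. indicator {ereal (t i)<..} (\<omega> i)) * (\<Prod>i\<in>B. limit_freq (t i) \<omega>) \<partial>P)"
      unfolding e_def W_def Y_def using insert.prems by (simp add: mult_ac)
    also have "\<dots> = survival P (insert b A \<union> B) t"
      using insert.prems insert.hyps by (intro insert.IH) auto
    finally show ?thesis .
  qed
  ultimately show ?case
    unfolding W_def using insert.hyps by (simp add: mult_ac)
qed

text \<open>The process minus ln of the limiting frequency lives on the sequence space itself.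
  Frequencies are ordered in time only almost surely for each pair of times; regularising repairs
  this, and right-continuity of survival functions keeps the transforms.\<close>

lemma de_finetti_chronometer:
  assumes P: "prob_space P" "sets P = sets (borel_fun UNIV)" and sym: "symmetric_law P"
  obtains H where "H \<in> P \<rightarrow>\<^sub>M borel_fun UNIV" "\<And>\<omega>. H \<omega> \<in> chron_paths"
    "\<And>J x. finite J \<Longrightarrow> (\<integral>\<omega>. (\<Prod>j\<in>J. expm (H \<omega> (x j))) \<partial>P) = survival P J x"
proof
  let ?y = "\<lambda>\<omega> t. lnm (limit_freq t \<omega>)"
  note [measurable] = tail_freq_measurable[OF P(2)]
  have m: "(\<lambda>\<omega>. ?y \<omega> t) \<in> borel_measurable P" for t by measurable
  show "right_regularisation ?y \<in> P \<rightarrow>\<^sub>M borel_fun UNIV" by (rule right_regularisation_measurable[OF m])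
  show "right_regularisation ?y \<omega> \<in> chron_paths" for \<omega> by (rule right_regularisation_paths)
  fix J x assume J: "finite (J :: nat set)"
  show "(\<integral>\<omega>. (\<Prod>j\<in>J. expm (right_regularisation ?y \<omega> (x j))) \<partial>P) = survival P J x"
  proof (rule regularised_laplace[OF P(1) m])
    show "AE \<omega> in P. 0 \<le> ?y \<omega> t" for t
      using limit_freq_bounds[OF P sym, of t] by eventually_elim (simp add: lnm_nonneg)
    show "AE \<omega> in P. ?y \<omega> s \<le> ?y \<omega> t" if "s \<le> t" for s t
      using tail_freq_LIMSEQ[OF P sym, of t] tail_freq_LIMSEQ[OF P sym, of s]
    proof eventually_elim
      case (elim \<omega>)
      have "limit_freq t \<omega> \<le> limit_freq s \<omega>"
        by (rule LIMSEQ_le[OF elim]) (use tail_freq_antimono[OF that] in auto)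
      then show ?case by (rule lnm_antimono)
    qed
    show "(\<integral>\<omega>. (\<Prod>j\<in>J. expm (?y \<omega> (x j))) \<partial>P) = survival P J x" for x
    proof -
      have "AE \<omega> in P. \<forall>j\<in>J. limit_freq (x j) \<omega> \<in> {0..1}"
        using limit_freq_bounds[OF P sym] J by (simp add: AE_finite_all)
      then have "AE \<omega> in P. (\<Prod>j\<in>J. expm (?y \<omega> (x j))) = (\<Prod>j\<in>J. limit_freq (x j) \<omega>)"
        by eventually_elim (auto intro!: prod.cong simp: expm_lnm)
      then have "(\<integral>\<omega>. (\<Prod>j\<in>J. expm (?y \<omega> (x j))) \<partial>P) = (\<integral>\<omega>. (\<Prod>j\<in>J. limit_freq (x j) \<omega>) \<partial>P)"
        by (intro integral_cong_AE) auto
      also have "\<dots> = survival P J x"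
        using integral_limit_freq_product[OF P sym J, of "{}" x] by simp
      finally show ?thesis .
    qed
    show "(\<lambda>m. survival P J (\<lambda>j. rat_above m (x j))) \<longlonglongrightarrow> survival P J x" for x
      by (rule survival_rat_above_LIMSEQ[OF P J]) simp
  qed
qed

section \<open>Kolmogorov extension for survival functions\<close>

text \<open>
  The library's projective limit requires values in a \<open>polish_space\<close> type, of which \<open>ereal\<close> is no
  instance; any measurable embedding into the reals serves.
\<close>

definition ereal_code :: "ereal \<Rightarrow> real" where
  "ereal_code x = (if x = \<infinity> then 0 else if x = - \<infinity> then -1 else exp (real_of_ereal x))"

definition ereal_decode :: "real \<Rightarrow> ereal" where
  "ereal_decode u = (if 0 < u then ereal (ln u) else if u = 0 then \<infinity> else - \<infinity>)"

lemma ereal_decode_code [simp]: "ereal_decode (ereal_code x) = x"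
  by (cases x) (auto simp: ereal_decode_def ereal_code_def)

lemma ereal_code_measurable [measurable]: "ereal_code \<in> borel_measurable borel"
  unfolding ereal_code_def by measurable

lemma ereal_decode_measurable [measurable]: "ereal_decode \<in> borel_measurable borel"
  unfolding ereal_decode_def by measurable

lemma survival_distr_restrict:
  assumes "sets V = sets (borel_fun H)" "finite K" "K \<subseteq> J" "J \<subseteq> H"
  shows "survival (distr V (borel_fun J) (\<lambda>\<omega>. restrict \<omega> J)) K x = survival V K x"
proof -
  have m: "(\<lambda>\<omega>. restrict \<omega> J) \<in> V \<rightarrow>\<^sub>M borel_fun J"
    unfolding measurable_cong_sets[OF assms(1) refl] by (rule measurable_restrict_subset[OF assms(4)])
  have "{\<omega> \<in> space V. \<forall>j\<in>K. ereal (x j) < restrict \<omega> J j} = {\<omega> \<in> space V. \<forall>j\<in>K. ereal (x j) < \<omega> j}"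
    using assms(3) by auto
  then show ?thesis
    unfolding survival_distr[OF m assms(2,3)] by (simp add: survival_def)
qed

text \<open>Consistency across dimensions is automatic: a law is determined by its survival
  function, and all of these are restrictions of the same F. Hence one law per initial segment
  suffices.\<close>

lemma kolmogorov_survival:
  fixes F :: "nat set \<Rightarrow> (nat \<Rightarrow> real) \<Rightarrow> real"
  assumes ex: "\<And>d. \<exists>V. prob_space V \<and> sets V = sets (borel_fun {..<d}) \<and> (\<forall>J\<subseteq>{..<d}. \<forall>x. survival V J x = F J x)"
  obtains Q where "prob_space Q" "sets Q = sets (borel_fun UNIV)" "\<And>J x. finite J \<Longrightarrow> survival Q J x = F J x"
proof -
  from ex obtain V where V: "\<And>d. prob_space (V d)" "\<And>d. sets (V d) = sets (borel_fun {..<d})"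
      "\<And>d J x. J \<subseteq> {..<d} \<Longrightarrow> survival (V d) J x = F J x"
    by metis
  \<comment> \<open>Any initial segment containing J would serve; the least one makes the choice
    definite.\<close>
  define dim where "dim J = (LEAST d. J \<subseteq> {..<d})" for J :: "nat set"
  have dim: "J \<subseteq> {..<dim J}" if "finite J" for J
    unfolding dim_def using finite_nat_iff_bounded[THEN iffD1, OF that] by (rule LeastI_ex)
  define W where "W J = distr (V (dim J)) (borel_fun J) (\<lambda>\<omega>. restrict \<omega> J)" for J
  have W_prob: "prob_space (W J)" if "finite J" for J
    unfolding W_def
    by (intro prob_space.prob_space_distr V, subst measurable_cong_sets[OF V(2) refl])
      (rule measurable_restrict_subset[OF dim[OF that]])
  have W_sets: "sets (W J) = sets (borel_fun J)" for J by (simp add: W_def)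
  have W_survival: "survival (W J) K x = F K x" if "finite J" "K \<subseteq> J" for J K x
    unfolding W_def using that dim[OF that(1)]
    by (subst survival_distr_restrict[OF V(2)]) (auto intro: V(3) finite_subset)
  have W_restrict: "W J = distr (W H) (borel_fun J) (\<lambda>\<omega>. restrict \<omega> J)" if "J \<subseteq> H" "finite H" for J H
  proof (rule measure_eqI_survival)
    have J: "finite J" using that finite_subset by auto
    show "prob_space (W J)" by (rule W_prob[OF J])
    have "(\<lambda>\<omega>. restrict \<omega> J) \<in> W H \<rightarrow>\<^sub>M borel_fun J"
      unfolding measurable_cong_sets[OF W_sets refl] by (rule measurable_restrict_subset[OF that(1)])
    then show "prob_space (distr (W H) (borel_fun J) (\<lambda>\<omega>. restrict \<omega> J))"
      by (intro prob_space.prob_space_distr W_prob that)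
    fix K x assume K: "finite K" "K \<subseteq> J"
    show "survival (W J) K x = survival (distr (W H) (borel_fun J) (\<lambda>\<omega>. restrict \<omega> J)) K x"
      using K that J by (subst survival_distr_restrict[OF W_sets]) (auto simp: W_survival)
  qed (simp_all add: W_sets)
  define code where "code J \<omega> = (\<lambda>j\<in>J. ereal_code (\<omega> j))" for J :: "nat set" and \<omega>
  have code_m[measurable]: "code J \<in> borel_fun H \<rightarrow>\<^sub>M (\<Pi>\<^sub>M j\<in>J. borel)" if "J \<subseteq> H" for J H
    unfolding code_def
    by (intro measurable_restrict measurable_compose[OF _ ereal_code_measurable] measurable_component_singleton)
      (use that in auto)
  have code_W: "code J \<in> W H \<rightarrow>\<^sub>M (\<Pi>\<^sub>M j\<in>J. borel)" if "J \<subseteq> H" for J H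
    unfolding measurable_cong_sets[OF W_sets refl] by (rule code_m[OF that])
  define PP where "PP J = distr (W J) (\<Pi>\<^sub>M j\<in>J. borel) (code J)" for J
  have "projective_family UNIV PP (\<lambda>_. borel)"
  proof (rule projective_family.intro)
    fix J H :: "nat set" assume JH: "J \<subseteq> H" "finite H" "H \<subseteq> UNIV"
    have res: "(\<lambda>\<omega>. restrict \<omega> J) \<in> W H \<rightarrow>\<^sub>M borel_fun J"
      unfolding measurable_cong_sets[OF W_sets refl] by (rule measurable_restrict_subset[OF JH(1)])
    have "PP J = distr (W H) (\<Pi>\<^sub>M j\<in>J. borel) (code J \<circ> (\<lambda>\<omega>. restrict \<omega> J))"
      unfolding PP_def by (subst W_restrict[OF JH(1,2)], rule distr_distr[OF code_m[OF subset_refl] res])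
    also have "code J \<circ> (\<lambda>\<omega>. restrict \<omega> J) = (\<lambda>f. restrict f J) \<circ> code H"
      using JH(1) by (auto simp: code_def fun_eq_iff)
    also have "distr (W H) (\<Pi>\<^sub>M j\<in>J. borel) ((\<lambda>f. restrict f J) \<circ> code H) = distr (PP H) (\<Pi>\<^sub>M j\<in>J. borel) (\<lambda>f. restrict f J)"
      unfolding PP_def
      by (rule distr_distr[OF measurable_restrict_subset[OF JH(1)] code_W[OF subset_refl], symmetric])
    finally show "PP J = distr (PP H) (\<Pi>\<^sub>M j\<in>J. borel) (\<lambda>f. restrict f J)" .
  next
    fix J :: "nat set" assume "finite J"
    then show "prob_space (PP J)"
      unfolding PP_def by (intro prob_space.prob_space_distr W_prob code_W) auto
  qed
  then interpret PP: polish_projective UNIV PP by (rule polish_projective.intro)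
  define decode where "decode \<omega> j = ereal_decode (\<omega> j)" for \<omega> :: "nat \<Rightarrow> real" and j
  have sets_lim: "sets PP.lim = sets (\<Pi>\<^sub>M j\<in>UNIV. borel)" by simp
  have dec_comp: "(\<lambda>\<omega>. ereal_decode (\<omega> j)) \<in> borel_measurable (\<Pi>\<^sub>M j\<in>J. borel)" if "j \<in> J" for j and J :: "nat set"
    by (rule measurable_compose[OF measurable_component_singleton[OF that] ereal_decode_measurable])
  have dec: "decode \<in> PP.lim \<rightarrow>\<^sub>M borel_fun UNIV"
    unfolding measurable_cong_sets[OF sets_lim refl]
    by (rule measurable_PiM_single') (auto simp: space_PiM decode_def intro: dec_comp)
  show thesis
  proof
    show "prob_space (distr PP.lim (borel_fun UNIV) decode)"
      by (rule PP.P.prob_space_distr[OF dec]) 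
    fix J :: "nat set" and x assume J: "finite J"
    define B where "B = {\<omega> \<in> space (\<Pi>\<^sub>M j\<in>J. borel). \<forall>j\<in>J. ereal (x j) < ereal_decode (\<omega> j)}"
    have B: "B \<in> sets (\<Pi>\<^sub>M j\<in>J. borel)"
      unfolding B_def
    proof (intro sets.sets_Collect_finite_All J)
      fix j assume "j \<in> J"
      note [measurable] = dec_comp[OF this]
      show "{\<omega> \<in> space (\<Pi>\<^sub>M j\<in>J. borel). ereal (x j) < ereal_decode (\<omega> j)} \<in> sets (\<Pi>\<^sub>M j\<in>J. borel)"
        by measurable
    qed
    have "survival (distr PP.lim (borel_fun UNIV) decode) J x
        = measure PP.lim {\<omega> \<in> space PP.lim. \<forall>j\<in>J. ereal (x j) < decode \<omega> j}"
      by (rule survival_distr[OF dec J]) simp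
    also have "{\<omega> \<in> space PP.lim. \<forall>j\<in>J. ereal (x j) < decode \<omega> j} = prod_emb UNIV (\<lambda>_. borel) J B"
      by (auto simp: B_def decode_def prod_emb_def space_PiM)
    also have "measure PP.lim \<dots> = measure (PP J) B"
      by (rule PP.measure_lim_emb[OF _ J B]) simp
    also have "\<dots> = measure (W J) (code J -` B \<inter> space (W J))"
      unfolding PP_def by (rule measure_distr[OF code_W[OF subset_refl] B])
    also have "code J -` B \<inter> space (W J) = {\<omega> \<in> space (W J). \<forall>j\<in>J. ereal (x j) < \<omega> j}"
      by (auto simp: B_def code_def space_PiM)
    also have "measure (W J) \<dots> = F J x"
      using W_survival[OF J subset_refl, of x] by (simp add: survival_def)
    finally show "survival (distr PP.lim (borel_fun UNIV) decode) J x = F J x" .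
  qed simp
qed

section \<open>Path laws combined with independent exponential levels\<close>

lemma D_inf_component: "H \<in> M \<rightarrow>\<^sub>M D_inf_space \<Longrightarrow> (\<lambda>\<omega>. H \<omega> t) \<in> borel_measurable M"
  by (rule borel_fun_component[OF D_inf_space_imp_borel_fun])

lemma first_passage_measurable:
  assumes paths: "\<And>\<omega>. \<omega> \<in> space N \<Longrightarrow> H \<omega> \<in> chron_paths"
    and H: "H \<in> N \<rightarrow>\<^sub>M D_inf_space" and E: "E \<in> N \<rightarrow>\<^sub>M (\<Pi>\<^sub>M i\<in>UNIV. borel)"
  shows "(\<lambda>\<omega>. first_passage (H \<omega>) (E \<omega>)) \<in> N \<rightarrow>\<^sub>M borel_fun UNIV"
proof (rule measurable_PiM_single')
  fix i
  note [measurable] = D_inf_component[OF H]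
  have [measurable]: "(\<lambda>\<omega>. E \<omega> i) \<in> borel_measurable N"
    using measurable_compose[OF E measurable_component_singleton[of i UNIV]] by simp
  show "(\<lambda>\<omega>. first_passage (H \<omega>) (E \<omega>) i) \<in> borel_measurable N"
  proof (rule borel_measurable_ereal_real_rays)
    fix r
    have "{\<omega> \<in> space N. H \<omega> r < ereal (E \<omega> i)} \<in> sets N" by measurable
    also have "{\<omega> \<in> space N. H \<omega> r < ereal (E \<omega> i)} = {\<omega> \<in> space N. ereal r < first_passage (H \<omega>) (E \<omega>) i}"
      using less_first_passage_iff[OF paths] by auto
    finally show "{\<omega> \<in> space N. ereal r < first_passage (H \<omega>) (E \<omega>) i} \<in> sets N" .
  qed
qed (auto simp: space_PiM)

lemma distr_pair_snd:
  assumes "prob_space A" "prob_space B"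
  shows "distr (A \<Otimes>\<^sub>M B) B snd = B"
proof (rule measure_eqI)
  interpret A: prob_space A by fact
  interpret B: prob_space B by fact
  fix X assume "X \<in> sets (distr (A \<Otimes>\<^sub>M B) B snd)"
  then have X: "X \<in> sets B" by simp
  have "snd -` X \<inter> space (A \<Otimes>\<^sub>M B) = space A \<times> X"
    using sets.sets_into_space[OF X] by (auto simp: space_pair_measure)
  then show "emeasure (distr (A \<Otimes>\<^sub>M B) B snd) X = emeasure B X"
    using X by (simp add: emeasure_distr B.emeasure_pair_measure_Times A.emeasure_space_1)
qed simp

text \<open>The carrier holds good paths only, so the first projection of a product over it has good
  paths at every outcome, as \<open>extended_chronometer\<close> demands, and not merely almost
  everywhere.\<close>

definition chron_space :: "(real \<Rightarrow> ereal) measure" where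
  "chron_space = restrict_space (borel_fun UNIV) chron_paths"

definition exponentials :: "(nat \<Rightarrow> real) measure" where
  "exponentials = (\<Pi>\<^sub>M i\<in>UNIV. density lborel (exponential_density 1))"

lemma space_chron_space: "space chron_space = chron_paths"
  by (simp add: chron_space_def space_restrict_space space_PiM)

lemma measurable_into_chron_space:
  "H \<in> M \<rightarrow>\<^sub>M borel_fun UNIV \<Longrightarrow> (\<And>\<omega>. \<omega> \<in> space M \<Longrightarrow> H \<omega> \<in> chron_paths) \<Longrightarrow> H \<in> M \<rightarrow>\<^sub>M chron_space"
  unfolding chron_space_def by (auto intro!: measurable_restrict_space2)

lemma chron_space_into_D_inf: "(\<lambda>h. h) \<in> chron_space \<rightarrow>\<^sub>M D_inf_space"
  unfolding D_inf_space_def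
  by (rule measurable_restrict_space2)
    (use chron_paths_subset_D_inf space_chron_space in \<open>auto simp: chron_space_def intro: measurable_restrict_space1\<close>)

lemma sets_exponentials: "sets exponentials = sets (\<Pi>\<^sub>M i\<in>UNIV. borel)"
  unfolding exponentials_def by (intro sets_PiM_cong) auto

lemma prob_space_exponentials: "prob_space exponentials"
  unfolding exponentials_def
  by (intro prob_space_PiM) (simp add: prob_space_exponential_density)

lemma unit_exponentials_snd:
  assumes D: "prob_space D"
  shows "unit_exponentials (D \<Otimes>\<^sub>M exponentials) snd"
proof -
  let ?e = "density lborel (exponential_density 1) :: real measure"
  let ?N = "D \<Otimes>\<^sub>M exponentials"
  interpret D: prob_space D by fact
  interpret E: prob_space exponentials by (rule prob_space_exponentials)
  interpret pair_prob_space D exponentials ..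
  have pe: "prob_space ?e" by (simp add: prob_space_exponential_density)
  have comp: "(\<lambda>\<omega>. \<omega> i) \<in> borel_measurable exponentials" for i
    unfolding measurable_cong_sets[OF sets_exponentials refl] by (rule measurable_component_singleton) simp
  have sm[measurable]: "(\<lambda>\<omega>. snd \<omega> i) \<in> borel_measurable ?N" for i
    by (rule measurable_compose[OF measurable_snd comp])
  have law: "distr ?N borel (\<lambda>\<omega>. snd \<omega> i) = ?e" for i
  proof -
    have "distr ?N borel (\<lambda>\<omega>. snd \<omega> i) = distr (distr ?N exponentials snd) borel (\<lambda>\<omega>. \<omega> i)"
      by (subst distr_distr[OF comp measurable_snd]) (simp add: o_def)
    also have "\<dots> = distr exponentials ?e (\<lambda>\<omega>. \<omega> i)"
      unfolding distr_pair_snd[OF D prob_space_exponentials] by (rule distr_cong) auto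
    also have "\<dots> = ?e"
      unfolding exponentials_def by (rule distr_PiM_component) (use pe in auto)
    finally show ?thesis .
  qed
  have "distr ?N (\<Pi>\<^sub>M i\<in>UNIV. borel) (\<lambda>\<omega>. \<lambda>i\<in>UNIV. snd \<omega> i) = (\<Pi>\<^sub>M i\<in>UNIV. distr ?N borel (\<lambda>\<omega>. snd \<omega> i))"
  proof -
    have "distr ?N (\<Pi>\<^sub>M i\<in>UNIV. borel) (\<lambda>\<omega>. \<lambda>i\<in>UNIV. snd \<omega> i) = distr ?N exponentials snd"
      by (rule distr_cong) (auto simp: sets_exponentials)
    then show ?thesis unfolding law distr_pair_snd[OF D prob_space_exponentials] by (simp add: exponentials_def)
  qed
  then have "indep_vars (\<lambda>_. borel) (\<lambda>i \<omega>. snd \<omega> i) UNIV"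
    by (subst indep_vars_iff_distr_eq_PiM) auto
  moreover have "distributed ?N lborel (\<lambda>\<omega>. snd \<omega> i) (exponential_density 1)" for i
  proof -
    have "distr ?N lborel (\<lambda>\<omega>. snd \<omega> i) = distr ?N borel (\<lambda>\<omega>. snd \<omega> i)"
      by (rule distr_cong) auto
    then show ?thesis unfolding distributed_def using law by auto
  qed
  ultimately show ?thesis by (simp add: unit_exponentials_def)
qed

text \<open>Events of the two projections are strips that meet in a rectangle, where the product
  measure multiplies.\<close>

lemma independent_fst_snd:
  assumes D: "prob_space D" "sets D = sets chron_space"
  shows "independent (D \<Otimes>\<^sub>M exponentials) D_inf_space fst (\<Pi>\<^sub>M i\<in>UNIV. borel) snd"
proof -
  let ?N = "D \<Otimes>\<^sub>M exponentials"
  interpret D: prob_space D by fact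
  interpret E: prob_space exponentials by (rule prob_space_exponentials)
  interpret pair_prob_space D exponentials ..
  have id_D: "(\<lambda>h. h) \<in> D \<rightarrow>\<^sub>M D_inf_space"
    unfolding measurable_cong_sets[OF D(2) refl] by (rule chron_space_into_D_inf)
  have f: "fst \<in> ?N \<rightarrow>\<^sub>M D_inf_space" by (rule measurable_compose[OF measurable_fst id_D])
  have s: "snd \<in> ?N \<rightarrow>\<^sub>M (\<Pi>\<^sub>M i\<in>UNIV. borel)"
    unfolding measurable_cong_sets[OF refl sets_exponentials[symmetric]] by (rule measurable_snd)
  have "indep_set {fst -` A \<inter> space ?N | A. A \<in> sets D_inf_space}
      {snd -` B \<inter> space ?N | B. B \<in> sets (\<Pi>\<^sub>M i\<in>UNIV. borel)}"
  proof (rule indep_setI)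
    show "{fst -` A \<inter> space ?N | A. A \<in> sets D_inf_space} \<subseteq> events" using measurable_sets[OF f] by auto
    show "{snd -` B \<inter> space ?N | B. B \<in> sets (\<Pi>\<^sub>M i\<in>UNIV. borel)} \<subseteq> events" using measurable_sets[OF s] by auto
    fix a b assume "a \<in> {fst -` A \<inter> space ?N | A. A \<in> sets D_inf_space}"
      and "b \<in> {snd -` B \<inter> space ?N | B. B \<in> sets (\<Pi>\<^sub>M i\<in>UNIV. borel)}"
    then obtain A B where A: "A \<in> sets D_inf_space" "a = fst -` A \<inter> space ?N"
      and B: "B \<in> sets (\<Pi>\<^sub>M i\<in>UNIV. borel)" "b = snd -` B \<inter> space ?N" by auto
    define A' where "A' = A \<inter> space D"
    define B' where "B' = B \<inter> space exponentials"
    have A': "A' \<in> sets D" using measurable_sets[OF id_D A(1)] by (simp add: A'_def)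
    have B': "B' \<in> sets exponentials" using B(1) sets_exponentials by (auto simp: B'_def)
    have eqs: "a = A' \<times> space exponentials" "b = space D \<times> B'" "a \<inter> b = A' \<times> B'"
      by (auto simp: A(2) B(2) A'_def B'_def space_pair_measure)
    have "prob (A' \<times> space exponentials) = measure D A'" "prob (space D \<times> B') = measure exponentials B'"
      "prob (A' \<times> B') = measure D A' * measure exponentials B'"
      using A' B' by (simp_all add: measure_def E.emeasure_pair_measure_Times D.emeasure_space_1
          E.emeasure_space_1 enn2real_mult)
    then show "prob (a \<inter> b) = prob a * prob b"
      unfolding eqs(3) unfolding eqs(1,2) by simp
  qed
  then show ?thesis using f s by (simp add: independent_def)
qed

lemma fst_chron_paths:
  assumes "sets D = sets chron_space" "\<omega> \<in> space (D \<Otimes>\<^sub>M exponentials)"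
  shows "fst \<omega> \<in> chron_paths"
  using assms(2) sets_eq_imp_space_eq[OF assms(1)]
  unfolding space_pair_measure space_chron_space by (simp add: mem_Times_iff)

lemma prod_expm_measurable: "(\<lambda>h. \<Prod>j\<in>J. expm (h (x j))) \<in> borel_measurable chron_space"
  by (intro borel_measurable_prod measurable_compose[OF _ expm_measurable] D_inf_component[OF chron_space_into_D_inf])

lemma laplace_fst:
  assumes D: "sets D = sets chron_space"
  shows "(\<integral>\<omega>. (\<Prod>j\<in>J. expm (fst \<omega> (x j))) \<partial>(D \<Otimes>\<^sub>M exponentials)) = (\<integral>h. (\<Prod>j\<in>J. expm (h (x j))) \<partial>D)"
proof -
  have "(\<integral>h. (\<Prod>j\<in>J. expm (h (x j))) \<partial>distr (D \<Otimes>\<^sub>M exponentials) D fst)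
      = (\<integral>\<omega>. (\<Prod>j\<in>J. expm (fst \<omega> (x j))) \<partial>(D \<Otimes>\<^sub>M exponentials))"
    by (rule integral_distr[OF measurable_fst])
      (unfold measurable_cong_sets[OF D refl], rule prod_expm_measurable)
  then show ?thesis
    unfolding prob_space.distr_pair_fst[OF prob_space_exponentials] by simp
qed

text \<open>The first passage times of a path drawn from D across independent exponential levels.
  This is the device that turns a root of H into a root of X.\<close>

definition passage_law :: "(real \<Rightarrow> ereal) measure \<Rightarrow> (nat \<Rightarrow> ereal) measure" where
  "passage_law D = distr (D \<Otimes>\<^sub>M exponentials) (borel_fun UNIV) (\<lambda>\<omega>. first_passage (fst \<omega>) (snd \<omega>))"

lemma passage_law:
  assumes D: "prob_space D" "sets D = sets chron_space"
  shows "prob_space (passage_law D)" "sets (passage_law D) = sets (borel_fun UNIV)"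
    "finite J \<Longrightarrow> survival (passage_law D) J x = (\<integral>h. (\<Prod>j\<in>J. expm (h (x j))) \<partial>D)"
proof -
  let ?N = "D \<Otimes>\<^sub>M exponentials"
  interpret D: prob_space D by fact
  interpret E: prob_space exponentials by (rule prob_space_exponentials)
  interpret pair_prob_space D exponentials ..
  note paths = fst_chron_paths[OF D(2)]
  note ind = independent_fst_snd[OF D]
  have m: "(\<lambda>\<omega>. first_passage (fst \<omega>) (snd \<omega>)) \<in> ?N \<rightarrow>\<^sub>M borel_fun UNIV"
  proof (rule first_passage_measurable[where H = fst and E = snd])
    show "fst \<in> ?N \<rightarrow>\<^sub>M D_inf_space"
      by (rule ind[unfolded independent_def, THEN conjunct1])
    show "snd \<in> ?N \<rightarrow>\<^sub>M (\<Pi>\<^sub>M i\<in>UNIV. borel)"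
      by (rule ind[unfolded independent_def, THEN conjunct2, THEN conjunct1])
  qed (rule paths)
  show "prob_space (passage_law D)" unfolding passage_law_def by (rule prob_space_distr[OF m])
  show "sets (passage_law D) = sets (borel_fun UNIV)" by (simp add: passage_law_def)
  assume J: "finite J"
  have "survival (passage_law D) J x = prob {\<omega> \<in> space ?N. \<forall>j\<in>J. ereal (x j) < first_passage (fst \<omega>) (snd \<omega>) j}"
    unfolding passage_law_def by (rule survival_distr[OF m J]) simp
  also have "\<dots> = (\<integral>\<omega>. (\<Prod>j\<in>J. expm (fst \<omega> (x j))) \<partial>?N)"
    by (rule first_passage_survival[OF _ paths unit_exponentials_snd[OF D(1)] ind J]) (rule prob_space_axioms)
  also have "\<dots> = (\<integral>h. (\<Prod>j\<in>J. expm (h (x j))) \<partial>D)" by (rule laplace_fst[OF D(2)])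
  finally show "survival (passage_law D) J x = (\<integral>h. (\<Prod>j\<in>J. expm (h (x j))) \<partial>D)" .
qed

section \<open>Independent copies\<close>

lemma iid_PiM:
  assumes Q: "prob_space Q" and f: "f \<in> Q \<rightarrow>\<^sub>M S" and n: "1 \<le> n"
  shows "iid (\<Pi>\<^sub>M i\<in>{..<n}. Q) S (\<lambda>i \<omega>. f (\<omega> i)) {..<n :: nat}"
proof -
  let ?N = "\<Pi>\<^sub>M i\<in>{..<n}. Q"
  interpret prob_space ?N using Q by (rule prob_space_PiM)
  have comp: "(\<lambda>\<omega>. \<omega> i) \<in> ?N \<rightarrow>\<^sub>M Q" if "i \<in> {..<n}" for i
    by (rule measurable_component_singleton[OF that])
  have law: "distr ?N Q (\<lambda>\<omega>. \<omega> i) = Q" if "i \<in> {..<n}" for i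
    by (rule distr_PiM_component[OF Q that])
  have "distr ?N ?N (\<lambda>\<omega>. \<lambda>i\<in>{..<n}. \<omega> i) = ?N"
    by (subst distr_id2[OF refl, symmetric], rule distr_cong) (auto simp: space_PiM)
  also have "?N = (\<Pi>\<^sub>M i\<in>{..<n}. distr ?N Q (\<lambda>\<omega>. \<omega> i))"
    by (rule PiM_cong) (auto simp: law)
  finally have "indep_vars (\<lambda>_. Q) (\<lambda>i \<omega>. \<omega> i) {..<n}"
    using n comp by (subst indep_vars_iff_distr_eq_PiM') (auto simp: lessThan_empty_iff)
  then have "indep_vars (\<lambda>_. S) (\<lambda>i \<omega>. f (\<omega> i)) {..<n}"
    by (rule indep_vars_compose2) (rule f)
  moreover have "distr ?N S (\<lambda>\<omega>. f (\<omega> i)) = distr Q S f" if "i \<in> {..<n}" for i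
  proof -
    have "distr ?N S (\<lambda>\<omega>. f (\<omega> i)) = distr (distr ?N Q (\<lambda>\<omega>. \<omega> i)) S f"
      using distr_distr[OF f comp[OF that]] by (simp add: o_def)
    then show ?thesis by (simp add: law[OF that])
  qed
  ultimately show ?thesis using prob_space_axioms by (auto simp: iid_def)
qed

lemma iidD:
  assumes "iid M S Y {..<n :: nat}"
  shows "prob_space M" "prob_space.indep_vars M (\<lambda>_. S) Y {..<n}"
    "i < n \<Longrightarrow> Y i \<in> M \<rightarrow>\<^sub>M S" "i < n \<Longrightarrow> distr M S (Y i) = distr M S (Y 0)"
proof -
  show M: "prob_space M" and ind: "prob_space.indep_vars M (\<lambda>_. S) Y {..<n}"
    using assms unfolding iid_def by blast+
  show "Y i \<in> M \<rightarrow>\<^sub>M S" if "i < n"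
    using ind that unfolding prob_space.indep_vars_def[OF M] by blast
  show "distr M S (Y i) = distr M S (Y 0)" if "i < n"
  proof -
    have "i \<in> {..<n}" "0 \<in> {..<n}" using that by auto
    then show ?thesis using assms unfolding iid_def by blast
  qed
qed

lemma iid_all_in:
  assumes iid: "iid M S Y {..<n :: nat}" and n: "1 \<le> n" and B: "B \<in> sets S"
  shows "measure M {\<omega> \<in> space M. \<forall>i<n. Y i \<omega> \<in> B} = measure M {\<omega> \<in> space M. Y 0 \<omega> \<in> B} ^ n"
proof -
  interpret prob_space M by (rule iidD[OF iid])
  note Y = iidD(2-4)[OF iid]
  have vim: "Y i -` B \<inter> space M = {\<omega> \<in> space M. Y i \<omega> \<in> B}" for i by auto
  have "prob (\<Inter>i\<in>{..<n}. Y i -` B \<inter> space M) = (\<Prod>i\<in>{..<n}. prob (Y i -` B \<inter> space M))"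
    by (rule indep_varsD[OF Y(1)]) (use n B in \<open>auto simp: lessThan_empty_iff\<close>)
  also have "(\<Inter>i\<in>{..<n}. Y i -` B \<inter> space M) = {\<omega> \<in> space M. \<forall>i<n. Y i \<omega> \<in> B}"
    using n by (auto simp: lessThan_empty_iff)
  also have "(\<Prod>i\<in>{..<n}. prob (Y i -` B \<inter> space M)) = (\<Prod>i\<in>{..<n}. prob (Y 0 -` B \<inter> space M))"
  proof (rule prod.cong)
    fix i assume "i \<in> {..<n}"
    then have "measure (distr M S (Y i)) B = measure (distr M S (Y 0)) B"
      by (subst Y(3)) auto
    then show "prob (Y i -` B \<inter> space M) = prob (Y 0 -` B \<inter> space M)"
      using \<open>i \<in> {..<n}\<close> n B Y(2) by (simp add: measure_distr)
  qed simp
  finally show ?thesis by (simp add: vim)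
qed

lemma iid_survival_Min:
  assumes iid: "iid N (borel_fun I) Y {..<n :: nat}" and n: "1 \<le> n" and J: "finite J" "J \<subseteq> I"
  shows "measure N {\<omega> \<in> space N. \<forall>j\<in>J. ereal (x j) < (MIN i\<in>{..<n}. Y i \<omega> j)}
       = survival (distr N (borel_fun I) (Y 0)) J x ^ n"
proof -
  note Y = iidD[OF iid]
  let ?B = "{\<omega> \<in> space (borel_fun I). \<forall>j\<in>J. ereal (x j) < \<omega> j}"
  have "ereal (x j) < (MIN i\<in>{..<n}. Y i \<omega> j) \<longleftrightarrow> (\<forall>i<n. ereal (x j) < Y i \<omega> j)" for \<omega> j
    using n by (subst Min_gr_iff) (auto simp: lessThan_empty_iff)
  then have "{\<omega> \<in> space N. \<forall>j\<in>J. ereal (x j) < (MIN i\<in>{..<n}. Y i \<omega> j)}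
      = {\<omega> \<in> space N. \<forall>i<n. Y i \<omega> \<in> ?B}"
    using measurable_space[OF Y(3)] by auto
  also have "measure N \<dots> = measure N {\<omega> \<in> space N. Y 0 \<omega> \<in> ?B} ^ n"
    by (rule iid_all_in[OF iid n]) (rule upper_box_sets[OF J refl])
  also have "{\<omega> \<in> space N. Y 0 \<omega> \<in> ?B} = {\<omega> \<in> space N. \<forall>j\<in>J. ereal (x j) < Y 0 \<omega> j}"
    using n measurable_space[OF Y(3)[of 0]] by auto
  finally show ?thesis
    using n by (subst survival_distr[OF Y(3) J]) auto
qed

text \<open>If one variable falls in B with probability p, all of them do with probability p^n; when
  this is 0, so is p.\<close>

lemma iid_AE_not_all:
  assumes iid: "iid M S Y {..<n :: nat}" and n: "1 \<le> n" and B: "B \<in> sets S"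
    and none: "AE \<omega> in M. \<not> (\<forall>i<n. Y i \<omega> \<in> B)" and i: "i < n"
  shows "AE \<omega> in M. Y i \<omega> \<notin> B"
proof -
  interpret prob_space M by (rule iidD[OF iid])
  note Y = iidD(2-4)[OF iid]
  have vim: "{\<omega> \<in> space M. Y i \<omega> \<in> B} = Y i -` B \<inter> space M" for i by auto
  have meas: "{\<omega> \<in> space M. Y i \<omega> \<in> B} \<in> sets M" if "i < n" for i
    unfolding vim by (rule measurable_sets[OF Y(2)[OF that] B])
  have law: "measure M {\<omega> \<in> space M. Y i \<omega> \<in> B} = measure (distr M S (Y i)) B" if "i < n" for i
    unfolding vim by (rule measure_distr[symmetric, OF Y(2)[OF that] B])
  have all: "{\<omega> \<in> space M. \<forall>i<n. Y i \<omega> \<in> B} \<in> sets M"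
  proof -
    have "{\<omega> \<in> space M. \<forall>i\<in>{..<n}. Y i \<omega> \<in> B} \<in> sets M"
      by (rule sets.sets_Collect_finite_All) (use meas in auto)
    then show ?thesis by (simp only: lessThan_iff Ball_def)
  qed
  have "AE \<omega> in M. \<omega> \<notin> {\<omega> \<in> space M. \<forall>i<n. Y i \<omega> \<in> B}"
    using none by (rule eventually_mono) blast
  then have "measure M {\<omega> \<in> space M. \<forall>i<n. Y i \<omega> \<in> B} = 0"
    using prob_eq_0[OF all] by blast
  then have "measure M {\<omega> \<in> space M. Y 0 \<omega> \<in> B} ^ n = 0"
    using iid_all_in[OF iid n B] by (simp only:)
  then have "measure M {\<omega> \<in> space M. Y i \<omega> \<in> B} = 0"
    unfolding law[OF i] Y(3)[OF i] using n by (subst (asm) law) auto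
  then have "AE \<omega> in M. \<omega> \<notin> {\<omega> \<in> space M. Y i \<omega> \<in> B}"
    using prob_eq_0[OF meas[OF i]] by blast
  then show ?thesis using AE_space[of M] by eventually_elim blast
qed

text \<open>Infinite values could destroy strictness, but f i < g i keeps every f i below
  \<infinity> and every g i above -\<infinity>.\<close>

lemma ereal_sum_strict_mono:
  fixes f g :: "nat \<Rightarrow> ereal"
  assumes "1 \<le> n" "\<And>i. i < n \<Longrightarrow> f i < g i"
  shows "(\<Sum>i<n. f i) < (\<Sum>i<n. g i)"
  using assms
proof (induction n rule: nat_induct_at_least)
  case (Suc n)
  then show ?case by (auto intro!: ereal_add_strict_mono2)
qed simp

text \<open>On non-negative arguments \<open>expm\<close> turns the sum into a product, for which an
  almost sure sign is enough under the integral. Independence then factorises the mean, and equal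
  laws make the factors equal.\<close>

lemma iid_laplace_sum:
  assumes iid: "iid M (borel_fun UNIV) Y {..<n :: nat}" and n: "1 \<le> n" and J: "finite J"
    and nn: "\<And>i t. i < n \<Longrightarrow> AE \<omega> in M. 0 \<le> Y i \<omega> t"
  shows "(\<integral>\<omega>. (\<Prod>j\<in>J. expm (\<Sum>i<n. Y i \<omega> (x j))) \<partial>M) = (\<integral>\<omega>. (\<Prod>j\<in>J. expm (Y 0 \<omega> (x j))) \<partial>M) ^ n"
proof -
  interpret prob_space M by (rule iidD[OF iid])
  note Y = iidD(2-4)[OF iid]
  define G where "G h = (\<Prod>j\<in>J. expm (h (x j)))" for h :: "_ \<Rightarrow> ereal"
  have G[measurable]: "G \<in> borel_measurable (borel_fun UNIV)"
    unfolding G_def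
    by (intro borel_measurable_prod measurable_compose[OF _ expm_measurable] measurable_component_singleton) simp
  have c: "(\<lambda>\<omega>. Y i \<omega> t) \<in> borel_measurable M" if "i \<in> {..<n}" for i t
    by (rule borel_fun_component[OF Y(2)]) (use that in simp)
  have good: "AE \<omega> in M. \<forall>i\<in>{..<n}. \<forall>j\<in>J. 0 \<le> Y i \<omega> (x j)"
    using nn J by (intro AE_finite_allI) auto
  have "(\<integral>\<omega>. (\<Prod>j\<in>J. expm (\<Sum>i<n. Y i \<omega> (x j))) \<partial>M) = (\<integral>\<omega>. (\<Prod>i<n. G (Y i \<omega>)) \<partial>M)"
  proof (rule integral_cong_AE)
    show "AE \<omega> in M. (\<Prod>j\<in>J. expm (\<Sum>i<n. Y i \<omega> (x j))) = (\<Prod>i<n. G (Y i \<omega>))"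
      using good
    proof eventually_elim
      case (elim \<omega>)
      have "(\<Prod>j\<in>J. expm (\<Sum>i<n. Y i \<omega> (x j))) = (\<Prod>j\<in>J. \<Prod>i<n. expm (Y i \<omega> (x j)))"
        using elim by (intro prod.cong refl expm_sum) auto
      also have "\<dots> = (\<Prod>i<n. G (Y i \<omega>))" unfolding G_def by (rule prod.swap)
      finally show ?case .
    qed
    show "(\<lambda>\<omega>. \<Prod>i<n. G (Y i \<omega>)) \<in> borel_measurable M"
      by (intro borel_measurable_prod measurable_compose[OF Y(2) G]) auto
    have "(\<lambda>\<omega>. \<Sum>i<n. Y i \<omega> t) \<in> borel_measurable M" for t
      by (rule borel_measurable_ereal_sum) (rule c)
    then show "(\<lambda>\<omega>. \<Prod>j\<in>J. expm (\<Sum>i<n. Y i \<omega> (x j))) \<in> borel_measurable M"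
      by (intro borel_measurable_prod measurable_compose[OF _ expm_measurable])
  qed
  also have "\<dots> = (\<Prod>i<n. \<integral>\<omega>. G (Y i \<omega>) \<partial>M)"
  proof (rule indep_vars_lebesgue_integral)
    show "indep_vars (\<lambda>_. borel) (\<lambda>i \<omega>. G (Y i \<omega>)) {..<n}"
      by (rule indep_vars_compose2[OF Y(1)]) (rule G)
    fix i assume i: "i \<in> {..<n}"
    show "integrable M (\<lambda>\<omega>. G (Y i \<omega>))"
    proof (rule integrable_const_bound[where B = 1])
      show "AE \<omega> in M. norm (G (Y i \<omega>)) \<le> 1"
        using good
      proof eventually_elim
        case (elim \<omega>)
        then show ?case using prod_expm_bounds[of J "\<lambda>j. Y i \<omega> (x j)"] i by (simp add: G_def)
      qed
      show "(\<lambda>\<omega>. G (Y i \<omega>)) \<in> borel_measurable M"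
        by (rule measurable_compose[OF Y(2) G]) (use i in auto)
    qed
  qed simp
  also have "\<dots> = (\<Prod>i<n. \<integral>\<omega>. G (Y 0 \<omega>) \<partial>M)"
  proof (rule prod.cong)
    fix i assume i: "i \<in> {..<n}"
    have "(\<integral>\<omega>. G (Y i \<omega>) \<partial>M) = integral\<^sup>L (distr M (borel_fun UNIV) (Y i)) G"
      by (rule integral_distr[symmetric, OF Y(2) G]) (use i in auto)
    also have "\<dots> = integral\<^sup>L (distr M (borel_fun UNIV) (Y 0)) G" by (subst Y(3)) (use i in auto)
    also have "\<dots> = (\<integral>\<omega>. G (Y 0 \<omega>) \<partial>M)"
      by (rule integral_distr[OF Y(2) G]) (use n in auto)
    finally show "(\<integral>\<omega>. G (Y i \<omega>) \<partial>M) = (\<integral>\<omega>. G (Y 0 \<omega>) \<partial>M)" .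
  qed simp
  finally show ?thesis by (simp add: G_def)
qed

section \<open>Exchangeability and min-infinite divisibility of sequences\<close>

lemma upper_box_image:
  assumes "inj_on f J"
  shows "{\<omega> \<in> \<Omega>. \<forall>j\<in>J. ereal (x j) < \<omega> (f j)} = {\<omega> \<in> \<Omega>. \<forall>j\<in>f ` J. ereal ((x \<circ> inv_into J f) j) < \<omega> j}"
proof -
  have "(x \<circ> inv_into J f) (f j) = x j" if "j \<in> J" for j using inv_into_f_f[OF assms that] by simp
  then show ?thesis by (simp del: o_apply cong: ball_cong)
qed

text \<open>A relabelled box is a box over the image of J with the thresholds carried along f.
  Symmetry thus becomes a statement about values of \<open>survival\<close> alone, to be read off
  from any formula for them.\<close>

lemma symmetric_law_iff:
  "symmetric_law P \<longleftrightarrow> (\<forall>J f x. finite J \<longrightarrow> inj_on f J \<longrightarrow> survival P (f ` J) (x \<circ> inv_into J f) = survival P J x)"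
proof -
  have "survival P (f ` J) (x \<circ> inv_into J f) = measure P {\<omega> \<in> space P. \<forall>j\<in>J. ereal (x j) < \<omega> (f j)}"
    if "inj_on f J" for J x and f :: "nat \<Rightarrow> nat"
    unfolding survival_def upper_box_image[OF that] ..
  then show ?thesis unfolding symmetric_law_def by (simp cong: imp_cong)
qed

lemma power_eq_imp_eq_root:
  assumes "0 \<le> a" "a ^ n = b" "1 \<le> n"
  shows "a = root n b"
  using assms real_root_power_cancel[of n a] by auto

text \<open>Non-negative n-th roots are unique, so an equality between two values of the survival
  function of P carries over to Q.\<close>

lemma symmetric_law_root:
  assumes sym: "symmetric_law P" and n: "1 \<le> n"
    and root: "\<And>J x. finite J \<Longrightarrow> survival Q J x ^ n = survival P J x"
  shows "symmetric_law Q"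
  unfolding symmetric_law_iff
proof (intro allI impI)
  fix J and f :: "nat \<Rightarrow> nat" and x assume J: "finite J" "inj_on f J"
  have "survival Q (f ` J) (x \<circ> inv_into J f) = root n (survival P (f ` J) (x \<circ> inv_into J f))"
    by (rule power_eq_imp_eq_root[OF survival_nonneg _ n]) (rule root, use J in auto)
  also have "\<dots> = root n (survival P J x)" using sym J unfolding symmetric_law_iff by metis
  also have "\<dots> = survival Q J x"
    by (rule power_eq_imp_eq_root[OF survival_nonneg _ n, symmetric]) (rule root, use J in auto)
  finally show "survival Q (f ` J) (x \<circ> inv_into J f) = survival Q J x" .
qed

lemma marginal_measurable: "marginal d i \<in> borel_fun UNIV \<rightarrow>\<^sub>M borel_fun {..<d}"
  unfolding marginal_def by (intro measurable_restrict measurable_component_singleton) simp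

lemma survival_marginal:
  assumes X: "X \<in> M \<rightarrow>\<^sub>M borel_fun UNIV" and J: "J \<subseteq> {..<d}"
  shows "survival (distr M (borel_fun {..<d}) (\<lambda>\<omega>. marginal d i (X \<omega>))) J x
       = measure M {\<omega> \<in> space M. \<forall>j\<in>J. ereal (x j) < X \<omega> (i j)}"
proof -
  have "finite J" using J finite_subset by blast
  then have "survival (distr M (borel_fun {..<d}) (\<lambda>\<omega>. marginal d i (X \<omega>))) J x
      = measure M {\<omega> \<in> space M. \<forall>j\<in>J. ereal (x j) < marginal d i (X \<omega>) j}"
    by (rule survival_distr[OF measurable_compose[OF X marginal_measurable] _ J])
  also have "{\<omega> \<in> space M. \<forall>j\<in>J. ereal (x j) < marginal d i (X \<omega>) j} = {\<omega> \<in> space M. \<forall>j\<in>J. ereal (x j) < X \<omega> (i j)}"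
    using J by (auto simp: marginal_def)
  finally show ?thesis .
qed

lemma measure_reindexed_distr:
  fixes X :: "'a \<Rightarrow> nat \<Rightarrow> ereal"
  assumes X: "X \<in> M \<rightarrow>\<^sub>M borel_fun UNIV" and J: "finite J" "inj_on f J"
  shows "measure (distr M (borel_fun UNIV) X) {\<omega> \<in> space (distr M (borel_fun UNIV) X). \<forall>j\<in>J. ereal (x j) < \<omega> (f j)}
       = measure M {\<omega> \<in> space M. \<forall>j\<in>J. ereal (x j) < X \<omega> (f j)}"
proof -
  have img: "finite (f ` J)" using J by simp
  show ?thesis
    using survival_distr[OF X img subset_UNIV, of "x \<circ> inv_into J f"] J(2)
    unfolding upper_box_image[OF J(2)] survival_def by auto
qed

text \<open>J and its image have complements of equal size in the segment; any bijection between
  these completes f.\<close>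

lemma extend_to_permutation:
  fixes f :: "nat \<Rightarrow> nat"
  assumes "J \<subseteq> {..<d}" "f ` J \<subseteq> {..<d}" "inj_on f J"
  obtains \<pi> where "\<pi> permutes {..<d}" "\<And>j. j \<in> J \<Longrightarrow> \<pi> j = f j"
proof -
  have J: "finite J" using assms(1) finite_subset by blast
  have "card ({..<d} - J) = card ({..<d} - f ` J)"
    using J assms card_image[OF assms(3)] by (simp add: card_Diff_subset)
  then obtain g where g: "bij_betw g ({..<d} - J) ({..<d} - f ` J)"
    using finite_same_card_bij[of "{..<d} - J" "{..<d} - f ` J"] by auto
  define \<pi> where "\<pi> k = (if k \<in> J then f k else if k < d then g k else k)" for k
  have "bij_betw \<pi> (J \<union> ({..<d} - J)) (f ` J \<union> ({..<d} - f ` J))"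
  proof (rule bij_betw_combine)
    have "bij_betw f J (f ` J)" using assms(3) by (rule inj_on_imp_bij_betw)
    then show "bij_betw \<pi> J (f ` J)" by (rule bij_betw_cong[THEN iffD1, rotated]) (simp add: \<pi>_def)
    show "bij_betw \<pi> ({..<d} - J) ({..<d} - f ` J)"
      using g by (rule bij_betw_cong[THEN iffD1, rotated]) (simp add: \<pi>_def)
  qed auto
  moreover have "J \<union> ({..<d} - J) = {..<d}" "f ` J \<union> ({..<d} - f ` J) = {..<d}" using assms by auto
  ultimately have "\<pi> permutes {..<d}"
    using assms(1) by (intro bij_imp_permutes) (auto simp: \<pi>_def)
  then show thesis by (rule that) (simp add: \<pi>_def)
qed

text \<open>An injection on J extends to a permutation once J and its image lie in a common initial
  segment. Conversely, under a symmetric law every marginal at d distinct indices has the survival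
  function of the first d coordinates, so permuting the indices changes nothing.\<close>

lemma exchangeable_iff_symmetric_law:
  fixes X :: "'a \<Rightarrow> nat \<Rightarrow> ereal"
  assumes M: "prob_space M" and X: "X \<in> M \<rightarrow>\<^sub>M borel_fun UNIV"
  shows "exchangeable M X \<longleftrightarrow> symmetric_law (distr M (borel_fun UNIV) X)"
proof
  assume ex: "exchangeable M X"
  show "symmetric_law (distr M (borel_fun UNIV) X)"
    unfolding symmetric_law_def
  proof (intro allI impI)
    fix J and f :: "nat \<Rightarrow> nat" and x assume J: "finite J" "inj_on f J"
    obtain d where d: "J \<union> f ` J \<subseteq> {..<d}"
      using finite_nat_iff_bounded[of "J \<union> f ` J"] J by auto
    obtain \<pi> where \<pi>: "\<pi> permutes {..<d}" "\<And>j. j \<in> J \<Longrightarrow> \<pi> j = f j"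
      using extend_to_permutation[of J d f] d J by auto
    have "eq_in_distribution (borel_fun {..<d}) M (\<lambda>\<omega>. marginal d (id \<circ> \<pi>) (X \<omega>)) M (\<lambda>\<omega>. marginal d id (X \<omega>))"
      by (rule ex[unfolded exchangeable_def, rule_format, OF inj_on_id \<pi>(1)])
    then have "distr M (borel_fun {..<d}) (\<lambda>\<omega>. marginal d (id \<circ> \<pi>) (X \<omega>)) = distr M (borel_fun {..<d}) (\<lambda>\<omega>. marginal d id (X \<omega>))"
      by (simp add: eq_in_distribution_def)
    then have "measure M {\<omega> \<in> space M. \<forall>j\<in>J. ereal (x j) < X \<omega> ((id \<circ> \<pi>) j)} = measure M {\<omega> \<in> space M. \<forall>j\<in>J. ereal (x j) < X \<omega> (id j)}"
      using d by (subst (1 2) survival_marginal[OF X, symmetric, where d = d]) auto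
    then show "measure (distr M (borel_fun UNIV) X) {\<omega> \<in> space (distr M (borel_fun UNIV) X). \<forall>j\<in>J. ereal (x j) < \<omega> (f j)}
        = survival (distr M (borel_fun UNIV) X) J x"
      unfolding measure_reindexed_distr[OF X J] survival_distr[OF X J(1) subset_UNIV]
      by (simp add: \<pi>(2) cong: ball_cong)
  qed
next
  assume sym: "symmetric_law (distr M (borel_fun UNIV) X)"
  show "exchangeable M X"
    unfolding exchangeable_def
  proof (intro allI impI)
    fix d :: nat and i \<pi> :: "nat \<Rightarrow> nat" assume i: "inj_on i {..<d}" and \<pi>: "\<pi> permutes {..<d}"
    have m: "(\<lambda>\<omega>. marginal d i (X \<omega>)) \<in> M \<rightarrow>\<^sub>M borel_fun {..<d}" for i
      by (rule measurable_compose[OF X marginal_measurable])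
    have inj: "inj_on (i \<circ> \<pi>) {..<d}"
      using i \<pi> by (intro comp_inj_on) (auto simp: permutes_image permutes_inj_on)
    have key: "survival (distr M (borel_fun {..<d}) (\<lambda>\<omega>. marginal d i (X \<omega>))) J x = survival (distr M (borel_fun UNIV) X) J x"
      if J: "J \<subseteq> {..<d}" and i: "inj_on i {..<d}" for J x and i :: "nat \<Rightarrow> nat"
    proof -
      have J': "finite J" "inj_on i J" using J i finite_subset inj_on_subset by blast+
      show ?thesis
        unfolding survival_marginal[OF X J] measure_reindexed_distr[OF X J', symmetric]
        using sym J' unfolding symmetric_law_def by blast
    qed
    have "distr M (borel_fun {..<d}) (\<lambda>\<omega>. marginal d (i \<circ> \<pi>) (X \<omega>)) = distr M (borel_fun {..<d}) (\<lambda>\<omega>. marginal d i (X \<omega>))"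
      by (rule measure_eqI_survival)
        (auto intro!: prob_space.prob_space_distr[OF M m] simp: key[OF _ inj] key[OF _ i] simp del: o_apply)
    then show "eq_in_distribution (borel_fun {..<d}) M (\<lambda>\<omega>. marginal d (i \<circ> \<pi>) (X \<omega>)) M (\<lambda>\<omega>. marginal d i (X \<omega>))"
      using m unfolding eq_in_distribution_def by blast
  qed
qed

text \<open>In each dimension only the law of one of the n i.i.d. vectors is used. Its survival
  function is forced to be the n-th root of that of X, a formula free of d, and this lets the
  extension theorem glue the dimensions.\<close>

lemma min_id_sequence_imp_root:
  fixes X :: "'a \<Rightarrow> nat \<Rightarrow> ereal"
  assumes X: "X \<in> M \<rightarrow>\<^sub>M borel_fun UNIV" and min: "min_id_sequence M X" and n: "1 \<le> n"
  obtains Q where "prob_space Q" "sets Q = sets (borel_fun UNIV)"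
    "\<And>J x. finite J \<Longrightarrow> survival Q J x ^ n = survival (distr M (borel_fun UNIV) X) J x"
proof -
  let ?P = "distr M (borel_fun UNIV) X"
  have "\<exists>V. prob_space V \<and> sets V = sets (borel_fun {..<d}) \<and>
      (\<forall>J\<subseteq>{..<d}. \<forall>x. survival V J x = root n (survival ?P J x))" for d
  proof -
    have "min_id_vector d M (\<lambda>\<omega>. marginal d id (X \<omega>))" using min unfolding min_id_sequence_def by blast
    then obtain N :: "(nat \<Rightarrow> nat \<Rightarrow> ereal) measure" and Y :: "nat \<Rightarrow> (nat \<Rightarrow> nat \<Rightarrow> ereal) \<Rightarrow> nat \<Rightarrow> ereal"
      where iid: "iid N (borel_fun {..<d}) Y {..<n}"
        and eq: "eq_in_distribution (borel_fun {..<d}) M (\<lambda>\<omega>. marginal d id (X \<omega>))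
          N (\<lambda>\<omega>. \<lambda>k\<in>{..<d}. MIN i\<in>{..<n}. Y i \<omega> k)"
      using n unfolding min_id_vector_def by blast
    note Y = iidD[OF iid]
    let ?V = "distr N (borel_fun {..<d}) (Y 0)"
    have "survival ?V J x = root n (survival ?P J x)" if J: "J \<subseteq> {..<d}" for J x
    proof (rule power_eq_imp_eq_root[OF survival_nonneg _ n])
      have fin: "finite J" using J finite_subset by blast
      have mN: "(\<lambda>\<omega>. \<lambda>k\<in>{..<d}. MIN i\<in>{..<n}. Y i \<omega> k) \<in> N \<rightarrow>\<^sub>M borel_fun {..<d}"
        using eq unfolding eq_in_distribution_def by blast
      have "survival ?V J x ^ n = measure N {\<omega> \<in> space N. \<forall>j\<in>J. ereal (x j) < (MIN i\<in>{..<n}. Y i \<omega> j)}"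
        by (rule iid_survival_Min[OF iid n fin J, symmetric])
      also have "{\<omega> \<in> space N. \<forall>j\<in>J. ereal (x j) < (MIN i\<in>{..<n}. Y i \<omega> j)}
          = {\<omega> \<in> space N. \<forall>j\<in>J. ereal (x j) < (\<lambda>k\<in>{..<d}. MIN i\<in>{..<n}. Y i \<omega> k) j}"
        using J by (intro Collect_cong conj_cong ball_cong refl) auto
      also have "measure N \<dots> = survival (distr N (borel_fun {..<d}) (\<lambda>\<omega>. \<lambda>k\<in>{..<d}. MIN i\<in>{..<n}. Y i \<omega> k)) J x"
        by (rule survival_distr[OF mN fin J, symmetric])
      also have "\<dots> = survival (distr M (borel_fun {..<d}) (\<lambda>\<omega>. marginal d id (X \<omega>))) J x"
        using eq unfolding eq_in_distribution_def by (simp only:)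
      also have "\<dots> = survival ?P J x"
        unfolding survival_marginal[OF X J] survival_distr[OF X fin subset_UNIV] by simp
      finally show "survival ?V J x ^ n = survival ?P J x" .
    qed
    moreover have "prob_space ?V" using n by (intro prob_space.prob_space_distr Y(1) Y(3)) simp
    ultimately show ?thesis by (intro exI[of _ ?V]) auto
  qed
  from kolmogorov_survival[of "\<lambda>J x. root n (survival ?P J x)", OF this]
  obtain Q where "prob_space Q" "sets Q = sets (borel_fun UNIV)"
    "\<And>J x. finite J \<Longrightarrow> survival Q J x = root n (survival ?P J x)" by blast
  then show thesis using n that by (simp add: survival_nonneg)
qed

text \<open>Independent copies of the whole root sequence are minimised first and marginals taken
  afterwards. Index tuples with repetitions are thereby treated like all others.\<close>

lemma min_id_sequenceI:
  fixes X :: "'a \<Rightarrow> nat \<Rightarrow> ereal"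
  assumes M: "prob_space M" and X: "X \<in> M \<rightarrow>\<^sub>M borel_fun UNIV"
    and root: "\<And>n. 1 \<le> n \<Longrightarrow> \<exists>Q. prob_space Q \<and> sets Q = sets (borel_fun UNIV) \<and>
      (\<forall>J x. finite J \<longrightarrow> survival Q J x ^ n = survival (distr M (borel_fun UNIV) X) J x)"
  shows "min_id_sequence M X"
  unfolding min_id_sequence_def min_id_vector_def
proof (intro allI impI)
  fix d and i :: "nat \<Rightarrow> nat" and n :: nat assume n: "1 \<le> n"
  from root[OF n] obtain Q where Q: "prob_space Q" "sets Q = sets (borel_fun UNIV)"
    and surv: "\<And>J x. finite J \<Longrightarrow> survival Q J x ^ n = survival (distr M (borel_fun UNIV) X) J x" by blast
  define N :: "(nat \<Rightarrow> nat \<Rightarrow> ereal) measure" where "N = (\<Pi>\<^sub>M l\<in>{..<n}. Q)"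
  have idQ: "(\<lambda>\<omega>. \<omega>) \<in> Q \<rightarrow>\<^sub>M borel_fun UNIV"
    unfolding measurable_cong_sets[OF Q(2) refl] by simp
  have iid: "iid N (borel_fun UNIV) (\<lambda>l \<omega>. \<omega> l) {..<n}"
    unfolding N_def by (rule iid_PiM[OF Q(1) idQ n])
  have iid_m: "iid N (borel_fun {..<d}) (\<lambda>l \<omega>. marginal d i (\<omega> l)) {..<n}"
    unfolding N_def
    by (rule iid_PiM[OF Q(1) _ n]) (unfold measurable_cong_sets[OF Q(2) refl], rule marginal_measurable)
  define Z where "Z \<omega> j = (MIN l\<in>{..<n}. \<omega> l j)" for \<omega> :: "nat \<Rightarrow> nat \<Rightarrow> ereal" and j :: nat
  have Z: "Z \<in> N \<rightarrow>\<^sub>M borel_fun UNIV"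
  proof (rule measurable_PiM_single')
    fix j
    show "(\<lambda>\<omega>. Z \<omega> j) \<in> borel_measurable N"
      unfolding Z_def
      by (intro borel_measurable_Min borel_fun_component[OF iidD(3)[OF iid]]) auto
  qed (auto simp: space_PiM)
  have "distr N (borel_fun UNIV) Z = distr M (borel_fun UNIV) X"
  proof (rule measure_eqI_survival)
    show "prob_space (distr N (borel_fun UNIV) Z)" by (rule prob_space.prob_space_distr[OF iidD(1)[OF iid] Z])
    show "prob_space (distr M (borel_fun UNIV) X)" by (rule prob_space.prob_space_distr[OF M X])
    fix J x assume J: "finite J" "J \<subseteq> (UNIV :: nat set)"
    have "distr N (borel_fun UNIV) (\<lambda>\<omega>. \<omega> 0) = distr N Q (\<lambda>\<omega>. \<omega> 0)"
      by (rule distr_cong) (auto simp: Q(2))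
    also have "\<dots> = Q" unfolding N_def by (rule distr_PiM_component) (use Q n in auto)
    finally show "survival (distr N (borel_fun UNIV) Z) J x = survival (distr M (borel_fun UNIV) X) J x"
      using iid_survival_Min[OF iid n J, of x] surv[OF J(1), of x]
      by (subst survival_distr[OF Z J]) (simp add: Z_def)
  qed simp_all
  then have "distr (distr M (borel_fun UNIV) X) (borel_fun {..<d}) (marginal d i)
      = distr (distr N (borel_fun UNIV) Z) (borel_fun {..<d}) (marginal d i)" by simp
  then have "distr M (borel_fun {..<d}) (\<lambda>\<omega>. marginal d i (X \<omega>)) = distr N (borel_fun {..<d}) (\<lambda>\<omega>. marginal d i (Z \<omega>))"
    unfolding distr_distr[OF marginal_measurable X] distr_distr[OF marginal_measurable Z] by (simp add: o_def)
  moreover have "marginal d i (Z \<omega>) = (\<lambda>k\<in>{..<d}. MIN l\<in>{..<n}. marginal d i (\<omega> l) k)" for \<omega>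
    by (auto simp: marginal_def Z_def)
  moreover have "(\<lambda>\<omega>. marginal d i (X \<omega>)) \<in> M \<rightarrow>\<^sub>M borel_fun {..<d}" "(\<lambda>\<omega>. marginal d i (Z \<omega>)) \<in> N \<rightarrow>\<^sub>M borel_fun {..<d}"
    by (rule measurable_compose[OF X marginal_measurable], rule measurable_compose[OF Z marginal_measurable])
  ultimately show "\<exists>(N :: (nat \<Rightarrow> nat \<Rightarrow> ereal) measure) Y. iid N (borel_fun {..<d}) Y {..<n} \<and>
      eq_in_distribution (borel_fun {..<d}) M (\<lambda>\<omega>. marginal d i (X \<omega>)) N (\<lambda>\<omega>. \<lambda>k\<in>{..<d}. MIN i\<in>{..<n}. Y i \<omega> k)"
    using iid_m by (intro exI[of _ N] exI[of _ "\<lambda>l \<omega>. marginal d i (\<omega> l)"]) (simp add: eq_in_distribution_def)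
qed

section \<open>From the chronometer to the sequence\<close>

lemma extended_chronometer_paths:
  assumes "extended_chronometer N H" "\<omega> \<in> space N"
  shows "H \<omega> \<in> chron_paths"
proof -
  have "H \<in> N \<rightarrow>\<^sub>M D_inf_space" using assms(1) unfolding extended_chronometer_def by blast
  from measurable_space[OF this assms(2)] have "H \<omega> \<in> space D_inf_space" .
  then have "H \<omega> \<in> D_inf" by (simp add: D_inf_space_def space_restrict_space)
  then show ?thesis
    using assms unfolding extended_chronometer_def chron_paths_def D_inf_def by blast
qed

lemma representation_survival:
  assumes X: "X \<in> M \<rightarrow>\<^sub>M borel_fun UNIV" and rep: "chronometer_representation M X N H E" and J: "finite J"
  shows "survival (distr M (borel_fun UNIV) X) J x = (\<integral>\<omega>. (\<Prod>j\<in>J. expm (H \<omega> (x j))) \<partial>N)"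
proof -
  have chron: "extended_chronometer N H" and N: "prob_space N" and E: "unit_exponentials N E"
    and ind: "independent N D_inf_space H (\<Pi>\<^sub>M i\<in>UNIV. borel) E"
    and eq: "eq_in_distribution (borel_fun UNIV) M X N (\<lambda>\<omega>. first_passage (H \<omega>) (E \<omega>))"
    using rep unfolding chronometer_representation_def by blast+
  have fp: "(\<lambda>\<omega>. first_passage (H \<omega>) (E \<omega>)) \<in> N \<rightarrow>\<^sub>M borel_fun UNIV"
    using eq unfolding eq_in_distribution_def by blast
  have "survival (distr M (borel_fun UNIV) X) J x
      = survival (distr N (borel_fun UNIV) (\<lambda>\<omega>. first_passage (H \<omega>) (E \<omega>))) J x"
    using eq unfolding eq_in_distribution_def by (simp only:)
  also have "\<dots> = measure N {\<omega> \<in> space N. \<forall>j\<in>J. ereal (x j) < first_passage (H \<omega>) (E \<omega>) j}"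
    by (rule survival_distr[OF fp J]) simp
  also have "\<dots> = (\<integral>\<omega>. (\<Prod>j\<in>J. expm (H \<omega> (x j))) \<partial>N)"
    by (rule first_passage_survival[OF N extended_chronometer_paths[OF chron] E ind J])
  finally show ?thesis .
qed

text \<open>Distinct coordinates of X may carry equal thresholds, so its survival function contains
  the transforms with repeated times on which the moment argument relies.\<close>

lemma chronometer_law_unique:
  assumes X: "X \<in> M \<rightarrow>\<^sub>M borel_fun UNIV"
    and rep: "chronometer_representation M X N H E" and rep': "chronometer_representation M X N' H' E'"
  shows "distr N D_inf_space H = distr N' D_inf_space H'"
proof -
  have N: "prob_space N" "extended_chronometer N H" and N': "prob_space N'" "extended_chronometer N' H'"
    using rep rep' unfolding chronometer_representation_def by blast+
  have H: "H \<in> N \<rightarrow>\<^sub>M D_inf_space" and H': "H' \<in> N' \<rightarrow>\<^sub>M D_inf_space"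
    using N(2) N'(2) unfolding extended_chronometer_def by blast+
  note B = D_inf_space_imp_borel_fun[OF H] and B' = D_inf_space_imp_borel_fun[OF H']
  have law: "distr N (borel_fun UNIV) H = distr N' (borel_fun UNIV) H'"
  proof (rule process_law_eqI[OF N(1) B _ N'(1) B'])
    show "0 \<le> H \<omega> t" if "\<omega> \<in> space N" for \<omega> t
      by (rule chron_paths_nonneg[OF extended_chronometer_paths[OF N(2) that]])
    show "0 \<le> H' \<omega> t" if "\<omega> \<in> space N'" for \<omega> t
      by (rule chron_paths_nonneg[OF extended_chronometer_paths[OF N'(2) that]])
    fix d :: nat and t
    show "(\<integral>\<omega>. (\<Prod>k<d. expm (H \<omega> (t k))) \<partial>N) = (\<integral>\<omega>. (\<Prod>k<d. expm (H' \<omega> (t k))) \<partial>N')"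
      using representation_survival[OF X rep, of "{..<d}" t] representation_survival[OF X rep', of "{..<d}" t] by simp
  qed
  \<comment> \<open>Sets of \<open>D_inf_space\<close> are traces on \<open>D_inf\<close> of
    product-measurable sets. Since all paths of G lie in \<open>D_inf\<close>, a set and its trace
    have the same preimage.\<close>
  have pull: "emeasure (distr K D_inf_space G) (D_inf \<inter> A) = emeasure (distr K (borel_fun UNIV) G) A"
    if G: "G \<in> K \<rightarrow>\<^sub>M D_inf_space" and A: "A \<in> sets (borel_fun UNIV)" for K :: "'k measure" and G A
  proof -
    have "D_inf \<inter> A \<in> sets D_inf_space"
      using A unfolding D_inf_space_def sets_restrict_space by blast
    moreover have "G -` (D_inf \<inter> A) \<inter> space K = G -` A \<inter> space K"
      using measurable_space[OF G] by (auto simp: D_inf_space_def space_restrict_space)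
    ultimately show ?thesis
      using G A D_inf_space_imp_borel_fun[OF G] by (simp add: emeasure_distr)
  qed
  show ?thesis
  proof (rule measure_eqI)
    fix A assume "A \<in> sets (distr N D_inf_space H)"
    then have "A \<in> sets D_inf_space" by simp
    then obtain A' where A': "A' \<in> sets (borel_fun UNIV)" "A = D_inf \<inter> A'"
      unfolding D_inf_space_def sets_restrict_space by blast
    show "emeasure (distr N D_inf_space H) A = emeasure (distr N' D_inf_space H') A"
      unfolding A'(2) pull[OF H A'(1)] pull[OF H' A'(1)] law ..
  qed simp
qed

text \<open>
  If one summand were negative, or decreased from \<open>s\<close> to \<open>t\<close>, with positive probability, then by
  independence so would all of them at once, and hence their sum.
\<close>

lemma id_process_increments:
  fixes n :: nat
  assumes H: "H \<in> M \<rightarrow>\<^sub>M borel_fun UNIV" and nn: "\<And>\<omega> t. \<omega> \<in> space M \<Longrightarrow> 0 \<le> H \<omega> t"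
    and mono: "\<And>\<omega> s t. \<omega> \<in> space M \<Longrightarrow> s \<le> t \<Longrightarrow> H \<omega> s \<le> H \<omega> t"
    and iid: "iid N (borel_fun UNIV) Y {..<n}" and n: "1 \<le> n"
    and eq: "eq_fin_dim_distributions M H N (\<lambda>\<omega> t. \<Sum>i<n. Y i \<omega> t)"
    and i: "i < n"
  shows "AE \<omega> in N. 0 \<le> Y i \<omega> t" "s \<le> t \<Longrightarrow> AE \<omega> in N. Y i \<omega> s \<le> Y i \<omega> (t :: real)"
proof -
  let ?Z = "\<lambda>\<omega> t. \<Sum>i<n. Y i \<omega> t"
  \<comment> \<open>A property of finitely many coordinates that H has at every outcome passes to
    the sum, almost surely, through equality of finite-dimensional laws.\<close>
  have transfer: "AE \<omega> in N. P (restrict (?Z \<omega>) J)"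
    if J: "finite J" and S: "{h \<in> space (borel_fun J). P h} \<in> sets (borel_fun J)" and all: "\<And>\<omega>. \<omega> \<in> space M \<Longrightarrow> P (restrict (H \<omega>) J)"
    for J P
  proof -
    have e: "(\<lambda>\<omega>. restrict (H \<omega>) J) \<in> M \<rightarrow>\<^sub>M borel_fun J" "(\<lambda>\<omega>. restrict (?Z \<omega>) J) \<in> N \<rightarrow>\<^sub>M borel_fun J"
      "distr M (borel_fun J) (\<lambda>\<omega>. restrict (H \<omega>) J) = distr N (borel_fun J) (\<lambda>\<omega>. restrict (?Z \<omega>) J)"
      using eq J unfolding eq_fin_dim_distributions_def eq_in_distribution_def by blast+
    have "AE h in distr M (borel_fun J) (\<lambda>\<omega>. restrict (H \<omega>) J). P h"
      unfolding AE_distr_iff[OF e(1) S] by (rule AE_I2) (rule all)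
    then show ?thesis unfolding e(3) AE_distr_iff[OF e(2) S] .
  qed
  have comp: "(\<lambda>h. h t) \<in> borel_measurable (borel_fun J)" if "t \<in> J" for t and J :: "real set"
    by (rule measurable_component_singleton[OF that])
  show "AE \<omega> in N. 0 \<le> Y i \<omega> t"
  proof -
    let ?B = "{h \<in> space (borel_fun UNIV). h t < (0::ereal)}"
    note [measurable] = comp[of t UNIV, simplified]
    have B: "?B \<in> sets (borel_fun UNIV)" by measurable
    have "AE \<omega> in N. 0 \<le> restrict (?Z \<omega>) {t} t"
    proof (rule transfer)
      show "{h \<in> space (borel_fun {t}). 0 \<le> h t} \<in> sets (borel_fun {t})"
        by (rule borel_measurable_le[OF borel_measurable_const comp]) simp
    qed (use nn in auto)
    then have "AE \<omega> in N. \<not> (\<forall>i<n. Y i \<omega> \<in> ?B)"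
    proof eventually_elim
      case (elim \<omega>)
      have False if "\<forall>i<n. Y i \<omega> \<in> ?B"
        using ereal_sum_strict_mono[OF n, of "\<lambda>i. Y i \<omega> t" "\<lambda>_. 0"] that elim by simp
      then show ?case by blast
    qed
    from iid_AE_not_all[OF iid n B this i] AE_space[of N]
    show ?thesis
      by eventually_elim (use measurable_space[OF iidD(3)[OF iid i]] in \<open>auto simp: not_less\<close>)
  qed
  show "AE \<omega> in N. Y i \<omega> s \<le> Y i \<omega> t" if st: "s \<le> t"
  proof -
    let ?B = "{h \<in> space (borel_fun UNIV). h t < (h s :: ereal)}"
    note [measurable] = comp[of t UNIV, simplified] comp[of s UNIV, simplified]
    have B: "?B \<in> sets (borel_fun UNIV)" by measurable
    have "AE \<omega> in N. restrict (?Z \<omega>) {s, t} s \<le> restrict (?Z \<omega>) {s, t} t"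
    proof (rule transfer)
      show "{h \<in> space (borel_fun {s, t}). h s \<le> h t} \<in> sets (borel_fun {s, t})"
        by (rule borel_measurable_le[OF comp comp]) auto
    qed (use mono st in auto)
    then have "AE \<omega> in N. \<not> (\<forall>i<n. Y i \<omega> \<in> ?B)"
    proof eventually_elim
      case (elim \<omega>)
      have False if "\<forall>i<n. Y i \<omega> \<in> ?B"
        using ereal_sum_strict_mono[OF n, of "\<lambda>i. Y i \<omega> t" "\<lambda>i. Y i \<omega> s"] that elim by simp
      then show ?case by blast
    qed
    from iid_AE_not_all[OF iid n B this i] AE_space[of N]
    show ?thesis
      by eventually_elim (use measurable_space[OF iidD(3)[OF iid i]] in \<open>auto simp: not_less\<close>)
  qed
qed

text \<open>One summand of an n-fold decomposition of H is regularised, and its first passage times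
  are taken. Their survival function is the n-th root of that of X.\<close>

lemma representation_imp_min_id:
  fixes X :: "'a \<Rightarrow> nat \<Rightarrow> ereal"
  assumes M: "prob_space M" and X: "X \<in> M \<rightarrow>\<^sub>M borel_fun UNIV" and rep: "chronometer_representation M X N H E"
  shows "min_id_sequence M X"
proof (rule min_id_sequenceI[OF M X])
  fix n :: nat assume n: "1 \<le> n"
  let ?P = "distr M (borel_fun UNIV) X"
  have N: "prob_space N" "extended_chronometer N H" and idp: "id_process N H"
    using rep unfolding chronometer_representation_def extended_chronometer_def by blast+
  have H: "H \<in> N \<rightarrow>\<^sub>M borel_fun UNIV" using idp unfolding id_process_def by blast
  note paths = extended_chronometer_paths[OF N(2)]
  obtain K :: "(nat \<Rightarrow> real \<Rightarrow> ereal) measure" and Y :: "nat \<Rightarrow> (nat \<Rightarrow> real \<Rightarrow> ereal) \<Rightarrow> real \<Rightarrow> ereal"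
    where iid: "iid K (borel_fun UNIV) Y {..<n}" and eq: "eq_fin_dim_distributions N H K (\<lambda>\<omega> t. \<Sum>i<n. Y i \<omega> t)"
    using idp n unfolding id_process_def by blast
  have K: "prob_space K" by (rule iidD[OF iid])
  have nn: "AE \<omega> in K. 0 \<le> Y i \<omega> t" if "i < n" for i t
    by (rule id_process_increments(1)[OF H _ _ iid n eq that])
      (auto intro: chron_paths_nonneg chron_paths_mono paths)
  have mono: "AE \<omega> in K. Y i \<omega> s \<le> Y i \<omega> t" if "i < n" "s \<le> t" for i s t
    by (rule id_process_increments(2)[OF H _ _ iid n eq that])
      (auto intro: chron_paths_nonneg chron_paths_mono paths)
  have Y0: "(\<lambda>\<omega>. Y 0 \<omega> t) \<in> borel_measurable K" for t
    by (rule borel_fun_component[OF iidD(3)[OF iid]]) (use n in simp)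
  have lap: "(\<integral>\<omega>. (\<Prod>j\<in>J. expm (Y 0 \<omega> (x j))) \<partial>K) = root n (survival ?P J x)"
    if J: "finite J" for J :: "nat set" and x
  proof (rule power_eq_imp_eq_root[OF _ _ n])
    show "0 \<le> (\<integral>\<omega>. (\<Prod>j\<in>J. expm (Y 0 \<omega> (x j))) \<partial>K)" by (intro integral_nonneg_AE AE_I2 prod_nonneg) simp
    \<comment> \<open>The times x j may coincide, so the finite-dimensional laws are compared over
      the set of times.\<close>
    let ?R = "x ` J"
    define G where "G h = (\<Prod>j\<in>J. expm (h (x j)))" for h :: "real \<Rightarrow> ereal"
    have G: "G \<in> borel_measurable (borel_fun ?R)"
      unfolding G_def
      by (intro borel_measurable_prod measurable_compose[OF _ expm_measurable] measurable_component_singleton) simp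
    have e: "(\<lambda>\<omega>. restrict (H \<omega>) ?R) \<in> N \<rightarrow>\<^sub>M borel_fun ?R" "(\<lambda>\<omega>. restrict (\<lambda>t. \<Sum>i<n. Y i \<omega> t) ?R) \<in> K \<rightarrow>\<^sub>M borel_fun ?R"
      "distr N (borel_fun ?R) (\<lambda>\<omega>. restrict (H \<omega>) ?R) = distr K (borel_fun ?R) (\<lambda>\<omega>. restrict (\<lambda>t. \<Sum>i<n. Y i \<omega> t) ?R)"
      using eq J unfolding eq_fin_dim_distributions_def eq_in_distribution_def by blast+
    have "(\<integral>\<omega>. (\<Prod>j\<in>J. expm (Y 0 \<omega> (x j))) \<partial>K) ^ n = (\<integral>\<omega>. (\<Prod>j\<in>J. expm (\<Sum>i<n. Y i \<omega> (x j))) \<partial>K)"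
      by (rule iid_laplace_sum[OF iid n J nn, symmetric])
    also have "\<dots> = (\<integral>\<omega>. G (restrict (\<lambda>t. \<Sum>i<n. Y i \<omega> t) ?R) \<partial>K)"
      unfolding G_def by (intro Bochner_Integration.integral_cong prod.cong refl) simp
    also have "\<dots> = integral\<^sup>L (distr K (borel_fun ?R) (\<lambda>\<omega>. restrict (\<lambda>t. \<Sum>i<n. Y i \<omega> t) ?R)) G"
      by (rule integral_distr[symmetric, OF e(2) G])
    also have "\<dots> = (\<integral>\<omega>. G (restrict (H \<omega>) ?R) \<partial>N)"
      unfolding e(3)[symmetric] by (rule integral_distr[OF e(1) G])
    also have "\<dots> = (\<integral>\<omega>. (\<Prod>j\<in>J. expm (H \<omega> (x j))) \<partial>N)"
      unfolding G_def by (intro Bochner_Integration.integral_cong prod.cong refl) simp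
    also have "\<dots> = survival ?P J x" by (rule representation_survival[OF X rep J, symmetric])
    finally show "(\<integral>\<omega>. (\<Prod>j\<in>J. expm (Y 0 \<omega> (x j))) \<partial>K) ^ n = survival ?P J x" .
  qed
  let ?G = "right_regularisation (Y 0)"
  have G: "?G \<in> K \<rightarrow>\<^sub>M chron_space"
    by (rule measurable_into_chron_space[OF right_regularisation_measurable[OF Y0] right_regularisation_paths])
  define D where "D = distr K chron_space ?G"
  have D: "prob_space D" "sets D = sets chron_space"
    unfolding D_def by (rule prob_space.prob_space_distr[OF K G]) simp
  have surv: "survival (passage_law D) J x = root n (survival ?P J x)" if J: "finite J" for J x
  proof -
    have "survival (passage_law D) J x = (\<integral>h. (\<Prod>j\<in>J. expm (h (x j))) \<partial>D)"
      by (rule passage_law(3)[OF D J])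
    also have "\<dots> = (\<integral>\<omega>. (\<Prod>j\<in>J. expm (?G \<omega> (x j))) \<partial>K)"
      unfolding D_def by (rule integral_distr[OF G prod_expm_measurable])
    also have "\<dots> = root n (survival ?P J x)"
    proof (rule regularised_laplace[OF K Y0])
      show "AE \<omega> in K. 0 \<le> Y 0 \<omega> t" for t by (rule nn) (use n in simp)
      show "AE \<omega> in K. Y 0 \<omega> s \<le> Y 0 \<omega> t" if "s \<le> t" for s t by (rule mono) (use n that in simp_all)
      show "(\<integral>\<omega>. (\<Prod>j\<in>J. expm (Y 0 \<omega> (x j))) \<partial>K) = root n (survival ?P J x)" for x by (rule lap[OF J])
      show "(\<lambda>m. root n (survival ?P J (\<lambda>j. rat_above m (x j)))) \<longlonglongrightarrow> root n (survival ?P J x)" for x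
        by (intro tendsto_real_root survival_rat_above_LIMSEQ[where I = UNIV] J prob_space.prob_space_distr[OF M X]) auto
    qed
    finally show ?thesis .
  qed
  show "\<exists>Q. prob_space Q \<and> sets Q = sets (borel_fun UNIV) \<and>
      (\<forall>J x. finite J \<longrightarrow> survival Q J x ^ n = survival ?P J x)"
    using passage_law(1,2)[OF D] n
    by (intro exI[of _ "passage_law D"]) (simp add: surv survival_nonneg)
qed

section \<open>Behaviour at -\<infinity> and positivity of the survival function\<close>

lemma chron_paths_INF_LIMSEQ:
  assumes "h \<in> chron_paths"
  shows "(\<lambda>m. h (- real m)) \<longlonglongrightarrow> (INF m. h (- real m))"
  by (rule LIMSEQ_INF) (auto intro!: decseq_SucI chron_paths_mono[OF assms])

text \<open>By monotonicity the limit at -\<infinity> is an infimum along negative integers, so the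
  condition involves only countably many times.\<close>

lemma chron_paths_at_bot_iff:
  assumes h: "h \<in> chron_paths"
  shows "(h \<longlongrightarrow> 0) at_bot \<longleftrightarrow> (INF m. h (- real m)) = 0"
proof
  assume "(h \<longlongrightarrow> 0) at_bot"
  moreover have "filterlim (\<lambda>m. - real m) at_bot sequentially"
    by (rule filterlim_uminus_at_bot[THEN iffD2]) (simp add: filterlim_real_sequentially)
  ultimately have "(\<lambda>m. h (- real m)) \<longlonglongrightarrow> 0" by (rule filterlim_compose)
  then show "(INF m. h (- real m)) = 0" using chron_paths_INF_LIMSEQ[OF h] by (rule LIMSEQ_unique[rotated])
next
  assume inf: "(INF m. h (- real m)) = 0"
  show "(h \<longlongrightarrow> 0) at_bot"
  proof (rule order_tendstoI)
    fix a :: ereal assume "a < 0"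
    then show "eventually (\<lambda>t. a < h t) at_bot"
      using chron_paths_nonneg[OF h] by (auto intro!: always_eventually less_le_trans[of a 0])
  next
    fix a :: ereal assume "0 < a"
    then obtain m where m: "h (- real m) < a" using inf by (metis INF_less_iff UNIV_I)
    have "eventually (\<lambda>t. t \<le> - real m) at_bot" by (rule eventually_le_at_bot)
    then show "eventually (\<lambda>t. h t < a) at_bot"
      by eventually_elim (use chron_paths_mono[OF h] m in \<open>auto intro: le_less_trans\<close>)
  qed
qed

lemma laplace_at_bot_LIMSEQ:
  assumes N: "prob_space N" and H: "H \<in> N \<rightarrow>\<^sub>M borel_fun UNIV" and paths: "\<And>\<omega>. \<omega> \<in> space N \<Longrightarrow> H \<omega> \<in> chron_paths"
  shows "(\<lambda>m. \<integral>\<omega>. expm (H \<omega> (- real m)) \<partial>N) \<longlonglongrightarrow> (\<integral>\<omega>. expm (INF m. H \<omega> (- real m)) \<partial>N)"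
proof (rule integral_dominated_convergence[where w = "\<lambda>_. 1"])
  interpret prob_space N by fact
  note [measurable] = borel_fun_component[OF H]
  show "(\<lambda>\<omega>. expm (INF m. H \<omega> (- real m))) \<in> borel_measurable N" by measurable
  show "(\<lambda>\<omega>. expm (H \<omega> (- real m))) \<in> borel_measurable N" for m by measurable
  show "integrable N (\<lambda>_. 1 :: real)" by simp
  show "AE \<omega> in N. (\<lambda>m. expm (H \<omega> (- real m))) \<longlonglongrightarrow> expm (INF m. H \<omega> (- real m))"
  proof (rule AE_I2)
    fix \<omega> assume "\<omega> \<in> space N"
    note p = paths[OF this]
    show "(\<lambda>m. expm (H \<omega> (- real m))) \<longlonglongrightarrow> expm (INF m. H \<omega> (- real m))"
      by (intro tendsto_expm chron_paths_INF_LIMSEQ[OF p] INF_greatest always_eventually allI chron_paths_nonneg[OF p])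
  qed
  show "AE \<omega> in N. norm (expm (H \<omega> (- real m))) \<le> 1" for m
    by (rule AE_I2) (simp add: expm_le_1 chron_paths_nonneg[OF paths])
qed

lemma survival_at_bot_LIMSEQ:
  assumes P: "prob_space P" "sets P = sets (borel_fun UNIV)"
  shows "(\<lambda>m. survival P {i} (\<lambda>_. - real m)) \<longlonglongrightarrow> measure P {\<omega> \<in> space P. -\<infinity> < \<omega> i}"
proof -
  interpret prob_space P by fact
  define B where "B m = {\<omega> \<in> space P. \<forall>j\<in>{i}. ereal (- real m) < \<omega> j}" for m
  have "range B \<subseteq> sets P" unfolding B_def using upper_box_sets[OF _ _ P(2), of "{i}"] by auto
  moreover have "incseq B"
  proof (rule incseq_SucI)
    show "B m \<le> B (Suc m)" for m
    proof
      fix \<omega> assume "\<omega> \<in> B m"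
      then have "\<omega> \<in> space P" "ereal (- real m) < \<omega> i" by (auto simp: B_def)
      moreover have "ereal (- real (Suc m)) < \<omega> i"
        by (rule less_trans[of _ "ereal (- real m)"]) (use calculation in auto)
      ultimately show "\<omega> \<in> B (Suc m)" unfolding B_def by blast
    qed
  qed
  ultimately have "(\<lambda>m. measure P (B m)) \<longlonglongrightarrow> measure P (\<Union>m. B m)" by (rule finite_Lim_measure_incseq)
  moreover have "(\<Union>m. B m) = {\<omega> \<in> space P. -\<infinity> < \<omega> i}"
  proof (intro set_eqI iffI)
    fix \<omega> assume "\<omega> \<in> {\<omega> \<in> space P. -\<infinity> < \<omega> i}"
    then have \<omega>: "\<omega> \<in> space P" "- \<omega> i \<noteq> \<infinity>" by (auto simp: ereal_uminus_eq_reorder)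
    obtain m where "- \<omega> i < ereal (real m)" using less_PInf_Ex_of_nat \<omega>(2) by metis
    with \<omega> show "\<omega> \<in> (\<Union>m. B m)"
      by (cases "\<omega> i") (auto simp: B_def intro!: exI[of _ m])
  qed (auto simp: B_def)
  ultimately show ?thesis by (simp add: survival_def B_def)
qed

text \<open>As m grows, the survival function at -m tends to the mass of the sequences with \<omega>
  i > -\<infinity>, and the transform of H tends to the mean of exp of minus its infimum g. The
  limits agree, and a variable in [0, 1] has mean 1 exactly when it is 1 almost surely.\<close>

lemma AE_at_bot_iff:
  assumes N: "prob_space N" and H: "H \<in> N \<rightarrow>\<^sub>M borel_fun UNIV" and paths: "\<And>\<omega>. \<omega> \<in> space N \<Longrightarrow> H \<omega> \<in> chron_paths"
    and P: "prob_space P" "sets P = sets (borel_fun UNIV)"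
    and surv: "\<And>m :: nat. survival P {i} (\<lambda>_. - real m) = (\<integral>\<omega>. expm (H \<omega> (- real m)) \<partial>N)"
  shows "(AE \<omega> in N. (H \<omega> \<longlongrightarrow> 0) at_bot) \<longleftrightarrow> (AE \<omega> in P. -\<infinity> < \<omega> i)"
proof -
  interpret N: prob_space N by fact
  interpret P: prob_space P by fact
  note [measurable] = borel_fun_component[OF H]
  \<comment> \<open>The variable of the argument is \<open>g\<close> itself: \<open>expm\<close> of
    the limit of H at -\<infinity>, equal to 1 exactly where that limit is 0.\<close>
  define g where "g \<omega> = expm (INF m. H \<omega> (- real m))" for \<omega>
  have gm[measurable]: "g \<in> borel_measurable N" unfolding g_def by measurable
  have g1: "0 \<le> g \<omega>" "g \<omega> \<le> 1" if "\<omega> \<in> space N" for \<omega>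
    unfolding g_def by (simp, intro expm_le_1 INF_greatest chron_paths_nonneg[OF paths[OF that]])
  have gi: "integrable N g"
    by (rule N.integrable_const_bound[where B = 1]) (auto intro!: AE_I2 simp: g1)
  have "(\<lambda>m. \<integral>\<omega>. expm (H \<omega> (- real m)) \<partial>N) \<longlonglongrightarrow> (\<integral>\<omega>. g \<omega> \<partial>N)"
    unfolding g_def by (rule laplace_at_bot_LIMSEQ[OF N H paths])
  then have eq: "(\<integral>\<omega>. g \<omega> \<partial>N) = measure P {\<omega> \<in> space P. -\<infinity> < \<omega> i}"
    using survival_at_bot_LIMSEQ[OF P, of i] unfolding surv by (rule LIMSEQ_unique)
  have lim: "(H \<omega> \<longlongrightarrow> 0) at_bot \<longleftrightarrow> 1 - g \<omega> = 0" if "\<omega> \<in> space N" for \<omega>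
  proof -
    have "0 \<le> (INF m. H \<omega> (- real m))" by (intro INF_greatest chron_paths_nonneg[OF paths[OF that]])
    then show ?thesis
      unfolding chron_paths_at_bot_iff[OF paths[OF that]] g_def
      by (cases "INF m. H \<omega> (- real m)") auto
  qed
  have "(AE \<omega> in N. (H \<omega> \<longlongrightarrow> 0) at_bot) \<longleftrightarrow> (AE \<omega> in N. 1 - g \<omega> = 0)"
    by (rule AE_cong) (rule lim)
  also have "\<dots> \<longleftrightarrow> (\<integral>\<omega>. 1 - g \<omega> \<partial>N) = 0"
    by (rule integral_nonneg_eq_0_iff_AE[symmetric]) (use gi g1 in auto)
  also have "\<dots> \<longleftrightarrow> measure P {\<omega> \<in> space P. -\<infinity> < \<omega> i} = 1"
    using gi eq by (simp add: N.prob_space)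
  also have "\<dots> \<longleftrightarrow> (AE \<omega> in P. \<omega> \<in> {\<omega> \<in> space P. -\<infinity> < \<omega> i})"
  proof (rule P.prob_eq_1)
    have "(\<lambda>\<omega>. \<omega> i) \<in> borel_measurable P"
      unfolding measurable_cong_sets[OF P(2) refl] by (rule measurable_component_singleton) simp
    then show "{\<omega> \<in> space P. -\<infinity> < \<omega> i} \<in> sets P" by measurable
  qed
  also have "\<dots> \<longleftrightarrow> (AE \<omega> in P. -\<infinity> < \<omega> i)" by (rule AE_cong) simp
  finally show ?thesis .
qed

lemma AE_component_distr:
  fixes X :: "'a \<Rightarrow> nat \<Rightarrow> ereal"
  assumes X: "X \<in> M \<rightarrow>\<^sub>M borel_fun UNIV"
  shows "(AE \<omega> in distr M (borel_fun UNIV) X. -\<infinity> < \<omega> i) \<longleftrightarrow> (AE \<omega> in M. X \<omega> i \<in> {-\<infinity><..\<infinity>})"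
proof (subst AE_distr_iff[OF X])
  have [measurable]: "(\<lambda>\<omega>. \<omega> i) \<in> borel_measurable (borel_fun UNIV :: (nat \<Rightarrow> ereal) measure)"
    by (rule measurable_component_singleton) simp
  show "{\<omega> \<in> space (borel_fun UNIV). -\<infinity> < \<omega> i} \<in> sets (borel_fun UNIV)" by measurable
qed simp

text \<open>Raising all thresholds to a common t only shrinks the event. Its probability is then the
  mean of a power of exp(-H t), positive because H t is finite with positive probability.\<close>

lemma representation_survival_pos:
  fixes X :: "'a \<Rightarrow> nat \<Rightarrow> ereal" and d :: nat
  assumes X: "X \<in> M \<rightarrow>\<^sub>M borel_fun UNIV" and M: "prob_space M" and rep: "chronometer_representation M X N H E"
  shows "\<P>(\<omega> in M. \<forall>k<d. X \<omega> (i k) > ereal (x k)) > 0"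
proof -
  interpret prob_space M by fact
  have N: "prob_space N" "extended_chronometer N H" and fin: "\<And>t. \<P>(\<omega> in N. H \<omega> t = \<infinity>) < 1"
    using rep unfolding chronometer_representation_def by blast+
  interpret N: prob_space N by fact
  note paths = extended_chronometer_paths[OF N(2)]
  have "H \<in> N \<rightarrow>\<^sub>M D_inf_space" using N(2) unfolding extended_chronometer_def by blast
  note [measurable] = D_inf_component[OF this]
  \<comment> \<open>Inserting 0 keeps the maximum defined when d = 0.\<close>
  define t where "t = Max (insert 0 (x ` {..<d}))"
  have t: "x k \<le> t" if "k < d" for k unfolding t_def using that by (intro Max_ge) auto
  \<comment> \<open>Repeated indices collapse in the image, so only distinct coordinates of X
    remain.\<close>
  let ?J = "i ` {..<d}"
  have "survival (distr M (borel_fun UNIV) X) ?J (\<lambda>_. t) = (\<integral>\<omega>. (\<Prod>j\<in>?J. expm (H \<omega> t)) \<partial>N)"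
    by (rule representation_survival[OF X rep]) simp
  also have "\<dots> \<noteq> 0"
  proof
    assume zero: "(\<integral>\<omega>. (\<Prod>j\<in>?J. expm (H \<omega> t)) \<partial>N) = 0"
    have b: "0 \<le> (\<Prod>j\<in>?J. expm (H \<omega> t))" "(\<Prod>j\<in>?J. expm (H \<omega> t)) \<le> 1" if "\<omega> \<in> space N" for \<omega>
      using prod_expm_bounds[of ?J "\<lambda>_. H \<omega> t"] chron_paths_nonneg[OF paths[OF that]] by auto
    have "AE \<omega> in N. (\<Prod>j\<in>?J. expm (H \<omega> t)) = 0"
    proof (rule integral_nonneg_eq_0_iff_AE[THEN iffD1, OF _ _ zero])
      show "integrable N (\<lambda>\<omega>. \<Prod>j\<in>?J. expm (H \<omega> t))"
      proof (rule N.integrable_const_bound[where B = 1])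
        show "AE \<omega> in N. norm (\<Prod>j\<in>?J. expm (H \<omega> t)) \<le> 1"
          by (rule AE_I2) (simp only: real_norm_def abs_of_nonneg[OF b(1)] b(2))
      qed measurable
      show "AE \<omega> in N. 0 \<le> (\<Prod>j\<in>?J. expm (H \<omega> t))" by (rule AE_I2) (rule b(1))
    qed
    then have "AE \<omega> in N. \<omega> \<in> {\<omega> \<in> space N. H \<omega> t = \<infinity>}"
      using AE_space[of N]
    proof eventually_elim
      case (elim \<omega>)
      then show ?case by (cases "H \<omega> t") (auto simp: expm_def)
    qed
    then have "\<P>(\<omega> in N. H \<omega> t = \<infinity>) = 1"
      by (subst N.prob_eq_1) auto
    then show False using fin[of t] by simp
  qed
  finally have "0 < survival (distr M (borel_fun UNIV) X) ?J (\<lambda>_. t)"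
    using survival_nonneg[of "distr M (borel_fun UNIV) X" ?J "\<lambda>_. t"] by linarith
  also have "\<dots> = measure M {\<omega> \<in> space M. \<forall>j\<in>?J. ereal t < X \<omega> j}"
    by (rule survival_distr[OF X]) auto
  also have "\<dots> \<le> \<P>(\<omega> in M. \<forall>k<d. X \<omega> (i k) > ereal (x k))"
  proof (rule finite_measure_mono)
    show "{\<omega> \<in> space M. \<forall>j\<in>?J. ereal t < X \<omega> j} \<subseteq> {\<omega> \<in> space M. \<forall>k<d. X \<omega> (i k) > ereal (x k)}"
    proof safe
      fix \<omega> k assume "\<omega> \<in> space M" and all: "\<forall>j\<in>?J. ereal t < X \<omega> j" and k: "k < d"
      have "ereal (x k) \<le> ereal t" using t[OF k] by simp
      also have "\<dots> < X \<omega> (i k)" using all k by blast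
      finally show "ereal (x k) < X \<omega> (i k)" .
    qed
    note [measurable] = borel_fun_component[OF X]
    have "{\<omega> \<in> space M. \<forall>k\<in>{..<d}. X \<omega> (i k) > ereal (x k)} \<in> sets M"
      by (intro sets.sets_Collect_finite_All) auto
    then show "{\<omega> \<in> space M. \<forall>k<d. X \<omega> (i k) > ereal (x k)} \<in> sets M"
      by (simp only: lessThan_iff Ball_def)
  qed
  finally show ?thesis .
qed

section \<open>From the sequence to the chronometer\<close>

text \<open>The transform uses the times alone and not the labels of the coordinates, so relabelling
  only reindexes a product.\<close>

lemma representation_imp_symmetric:
  fixes X :: "'a \<Rightarrow> nat \<Rightarrow> ereal"
  assumes X: "X \<in> M \<rightarrow>\<^sub>M borel_fun UNIV" and rep: "chronometer_representation M X N H E"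
  shows "symmetric_law (distr M (borel_fun UNIV) X)"
  unfolding symmetric_law_iff
proof (intro allI impI)
  fix J and f :: "nat \<Rightarrow> nat" and x assume J: "finite J" "inj_on f J"
  have "finite (f ` J)" using J by simp
  then have "survival (distr M (borel_fun UNIV) X) (f ` J) (x \<circ> inv_into J f)
      = (\<integral>\<omega>. (\<Prod>j\<in>f ` J. expm (H \<omega> ((x \<circ> inv_into J f) j))) \<partial>N)"
    by (rule representation_survival[OF X rep])
  also have "\<dots> = (\<integral>\<omega>. (\<Prod>j\<in>J. expm (H \<omega> (x j))) \<partial>N)"
    using J by (intro Bochner_Integration.integral_cong refl) (simp add: prod.reindex)
  also have "\<dots> = survival (distr M (borel_fun UNIV) X) J x"
    by (rule representation_survival[OF X rep J(1), symmetric])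
  finally show "survival (distr M (borel_fun UNIV) X) (f ` J) (x \<circ> inv_into J f)
      = survival (distr M (borel_fun UNIV) X) J x" .
qed

text \<open>De Finetti gives each root Q a process of its own. The sum of n independent copies has
  the transforms of D, and transforms determine the law.\<close>

lemma id_process_of_roots:
  assumes D: "prob_space D" "sets D = sets chron_space"
    and root: "\<And>n. 1 \<le> n \<Longrightarrow> \<exists>Q. prob_space Q \<and> sets Q = sets (borel_fun UNIV) \<and> symmetric_law Q \<and>
      (\<forall>J x. finite J \<longrightarrow> survival Q J x ^ n = (\<integral>h. (\<Prod>j\<in>J. expm (h (x j))) \<partial>D))"
  shows "id_process (D \<Otimes>\<^sub>M exponentials) fst"
proof -
  let ?N = "D \<Otimes>\<^sub>M exponentials"
  interpret D: prob_space D by fact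
  interpret E: prob_space exponentials by (rule prob_space_exponentials)
  interpret pair_prob_space D exponentials ..
  note paths = fst_chron_paths[OF D(2)]
  have "fst \<in> ?N \<rightarrow>\<^sub>M D_inf_space" by (rule independent_fst_snd[OF D, unfolded independent_def, THEN conjunct1])
  then have m: "fst \<in> ?N \<rightarrow>\<^sub>M borel_fun UNIV" by (rule D_inf_space_imp_borel_fun)
  have into: "(\<lambda>h. h) \<in> chron_space \<rightarrow>\<^sub>M borel_fun UNIV"
    by (rule D_inf_space_imp_borel_fun[OF chron_space_into_D_inf])
  have no_MInf: "\<P>(\<omega> in ?N. fst \<omega> t = - \<infinity>) = 0" for t
  proof -
    have "{\<omega> \<in> space ?N. fst \<omega> t = - \<infinity>} = {}"
      using chron_paths_nonneg[OF paths, of _ t] by force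
    then show ?thesis by (simp only: measure_empty)
  qed
  have "\<exists>(K :: (nat \<Rightarrow> real \<Rightarrow> ereal) measure) Y. iid K (borel_fun UNIV) Y {..<n} \<and>
      eq_fin_dim_distributions ?N fst K (\<lambda>\<omega> t. \<Sum>i<n. Y i \<omega> t)" if n: "1 \<le> n" for n :: nat
  proof -
    obtain Q where Q: "prob_space Q" "sets Q = sets (borel_fun UNIV)" "symmetric_law Q"
      and surv: "\<And>J x. finite J \<Longrightarrow> survival Q J x ^ n = (\<integral>h. (\<Prod>j\<in>J. expm (h (x j))) \<partial>D)"
      using root[OF n] by blast
    obtain H where H: "H \<in> Q \<rightarrow>\<^sub>M borel_fun UNIV" "\<And>\<omega>. H \<omega> \<in> chron_paths"
      and lap: "\<And>J x. finite J \<Longrightarrow> (\<integral>\<omega>. (\<Prod>j\<in>J. expm (H \<omega> (x j))) \<partial>Q) = survival Q J x"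
      using de_finetti_chronometer[OF Q] by blast
    have Hc: "H \<in> Q \<rightarrow>\<^sub>M chron_space" by (rule measurable_into_chron_space[OF H])
    \<comment> \<open>Moving the law to \<open>chron_space\<close> makes every summand a good path
      at every outcome of the product.\<close>
    define L where "L = distr Q chron_space H"
    have L: "prob_space L" unfolding L_def by (rule prob_space.prob_space_distr[OF Q(1) Hc])
    have Ls: "sets L = sets chron_space" by (simp add: L_def)
    have idL: "(\<lambda>h. h) \<in> L \<rightarrow>\<^sub>M borel_fun UNIV"
      unfolding measurable_cong_sets[OF Ls refl] by (rule into)
    define K where "K = (\<Pi>\<^sub>M i\<in>{..<n}. L)"
    have iid: "iid K (borel_fun UNIV) (\<lambda>i \<omega>. \<omega> i) {..<n}"
      unfolding K_def by (rule iid_PiM[OF L idL n])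
    note Y = iidD[OF iid]
    have Kpaths: "\<omega> i \<in> chron_paths" if "\<omega> \<in> space K" "i < n" for \<omega> i
      using that space_chron_space sets_eq_imp_space_eq[OF Ls] by (auto simp: K_def space_PiM)
    let ?Z = "\<lambda>\<omega> t. \<Sum>i<n. (\<omega> :: nat \<Rightarrow> real \<Rightarrow> ereal) i t"
    have Z: "?Z \<in> K \<rightarrow>\<^sub>M borel_fun UNIV"
    proof (rule measurable_PiM_single')
      fix t show "(\<lambda>\<omega>. ?Z \<omega> t) \<in> borel_measurable K"
        by (rule borel_measurable_ereal_sum) (rule borel_fun_component[OF Y(3)], simp)
    qed (auto simp: space_PiM)
    have lapZ: "(\<integral>\<omega>. (\<Prod>j\<in>J. expm (?Z \<omega> (x j))) \<partial>K) = (\<integral>h. (\<Prod>j\<in>J. expm (h (x j))) \<partial>D)"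
      if J: "finite J" for J :: "nat set" and x
    proof -
      have "(\<integral>\<omega>. (\<Prod>j\<in>J. expm (?Z \<omega> (x j))) \<partial>K) = (\<integral>\<omega>. (\<Prod>j\<in>J. expm (\<omega> 0 (x j))) \<partial>K) ^ n"
        by (rule iid_laplace_sum[OF iid n J]) (auto intro!: AE_I2 chron_paths_nonneg Kpaths)
      also have "(\<integral>\<omega>. (\<Prod>j\<in>J. expm (\<omega> 0 (x j))) \<partial>K) = (\<integral>h. (\<Prod>j\<in>J. expm (h (x j))) \<partial>distr K L (\<lambda>\<omega>. \<omega> 0))"
        unfolding K_def
        by (rule integral_distr[symmetric, OF measurable_component_singleton])
          (use n in simp, unfold measurable_cong_sets[OF Ls refl], rule prod_expm_measurable)
      also have "distr K L (\<lambda>\<omega>. \<omega> 0) = L"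
        unfolding K_def by (rule distr_PiM_component) (use L n in auto)
      also have "(\<integral>h. (\<Prod>j\<in>J. expm (h (x j))) \<partial>L) = (\<integral>\<omega>. (\<Prod>j\<in>J. expm (H \<omega> (x j))) \<partial>Q)"
        unfolding L_def by (rule integral_distr[OF Hc prod_expm_measurable])
      also have "\<dots> = survival Q J x" by (rule lap[OF J])
      finally show ?thesis by (simp only: surv[OF J])
    qed
    have law: "distr ?N (borel_fun UNIV) fst = distr K (borel_fun UNIV) ?Z"
    proof (rule process_law_eqI[OF prob_space_axioms m _ Y(1) Z])
      show "0 \<le> fst \<omega> t" if "\<omega> \<in> space ?N" for \<omega> t by (rule chron_paths_nonneg[OF paths[OF that]])
      show "0 \<le> ?Z \<omega> t" if "\<omega> \<in> space K" for \<omega> t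
        by (intro sum_nonneg chron_paths_nonneg[OF Kpaths[OF that]]) simp
      show "(\<integral>\<omega>. (\<Prod>k<d. expm (fst \<omega> (t k))) \<partial>?N) = (\<integral>\<omega>. (\<Prod>k<d. expm (?Z \<omega> (t k))) \<partial>K)" for d :: nat and t
        unfolding laplace_fst[OF D(2)] by (rule lapZ[symmetric]) simp
    qed
    have "eq_fin_dim_distributions ?N fst K ?Z"
      unfolding eq_fin_dim_distributions_def eq_in_distribution_def
    proof (intro allI impI conjI)
      fix J :: "real set"
      have r: "(\<lambda>h. restrict h J) \<in> borel_fun UNIV \<rightarrow>\<^sub>M borel_fun J" by (rule measurable_restrict_subset) simp
      show "(\<lambda>\<omega>. restrict (fst \<omega>) J) \<in> ?N \<rightarrow>\<^sub>M borel_fun J" by (rule measurable_compose[OF m r])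
      show "(\<lambda>\<omega>. restrict (?Z \<omega>) J) \<in> K \<rightarrow>\<^sub>M borel_fun J" by (rule measurable_compose[OF Z r])
      show "distr ?N (borel_fun J) (\<lambda>\<omega>. restrict (fst \<omega>) J) = distr K (borel_fun J) (\<lambda>\<omega>. restrict (?Z \<omega>) J)"
        using distr_distr[OF r m] distr_distr[OF r Z] law by (simp add: o_def)
    qed
    with iid show ?thesis by blast
  qed
  then show ?thesis using m no_MInf unfolding id_process_def by blast
qed

text \<open>The de Finetti process lives on sequence space, where no independent exponentials are at
  hand. Its law is therefore carried over to paths and multiplied by the law of the levels.\<close>

lemma exists_representation:
  fixes M :: "'a measure" and X :: "'a \<Rightarrow> nat \<Rightarrow> ereal"
  assumes M: "prob_space M" and X: "X \<in> M \<rightarrow>\<^sub>M borel_fun UNIV"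
    and ex: "exchangeable M X" and min: "min_id_sequence M X"
    and fin: "\<And>i. AE \<omega> in M. X \<omega> i \<in> {-\<infinity><..\<infinity>}"
    and pos: "\<And>d (i :: nat \<Rightarrow> nat) (x :: nat \<Rightarrow> real). \<P>(\<omega> in M. \<forall>k<d. X \<omega> (i k) > ereal (x k)) > 0"
  shows "\<exists>(N :: ((real \<Rightarrow> ereal) \<times> (nat \<Rightarrow> real)) measure) H E. chronometer_representation M X N H E"
proof -
  define P where "P = distr M (borel_fun UNIV) X"
  have P: "prob_space P" "sets P = sets (borel_fun UNIV)"
    unfolding P_def by (rule prob_space.prob_space_distr[OF M X]) simp
  have sym: "symmetric_law P" using ex exchangeable_iff_symmetric_law[OF M X] by (simp add: P_def)
  obtain H where H: "H \<in> P \<rightarrow>\<^sub>M borel_fun UNIV" "\<And>\<omega>. H \<omega> \<in> chron_paths"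
    and lap: "\<And>J x. finite J \<Longrightarrow> (\<integral>\<omega>. (\<Prod>j\<in>J. expm (H \<omega> (x j))) \<partial>P) = survival P J x"
    using de_finetti_chronometer[OF P sym] by blast
  have Hc: "H \<in> P \<rightarrow>\<^sub>M chron_space" by (rule measurable_into_chron_space[OF H])
  define D where "D = distr P chron_space H"
  have D: "prob_space D" "sets D = sets chron_space"
    unfolding D_def by (rule prob_space.prob_space_distr[OF P(1) Hc]) simp
  have lapD: "(\<integral>h. (\<Prod>j\<in>J. expm (h (x j))) \<partial>D) = survival P J x" if J: "finite J" for J x
    unfolding lap[OF J, symmetric] D_def by (rule integral_distr[OF Hc prod_expm_measurable])
  let ?N = "D \<Otimes>\<^sub>M exponentials"
  interpret D: prob_space D by fact
  interpret E: prob_space exponentials by (rule prob_space_exponentials)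
  interpret pair_prob_space D exponentials ..
  note paths = fst_chron_paths[OF D(2)]
  note ind = independent_fst_snd[OF D]
  note fst_D = ind[unfolded independent_def, THEN conjunct1]
    and snd_E = ind[unfolded independent_def, THEN conjunct2, THEN conjunct1]
  note fst_B = D_inf_space_imp_borel_fun[OF fst_D]
  have fp: "(\<lambda>\<omega>. first_passage (fst \<omega>) (snd \<omega>)) \<in> ?N \<rightarrow>\<^sub>M borel_fun UNIV"
    by (rule first_passage_measurable[where H = fst and E = snd, OF paths fst_D snd_E])
  have lapN: "(\<integral>\<omega>. (\<Prod>j\<in>J. expm (fst \<omega> (x j))) \<partial>?N) = survival P J x" if J: "finite J" for J x
    unfolding laplace_fst[OF D(2)] by (rule lapD[OF J])
  have "id_process ?N fst"
  proof (rule id_process_of_roots[OF D])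
    fix n :: nat assume n: "1 \<le> n"
    obtain Q where Q: "prob_space Q" "sets Q = sets (borel_fun UNIV)"
      "\<And>J x. finite J \<Longrightarrow> survival Q J x ^ n = survival P J x"
      using min_id_sequence_imp_root[OF X min n] unfolding P_def by blast
    have "symmetric_law Q" by (rule symmetric_law_root[OF sym n Q(3)])
    then show "\<exists>Q. prob_space Q \<and> sets Q = sets (borel_fun UNIV) \<and> symmetric_law Q \<and>
      (\<forall>J x. finite J \<longrightarrow> survival Q J x ^ n = (\<integral>h. (\<Prod>j\<in>J. expm (h (x j))) \<partial>D))"
      using Q lapD by (intro exI[of _ Q]) simp
  qed
  then have chron: "extended_chronometer ?N fst"
    unfolding extended_chronometer_def
    using fst_D paths by (auto simp: chron_paths_def)
  have law: "distr M (borel_fun UNIV) X = distr ?N (borel_fun UNIV) (\<lambda>\<omega>. first_passage (fst \<omega>) (snd \<omega>))"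
  proof (rule measure_eqI_survival)
    show "prob_space (distr M (borel_fun UNIV) X)" by (rule prob_space.prob_space_distr[OF M X])
    show "prob_space (distr ?N (borel_fun UNIV) (\<lambda>\<omega>. first_passage (fst \<omega>) (snd \<omega>)))" by (rule prob_space_distr[OF fp])
    fix J x assume J: "finite J" "J \<subseteq> (UNIV :: nat set)"
    show "survival (distr M (borel_fun UNIV) X) J x
        = survival (distr ?N (borel_fun UNIV) (\<lambda>\<omega>. first_passage (fst \<omega>) (snd \<omega>))) J x"
      using passage_law(3)[OF D J(1), of x] lapD[OF J(1), of x] unfolding passage_law_def P_def by simp
  qed simp_all
  have bot: "AE \<omega> in ?N. (fst \<omega> \<longlongrightarrow> 0) at_bot"
  proof (rule AE_at_bot_iff[OF prob_space_axioms fst_B paths P, THEN iffD2])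
    show "survival P {0} (\<lambda>_. - real m) = (\<integral>\<omega>. expm (fst \<omega> (- real m)) \<partial>?N)" for m :: nat
      using lapN[of "{0}" "\<lambda>_. - real m"] by simp
    show "AE \<omega> in P. -\<infinity> < \<omega> 0" unfolding P_def AE_component_distr[OF X] by (rule fin)
  qed
  \<comment> \<open>If H t were \<infinity> almost surely, its transform at t would vanish, and with
    it the probability that X 0 exceeds t.\<close>
  have finite: "\<P>(\<omega> in ?N. fst \<omega> t = \<infinity>) < 1" for t
  proof (rule ccontr)
    note [measurable] = D_inf_component[OF fst_D]
    assume "\<not> \<P>(\<omega> in ?N. fst \<omega> t = \<infinity>) < 1"
    then have "\<P>(\<omega> in ?N. fst \<omega> t = \<infinity>) = 1" by (intro antisym prob_le_1) simp
    then have "AE \<omega> in ?N. fst \<omega> t = \<infinity>"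
      by (subst (asm) prob_eq_1) (auto elim: eventually_mono)
    then have "AE \<omega> in ?N. expm (fst \<omega> t) = 0" by eventually_elim simp
    then have "(\<integral>\<omega>. expm (fst \<omega> t) \<partial>?N) = 0" by (rule integral_eq_zero_AE)
    then have "survival P {0} (\<lambda>_. t) = 0" using lapN[of "{0}" "\<lambda>_. t"] by simp
    moreover have "survival P {0} (\<lambda>_. t) = \<P>(\<omega> in M. \<forall>k<1::nat. X \<omega> 0 > ereal t)"
      unfolding P_def by (subst survival_distr[OF X]) auto
    ultimately show False using pos[where d = 1 and i = "\<lambda>_. 0" and x = "\<lambda>_. t"] by simp
  qed
  have "chronometer_representation M X ?N fst snd"
    unfolding chronometer_representation_def eq_in_distribution_def
    using prob_space_axioms chron bot finite unit_exponentials_snd[OF D(1)] ind X fp law by blast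
  then show ?thesis by blast
qed

theorem theorem3p1:
  fixes M :: "'a measure" and X :: "'a \<Rightarrow> nat \<Rightarrow> ereal"
  assumes "prob_space M" and "X \<in> M \<rightarrow>\<^sub>M (\<Pi>\<^sub>M i\<in>UNIV. borel)"
  shows
    "((exchangeable M X \<and> min_id_sequence M X \<and>
       (\<forall>i. AE \<omega> in M. X \<omega> i \<in> {-\<infinity><..\<infinity>}) \<and>
       (\<forall>d (i :: nat \<Rightarrow> nat) (x :: nat \<Rightarrow> real).
          \<P>(\<omega> in M. \<forall>k<d. X \<omega> (i k) > ereal (x k)) > 0))
      \<longleftrightarrow>
      (\<exists>(N :: ((real \<Rightarrow> ereal) \<times> (nat \<Rightarrow> real)) measure) H E.
         chronometer_representation M X N H E))
     \<and>
     (\<forall>(N :: 'b measure) H E (N' :: 'c measure) H' E'.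
        chronometer_representation M X N H E \<longrightarrow>
        chronometer_representation M X N' H' E' \<longrightarrow>
        distr N D_inf_space H = distr N' D_inf_space H')"
proof (intro conjI iffI allI impI)
  assume "exchangeable M X \<and> min_id_sequence M X \<and>
       (\<forall>i. AE \<omega> in M. X \<omega> i \<in> {-\<infinity><..\<infinity>}) \<and>
       (\<forall>d (i :: nat \<Rightarrow> nat) (x :: nat \<Rightarrow> real).
          \<P>(\<omega> in M. \<forall>k<d. X \<omega> (i k) > ereal (x k)) > 0)"
  then show "\<exists>(N :: ((real \<Rightarrow> ereal) \<times> (nat \<Rightarrow> real)) measure) H E. chronometer_representation M X N H E"
    by (intro exists_representation[OF assms]) simp_all
next
  fix N :: "'b measure" and H E and N' :: "'c measure" and H' E'
  assume "chronometer_representation M X N H E" "chronometer_representation M X N' H' E'"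
  then show "distr N D_inf_space H = distr N' D_inf_space H'"
    by (rule chronometer_law_unique[OF assms(2)])
next
  assume "\<exists>(N :: ((real \<Rightarrow> ereal) \<times> (nat \<Rightarrow> real)) measure) H E. chronometer_representation M X N H E"
  then obtain N :: "((real \<Rightarrow> ereal) \<times> (nat \<Rightarrow> real)) measure" and H E
    where rep: "chronometer_representation M X N H E" by blast
  note X = assms(2)
  have N: "prob_space N" "extended_chronometer N H" "AE \<omega> in N. (H \<omega> \<longlongrightarrow> 0) at_bot"
    using rep unfolding chronometer_representation_def by blast+
  have H: "H \<in> N \<rightarrow>\<^sub>M borel_fun UNIV"
    using N(2) D_inf_space_imp_borel_fun unfolding extended_chronometer_def by blast
  show "exchangeable M X"
    using exchangeable_iff_symmetric_law[OF assms] representation_imp_symmetric[OF X rep] by blast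
  show "min_id_sequence M X" by (rule representation_imp_min_id[OF assms rep])
  show "AE \<omega> in M. X \<omega> i \<in> {-\<infinity><..\<infinity>}" for i
    unfolding AE_component_distr[OF X, symmetric]
  proof (rule AE_at_bot_iff[OF N(1) H extended_chronometer_paths[OF N(2)], THEN iffD1])
    show "survival (distr M (borel_fun UNIV) X) {i} (\<lambda>_. - real m) = (\<integral>\<omega>. expm (H \<omega> (- real m)) \<partial>N)" for m :: nat
      using representation_survival[OF X rep, of "{i}" "\<lambda>_. - real m"] by simp
  qed (use N(3) prob_space.prob_space_distr[OF assms] in auto)
  show "0 < \<P>(\<omega> in M. \<forall>k<d. X \<omega> (i k) > ereal (x k))" for d and i :: "nat \<Rightarrow> nat" and x :: "nat \<Rightarrow> real"
    by (rule representation_survival_pos[OF X assms(1) rep])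
qed

end
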